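(* Let $m\ge 2$ and let $T$ be an $m$-variable operator (a map sending $m$-tuples of measurable functions on $\mathbb{R}^n$ to measurable functions on $\mathbb{R}^n$). Let $\mathbb{F}$ be a fixed collection of $m$-tuples of measurable functions on which $T$ is defined. Let $\vec p=(p_1,\dots,p_m)$ with $1\le p_1,\dots,p_m\le\infty$ and let $\frac1p=\frac1{p_1}+\dots+\frac1{p_m}\in[0,m]$. Assume that for every $\vec w=(w_1,\dots,w_m)\in A_{\vec p}$ the inequality $$\|T(f_1,\dots,f_m)\,w\|_{L^p}\lesssim\prod_{i=1}^m\|f_iw_i\|_{L^{p_i}}$$ holds for every $(f_1,\dots,f_m)\in\mathbb{F}$, where $w:=\prod_{i=1}^m w_i$. Then for all exponents $\vec q=(q_1,\dots,q_m)$ with $1<q_1,\dots,q_m\le\infty$ and $\frac1q=\frac1{q_1}+\dots+\frac1{q_m}>0$, and for all weights $\vec v=(v_1,\dots,v_m)\in A_{\vec q}$, the inequality $$\|T(f_1,\dots,f_m)\,v\|_{L^q}\lesssim\prod_{i=1}^m\|f_iv_i\|_{L^{q_i}}$$ holds for every $(f_1,\dots,f_m)\in\mathbb{F}$, where $v:=\prod_{i=1}^m v_i$. Moreover, for the same family of exponents $\vec q$ and weights $\vec v$, and for all exponents $\vec s=(s_1,\dots,s_m)$ with $1<s_1,\dots,s_m\le\infty$ and $\frac1s=\frac1{s_1}+\dots+\frac1{s_m}>0$, the inequality $$\Big\|\big\{T(f_1^j,\dots,f_m^j)\,v\big\}_j\Big\|_{L^q_{\ell^s}}\lesssim\prod_{i=1}^m\Big\|\big\{f_i^jv_i\big\}_j\Big\|_{L^{q_i}_{\ell^{s_i}}}$$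 holds for all sequences $\{(f_1^j,\dots,f_m^j)\}_j\subset\mathbb{F}$.
   Context: All function spaces are over $\mathbb{R}^n$ with Lebesgue measure; $L^p$ with $0<p<1$ carries the usual quasi-norm. $Q$ denotes cubes in $\mathbb{R}^n$, and averages are $\frac1{|Q|}\int_Q$. $p_i'$ is the conjugate exponent of $p_i$. Class $A_{\vec p}$: given $\vec p=(p_1,\dots,p_m)$ with $1\le p_i\le\infty$ and $\frac1p=\sum_i\frac1{p_i}$, $\vec w=(w_1,\dots,w_m)\in A_{\vec p}$ means that each $w_i$ is measurable with $0<w_i<\infty$ a.e. and, with $w=\prod_{i=1}^m w_i$, $$[\vec w]_{A_{\vec p}}=\sup_Q\Big(\frac1{|Q|}\int_Q w^p\,dx\Big)^{\frac1p}\prod_{i=1}^m\Big(\frac1{|Q|}\int_Q w_i^{-p_i'}\,dx\Big)^{\frac1{p_i'}}<\infty,$$ where the first factor is replaced by $\operatorname{ess\,sup}_Q w$ if $p=\infty$, the factor for $w_i$ is replaced by $\operatorname{ess\,sup}_Q w_i^{-1}$ if $p_i=1$, and $p_i'=1$ if $p_i=\infty$. Vector-valued norm: $\|\{g_j\}_j\|_{L^q_{\ell^s}}=\big\|\,\|\{g_j\}_j\|_{\ell^s}\,\big\|_{L^q}$, with $\ell^\infty$ meaning the supremum over $j$. Convention on $\lesssim$: in the hypothesis and in the conclusions, the implicit constant is independent of the functions and depends on the weights only through a non-decreasing function of the corresponding constant $[\vec w]_{A_{\vec p}}$ or $[\vec v]_{A_{\vec q}}$ (besides the dimension and the exponents).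 *)

theory Defs
  imports "HOL-Probability.Essential_Supremum"
begin

(* Exponents are elements of [0,\<infinity>] (type ennreal), with inverse \<infinity> = 0 and inverse 0 = \<infinity>.
   Norms take values in [0,\<infinity>], with the measure-theoretic convention 0 * \<infinity> = 0. *)

(* x^a on [0,\<infinity>]; only used with a > 0. *)
definition ennpowr :: "ennreal \<Rightarrow> real \<Rightarrow> ennreal" where
  "ennpowr x a = (if x = \<infinity> then \<infinity> else ennreal (enn2real x powr a))"

(* The exponent p with 1/p = sum of 1/p_i. *)
definition harmonic_exponent :: "('m::finite \<Rightarrow> ennreal) \<Rightarrow> ennreal" where
  "harmonic_exponent p = inverse (\<Sum>i\<in>UNIV. inverse (p i))"

(* The solution of 1/p + 1/p' = 1, for 1 \<le> p \<le> \<infinity>: it is \<infinity> at p = 1 and 1 at p = \<infinity>. *)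
definition conjugate_exponent :: "ennreal \<Rightarrow> ennreal" where
  "conjugate_exponent p = inverse (1 - inverse p)"

(* The (quasi-)norm of L^p for 0 < p \<le> \<infinity>, on functions with values in [0,\<infinity>]. *)
definition Lp_ennnorm :: "ennreal \<Rightarrow> (real^'n \<Rightarrow> ennreal) \<Rightarrow> ennreal" where
  "Lp_ennnorm p g =
     (if p = \<infinity> then esssup lebesgue g
      else ennpowr (\<integral>\<^sup>+x. ennpowr (g x) (enn2real p) \<partial>lebesgue) (1 / enn2real p))"

definition Lp_norm :: "ennreal \<Rightarrow> (real^'n \<Rightarrow> complex) \<Rightarrow> ennreal" where
  "Lp_norm p g = Lp_ennnorm p (\<lambda>x. ennreal (cmod (g x)))"

definition lseq_norm :: "ennreal \<Rightarrow> (nat \<Rightarrow> complex) \<Rightarrow> ennreal" where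
  "lseq_norm s a =
     (if s = \<infinity> then (SUP j. ennreal (cmod (a j)))
      else ennpowr (\<Sum>j. ennreal (cmod (a j) powr enn2real s)) (1 / enn2real s))"

definition Lp_lseq_norm :: "ennreal \<Rightarrow> ennreal \<Rightarrow> (nat \<Rightarrow> real^'n \<Rightarrow> complex) \<Rightarrow> ennreal" where
  "Lp_lseq_norm q s g = Lp_ennnorm q (\<lambda>x. lseq_norm s (\<lambda>j. g j x))"

definition cubes :: "(real^'n) set set" where
  "cubes = {cbox a (\<chi> i. a $ i + l) | a l. 0 < l}"

definition average :: "(real^'n) set \<Rightarrow> (real^'n \<Rightarrow> ennreal) \<Rightarrow> ennreal" where
  "average Q h = (\<integral>\<^sup>+x\<in>Q. h x \<partial>lebesgue) / emeasure lebesgue Q"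

definition esssup_on :: "(real^'n) set \<Rightarrow> (real^'n \<Rightarrow> ennreal) \<Rightarrow> ennreal" where
  "esssup_on Q h = esssup (restrict_space lebesgue Q) h"

definition prod_weight :: "('m::finite \<Rightarrow> real^'n \<Rightarrow> real) \<Rightarrow> real^'n \<Rightarrow> real" where
  "prod_weight w x = (\<Prod>i\<in>UNIV. w i x)"

definition product_factor :: "ennreal \<Rightarrow> (real^'n) set \<Rightarrow> (real^'n \<Rightarrow> real) \<Rightarrow> ennreal" where
  "product_factor p Q W =
     (if p = \<infinity> then esssup_on Q (\<lambda>x. ennreal (W x))
      else ennpowr (average Q (\<lambda>x. ennreal (W x powr enn2real p))) (1 / enn2real p))"

definition dual_factor :: "ennreal \<Rightarrow> (real^'n) set \<Rightarrow> (real^'n \<Rightarrow> real) \<Rightarrow> ennreal" where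
  "dual_factor r Q u =
     (if r = 1 then esssup_on Q (\<lambda>x. ennreal (inverse (u x)))
      else let r' = enn2real (conjugate_exponent r)
           in ennpowr (average Q (\<lambda>x. ennreal (u x powr (- r')))) (1 / r'))"

definition Ap_constant ::
  "('m::finite \<Rightarrow> ennreal) \<Rightarrow> ('m \<Rightarrow> real^'n \<Rightarrow> real) \<Rightarrow> ennreal" where
  "Ap_constant p w =
     (SUP Q\<in>cubes. product_factor (harmonic_exponent p) Q (prod_weight w)
        * (\<Prod>i\<in>UNIV. dual_factor (p i) Q (w i)))"

(* Weights are real-valued, so that w_i < \<infinity> is automatic; values on a null set are irrelevant. *)
definition Ap_class :: "('m::finite \<Rightarrow> ennreal) \<Rightarrow> ('m \<Rightarrow> real^'n \<Rightarrow> real) set" where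
  "Ap_class p = {w. (\<forall>i. w i \<in> borel_measurable lebesgue \<and> (AE x in lebesgue. 0 < w i x))
                    \<and> Ap_constant p w < \<infinity>}"

definition weighted :: "(real^'n \<Rightarrow> complex) \<Rightarrow> (real^'n \<Rightarrow> real) \<Rightarrow> real^'n \<Rightarrow> complex" where
  "weighted g u x = g x * complex_of_real (u x)"

end

theory Submission
  imports Defs
begin

text \<open>The weights are put in a symmetric form: with \<open>v\<^sub>0 = 1 / (v\<^sub>1 \<cdots> v\<^sub>m)\<close> the class \<open>A\<^sub>q\<close> says that
  \<open>\<Prod>\<^sub>i \<langle>v\<^sub>i\<^sup>-\<^sup>1\<rangle>\<close> is bounded over cubes, where the \<open>i\<close>-th average is taken in \<open>L\<^sup>1\<^sup>/\<^sup>\<alpha>\<close> for \<open>\<alpha> = \<alpha>\<^sub>i\<close>, and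
  \<open>\<alpha>\<^sub>i = 1 - 1/q\<^sub>i\<close>, \<open>\<alpha>\<^sub>0 = 1/q\<close>. The sum of the \<open>\<alpha>\<^sub>i\<close> does not depend on \<open>q\<close>, so one passes from \<open>q\<close> to \<open>p\<close> by
  finitely many steps that only increase \<open>\<alpha>\<^sub>i\<close> and decrease \<open>\<alpha>\<^sub>j\<close> by some \<open>d\<close>. Such a step replaces \<open>v\<^sub>i, v\<^sub>j\<close>
  by \<open>v\<^sub>i H\<^sup>-\<^sup>d, v\<^sub>j H\<^sup>d\<close>, where \<open>H\<close> is an integrable majorant of \<open>\<bar>f\<^sub>i v\<^sub>i\<bar>\<close> to the power \<open>q\<^sub>i\<close>, found by the Rubio de
  Francia algorithm. The sublinear operator to be iterated is bounded because the averages of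
  \<open>s\<^sub>i = v\<^sub>i\<^sup>-\<^sup>1\<^sup>/\<^sup>\<alpha>\<close> and \<open>s\<^sub>j\<close> are comparable with that of their geometric mean (Hoelder with the remaining
  weights), which permits Lerner's proof of Muckenhoupt's theorem: two applications of Doob's inequality, for the measures
  \<open>s\<^sub>i dx\<close> and \<open>s\<^sub>j dx\<close>. The estimate for \<open>T\<close> is recovered from the weights by duality.\<close>

section \<open>Hoelder's inequality in reciprocal exponents\<close>

text \<open>The assumptions \<open>1 < q i\<close> and 1/q > 0 say exactly that all starting
  exponents are positive, which the maximal theorems behind a step require. The target may have zero
  exponents (\<open>p i = 1\<close> or p = \<infinity>), so the steps are arranged to let an
  exponent vanish only when it arrives at its final value. The weights made by a step depend on the
  functions, but their class constant depends only on the old one; hence everything is proved for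
  one tuple at a time.

  Duality has to work for q < 1 as well, where \<open>L^q\<close> has no useful dual. A function y
  is therefore tested against one power of itself, in a space chosen so that the product lies in
  \<open>L^(1/t)\<close> with t larger than both 1/q and 1/p. The test function takes the slot of
  the weight \<open>v\<^sub>0\<close> and is carried through the steps with the other m functions.

  No property of T is used beyond the given estimate for |T f| and the |f_i|. This is what allows a
  second extrapolation, from s to q, for sequence norms in place of functions.\<close>

lemma ennpowr_ennreal: "0 \<le> x \<Longrightarrow> ennpowr (ennreal x) a = ennreal (x powr a)"
  by (simp add: ennpowr_def)

lemma ennpowr_top [simp]: "ennpowr top a = top"
  by (simp add: ennpowr_def)

lemma ennpowr_zero [simp]: "ennpowr 0 a = 0"
  by (simp add: ennpowr_def)

lemma ennpowr_one [simp]: "ennpowr 1 a = 1"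
  by (simp add: ennpowr_def)

lemma ennpowr_one_right [simp]: "ennpowr x 1 = x"
  by (cases x rule: ennreal_cases) (simp_all add: ennpowr_ennreal)

lemma ennpowr_eq_0_iff [simp]: "ennpowr x a = 0 \<longleftrightarrow> x = 0"
  by (cases x rule: ennreal_cases) (auto simp: ennpowr_ennreal ennreal_eq_0_iff)

lemma ennpowr_eq_top_iff [simp]: "ennpowr x a = top \<longleftrightarrow> x = top"
  by (cases x rule: ennreal_cases) (auto simp: ennpowr_ennreal)

lemma ennpowr_mult: "ennpowr (x * y) a = ennpowr x a * ennpowr y a"
proof (cases "x = top \<or> y = top")
  case True
  then show ?thesis
    by (auto simp: ennreal_mult_top ennreal_top_mult)
next
  case False
  then obtain r s where "x = ennreal r" "0 \<le> r" "y = ennreal s" "0 \<le> s"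
    by (metis ennreal_cases)
  then show ?thesis
    by (simp add: ennpowr_ennreal flip: ennreal_mult) (simp add: powr_mult)
qed

lemma ennpowr_ennpowr: "ennpowr (ennpowr x a) b = ennpowr x (a * b)"
  by (cases x rule: ennreal_cases) (simp_all add: ennpowr_ennreal powr_powr)

lemma ennpowr_add: "ennpowr x (a + b) = ennpowr x a * ennpowr x b"
  by (cases x rule: ennreal_cases)
     (simp_all add: ennpowr_ennreal powr_add ennreal_mult' ennreal_top_mult)

lemma ennpowr_mono: "x \<le> y \<Longrightarrow> 0 \<le> a \<Longrightarrow> ennpowr x a \<le> ennpowr y a"
  by (cases x rule: ennreal_cases; cases y rule: ennreal_cases)
     (auto simp: ennpowr_ennreal powr_mono2 top_unique)

lemma ennpowr_le_iff: "0 < a \<Longrightarrow> ennpowr x a \<le> y \<longleftrightarrow> x \<le> ennpowr y (1 / a)"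
  using ennpowr_mono [of "ennpowr x a" y "1 / a"] ennpowr_mono [of x "ennpowr y (1 / a)" a]
  by (auto simp: ennpowr_ennpowr)

lemma ennpowr_SUP:
  assumes "0 < a" "I \<noteq> {}"
  shows "ennpowr (SUP i\<in>I. x i) a = (SUP i\<in>I. ennpowr (x i) a)"
proof (rule antisym)
  have "x i \<le> ennpowr (SUP i\<in>I. ennpowr (x i) a) (1 / a)" if "i \<in> I" for i
    using assms that by (subst ennpowr_le_iff [symmetric]) (auto intro: SUP_upper)
  then show "ennpowr (SUP i\<in>I. x i) a \<le> (SUP i\<in>I. ennpowr (x i) a)"
    using assms by (subst ennpowr_le_iff) (auto intro: SUP_least)
  show "(SUP i\<in>I. ennpowr (x i) a) \<le> ennpowr (SUP i\<in>I. x i) a"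
    using assms by (intro SUP_least ennpowr_mono SUP_upper) auto
qed

lemma borel_measurable_ennpowr [measurable (raw)]:
  assumes [measurable]: "f \<in> borel_measurable M"
  shows "(\<lambda>x. ennpowr (f x) a) \<in> borel_measurable M"
  unfolding ennpowr_def by measurable

lemma ennpowr_Young:
  assumes "0 < t" "t < 1"
  shows "ennpowr x t * ennpowr y (1 - t) \<le> ennreal t * x + ennreal (1 - t) * y"
proof (cases "x = top \<or> y = top")
  case True
  then show ?thesis
    using assms by (auto simp: ennreal_mult_top)
next
  case False
  then obtain r s where rs: "x = ennreal r" "0 \<le> r" "y = ennreal s" "0 \<le> s"
    by (metis ennreal_cases)
  have "r powr t * s powr (1 - t) \<le> t * r + (1 - t) * s"
  proof (cases "r = 0 \<or> s = 0")
    case True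
    then show ?thesis using assms rs by auto
  qed (use assms rs in \<open>auto intro!: Youngs_inequality_0\<close>)
  then have "ennreal (r powr t * s powr (1 - t)) \<le> ennreal (t * r + (1 - t) * s)"
    by (rule ennreal_leI)
  then show ?thesis
    using rs assms by (simp add: ennpowr_ennreal ennreal_mult'' ennreal_mult)
qed

text \<open>Normalising both integrals to 1 reduces this to the pointwise Young inequality. Zero and
  infinite integrals cannot be normalised and are split off, with 0 * \<infinity> = 0.\<close>

lemma nn_integral_Holder:
  assumes [measurable]: "f \<in> borel_measurable M" "g \<in> borel_measurable M" and t: "0 < t" "t < 1"
  shows "(\<integral>\<^sup>+x. ennpowr (f x) t * ennpowr (g x) (1 - t) \<partial>M)
     \<le> ennpowr (\<integral>\<^sup>+x. f x \<partial>M) t * ennpowr (\<integral>\<^sup>+x. g x \<partial>M) (1 - t)"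
    (is "?L \<le> ennpowr ?A t * ennpowr ?B (1 - t)")
proof -
  consider "?A = 0" | "?B = 0" | "?A \<noteq> 0" "?B \<noteq> 0" "?A = top \<or> ?B = top"
    | "?A \<noteq> 0" "?A \<noteq> top" "?B \<noteq> 0" "?B \<noteq> top" by blast
  then show ?thesis
  proof cases
    case 1
    then have "AE x in M. f x = 0" by (subst (asm) nn_integral_0_iff_AE) auto
    then have "AE x in M. ennpowr (f x) t * ennpowr (g x) (1 - t) = 0" by eventually_elim simp
    then have "?L = 0" by (subst nn_integral_0_iff_AE) auto
    then show ?thesis by simp
  next
    case 2
    then have "AE x in M. g x = 0" by (subst (asm) nn_integral_0_iff_AE) auto
    then have "AE x in M. ennpowr (f x) t * ennpowr (g x) (1 - t) = 0" by eventually_elim simp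
    then have "?L = 0" by (subst nn_integral_0_iff_AE) auto
    then show ?thesis by simp
  next
    case 3
    then show ?thesis by (auto simp: ennreal_mult_top ennreal_top_mult)
  next
    case 4
    then obtain A B where AB: "?A = ennreal A" "?B = ennreal B" "0 < A" "0 < B"
      by (metis ennreal_cases ennreal_0 ennreal_less_zero_iff less_eq_real_def)
    define c where "c = ennreal (A powr t * B powr (1 - t))"
    have c: "ennpowr ?A t * ennpowr ?B (1 - t) = c"
      using AB by (simp add: c_def ennpowr_ennreal ennreal_mult)
    have "ennpowr (f x) t * ennpowr (g x) (1 - t)
        \<le> c * (ennreal t * (f x * ennreal (1 / A)) + ennreal (1 - t) * (g x * ennreal (1 / B)))"
      (is "?l x \<le> c * ?r x") for x
    proof -
      have 1: "z = ennreal r * (z * ennreal (1 / r))" if "0 < r" for z r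
        using that by (subst mult.left_commute) (simp flip: ennreal_mult)
      have "?l x = c * (ennpowr (f x * ennreal (1 / A)) t * ennpowr (g x * ennreal (1 / B)) (1 - t))"
        using AB by (subst 1 [OF AB(3), of "f x"], subst 1 [OF AB(4), of "g x"])
          (simp add: ennpowr_mult ennpowr_ennreal c_def ennreal_mult mult_ac)
      also have "\<dots> \<le> c * ?r x"
        by (intro mult_left_mono ennpowr_Young t) auto
      finally show ?thesis .
    qed
    then have "?L \<le> (\<integral>\<^sup>+x. c * ?r x \<partial>M)"
      by (intro nn_integral_mono)
    also have "\<dots> = c * (ennreal t * (?A * ennreal (1 / A)) + ennreal (1 - t) * (?B * ennreal (1 / B)))"
      by (simp add: nn_integral_cmult nn_integral_add nn_integral_multc)
    also have "\<dots> = c"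
      using AB t by (simp flip: ennreal_mult ennreal_plus)
    finally show ?thesis by (simp only: c)
  qed
qed

text \<open>The parameter is the reciprocal of the Lebesgue exponent, so that \<open>\<nu> = 0\<close> is \<open>L\<^sup>\<infinity>\<close> and
  Hoelder's inequality is additive in it.\<close>

definition Lnorm :: "'a measure \<Rightarrow> real \<Rightarrow> ('a \<Rightarrow> ennreal) \<Rightarrow> ennreal" where
  "Lnorm M \<nu> g = (if \<nu> = 0 then esssup M g
     else ennpowr (\<integral>\<^sup>+x. ennpowr (g x) (1 / \<nu>) \<partial>M) \<nu>)"

lemma Lnorm_mono_AE:
  assumes "f \<in> borel_measurable M" "AE x in M. f x \<le> g x" "0 \<le> \<nu>"
  shows "Lnorm M \<nu> f \<le> Lnorm M \<nu> g"
proof (cases "\<nu> = 0")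
  case True
  then show ?thesis using assms by (simp add: Lnorm_def esssup_AE_mono)
next
  case False
  have "AE x in M. ennpowr (f x) (1 / \<nu>) \<le> ennpowr (g x) (1 / \<nu>)"
    using assms(2) by eventually_elim (use assms in \<open>simp add: ennpowr_mono\<close>)
  then show ?thesis
    using False assms(3) by (simp add: Lnorm_def ennpowr_mono nn_integral_mono_AE)
qed

lemma Lnorm_cong_AE:
  assumes "f \<in> borel_measurable M" "g \<in> borel_measurable M" "AE x in M. f x = g x" "0 \<le> \<nu>"
  shows "Lnorm M \<nu> f = Lnorm M \<nu> g"
proof (rule antisym)
  have "AE x in M. f x \<le> g x" "AE x in M. g x \<le> f x" using assms(3) by auto
  then show "Lnorm M \<nu> f \<le> Lnorm M \<nu> g" "Lnorm M \<nu> g \<le> Lnorm M \<nu> f"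
    using assms by (auto intro!: Lnorm_mono_AE)
qed

lemma Lnorm_eq_0_iff:
  assumes [measurable]: "f \<in> borel_measurable M"
  shows "Lnorm M \<nu> f = 0 \<longleftrightarrow> (AE x in M. f x = 0)"
proof (cases "\<nu> = 0")
  case True
  have "(AE x in M. f x = 0)" if "esssup M f = 0"
    using esssup_AE [of f M] unfolding that by simp
  moreover have "esssup M f = 0" if "AE x in M. f x = 0"
    using that esssup_I [of f M 0] by auto
  ultimately show ?thesis using True by (auto simp: Lnorm_def)
next
  case False
  then show ?thesis by (simp add: Lnorm_def nn_integral_0_iff_AE)
qed

lemma Lnorm_const:
  assumes "emeasure M (space M) = 1" "0 \<le> \<nu>"
  shows "Lnorm M \<nu> (\<lambda>x. c) = c"
  using assms by (auto simp: Lnorm_def esssup_const ennpowr_ennpowr)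

lemma Lnorm_cmult_le:
  assumes [measurable]: "f \<in> borel_measurable M" and "0 \<le> \<nu>"
  shows "Lnorm M \<nu> (\<lambda>x. c * f x) \<le> c * Lnorm M \<nu> f"
proof (cases "\<nu> = 0")
  case True
  have "AE x in M. c * f x \<le> c * esssup M f"
    using esssup_AE [of f M] by eventually_elim (simp add: mult_left_mono)
  then show ?thesis using True by (auto simp: Lnorm_def intro: esssup_I)
next
  case False
  then show ?thesis
    by (simp add: Lnorm_def ennpowr_mult nn_integral_cmult ennpowr_ennpowr)
qed

lemma Lnorm_Holder_esssup:
  assumes [measurable]: "f \<in> borel_measurable M" "g \<in> borel_measurable M" and "0 \<le> b"
  shows "Lnorm M b (\<lambda>x. f x * g x) \<le> Lnorm M 0 f * Lnorm M b g"
proof -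
  have "AE x in M. f x * g x \<le> esssup M f * g x"
    using esssup_AE [of f M] by eventually_elim (simp add: mult_right_mono)
  then have "Lnorm M b (\<lambda>x. f x * g x) \<le> Lnorm M b (\<lambda>x. esssup M f * g x)"
    using assms by (intro Lnorm_mono_AE) auto
  also have "\<dots> \<le> esssup M f * Lnorm M b g"
    using assms by (intro Lnorm_cmult_le) auto
  finally show ?thesis by (simp add: Lnorm_def)
qed

text \<open>The power \<open>t = a / (a + b)\<close> turns both 1/a and 1/b into 1/(a + b). The sum
  \<open>a + b\<close> may exceed 1, so the product may lie in a quasi-normed space.\<close>

lemma Lnorm_Holder:
  assumes [measurable]: "f \<in> borel_measurable M" "g \<in> borel_measurable M" and "0 \<le> a" "0 \<le> b"
  shows "Lnorm M (a + b) (\<lambda>x. f x * g x) \<le> Lnorm M a f * Lnorm M b g"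
proof -
  consider "a = 0" | "b = 0" | "0 < a" "0 < b" using assms by linarith
  then show ?thesis
  proof cases
    case 1
    then show ?thesis using Lnorm_Holder_esssup [OF assms(1,2), of b] assms by simp
  next
    case 2
    then show ?thesis
      using Lnorm_Holder_esssup [OF assms(2,1), of a] assms by (simp add: mult.commute)
  next
    case 3
    define t where "t = a / (a + b)"
    have t: "0 < t" "t < 1" "t / a = 1 / (a + b)" "(1 - t) / b = 1 / (a + b)"
      "t * (a + b) = a" "(1 - t) * (a + b) = b"
      using 3 add_pos_pos [OF 3] by (simp_all add: t_def diff_divide_eq_iff)
    have "(\<integral>\<^sup>+x. ennpowr (f x * g x) (1 / (a + b)) \<partial>M)
       = (\<integral>\<^sup>+x. ennpowr (ennpowr (f x) (1 / a)) t * ennpowr (ennpowr (g x) (1 / b)) (1 - t) \<partial>M)"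
      using t by (simp add: ennpowr_mult ennpowr_ennpowr)
    also have "\<dots> \<le> ennpowr (\<integral>\<^sup>+x. ennpowr (f x) (1 / a) \<partial>M) t
        * ennpowr (\<integral>\<^sup>+x. ennpowr (g x) (1 / b) \<partial>M) (1 - t)"
      by (intro nn_integral_Holder t) auto
    finally have "ennpowr (\<integral>\<^sup>+x. ennpowr (f x * g x) (1 / (a + b)) \<partial>M) (a + b)
      \<le> ennpowr (\<dots>) (a + b)"
      using 3 by (intro ennpowr_mono) auto
    then show ?thesis
      using 3 t by (simp add: Lnorm_def ennpowr_mult ennpowr_ennpowr)
  qed
qed

lemma Lnorm_Holder_prod:
  assumes "finite I" "I \<noteq> {}" "\<And>i. i \<in> I \<Longrightarrow> f i \<in> borel_measurable M" "\<And>i. i \<in> I \<Longrightarrow> 0 \<le> \<nu> i"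
  shows "Lnorm M (\<Sum>i\<in>I. \<nu> i) (\<lambda>x. \<Prod>i\<in>I. f i x) \<le> (\<Prod>i\<in>I. Lnorm M (\<nu> i) (f i))"
  using assms
proof (induction I rule: finite_ne_induct)
  case (insert j I)
  have "Lnorm M (\<nu> j + sum \<nu> I) (\<lambda>x. f j x * (\<Prod>i\<in>I. f i x))
      \<le> Lnorm M (\<nu> j) (f j) * Lnorm M (sum \<nu> I) (\<lambda>x. \<Prod>i\<in>I. f i x)"
    using insert by (intro Lnorm_Holder borel_measurable_prod_ennreal) (auto intro: sum_nonneg)
  also have "\<dots> \<le> Lnorm M (\<nu> j) (f j) * (\<Prod>i\<in>I. Lnorm M (\<nu> i) (f i))"
    using insert by (intro mult_left_mono) auto
  finally show ?case using insert by simp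
qed simp

text \<open>On a probability space Hoelder's inequality turns a pointwise lower bound into one for
  the product of averages. For weights of product 1 this is the source of reverse
  inequalities.\<close>

lemma one_le_prod_Lnorm:
  assumes M: "emeasure M (space M) = 1" and "finite I" "I \<noteq> {}"
    and meas: "\<And>i. i \<in> I \<Longrightarrow> f i \<in> borel_measurable M" and nn: "\<And>i. i \<in> I \<Longrightarrow> 0 \<le> \<nu> i"
    and one: "AE x in M. 1 \<le> (\<Prod>i\<in>I. f i x)"
  shows "1 \<le> (\<Prod>i\<in>I. Lnorm M (\<nu> i) (f i))"
proof -
  have "Lnorm M (\<Sum>i\<in>I. \<nu> i) (\<lambda>x. 1) \<le> Lnorm M (\<Sum>i\<in>I. \<nu> i) (\<lambda>x. \<Prod>i\<in>I. f i x)"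
    using one nn by (intro Lnorm_mono_AE sum_nonneg) auto
  also have "\<dots> \<le> (\<Prod>i\<in>I. Lnorm M (\<nu> i) (f i))"
    using assms by (intro Lnorm_Holder_prod) auto
  finally show ?thesis using Lnorm_const [OF M, of "\<Sum>i\<in>I. \<nu> i" 1] nn by (simp add: sum_nonneg)
qed

section \<open>The maximal operator of a laminar family\<close>

definition laminar :: "'a set set \<Rightarrow> bool" where
  "laminar F \<longleftrightarrow> (\<forall>A\<in>F. \<forall>B\<in>F. A \<subseteq> B \<or> B \<subseteq> A \<or> A \<inter> B = {})"

lemma laminar_subset: "laminar F \<Longrightarrow> G \<subseteq> F \<Longrightarrow> laminar G"
  unfolding laminar_def by blast

text \<open>The maximal members of a finite laminar family are pairwise disjoint and have the same
  union, so summing over them loses no covering constant.\<close>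

lemma sum_emeasure_laminar:
  assumes "finite F" "F \<subseteq> sets M" "sets N = sets M"
    and lam: "laminar F"
    and le: "\<And>A. A \<in> F \<Longrightarrow> c * emeasure M A \<le> emeasure N A"
  shows "c * emeasure M (\<Union>F) \<le> emeasure N (\<Union>F)"
proof -
  define G where "G = {A \<in> F. \<forall>B\<in>F. A \<subseteq> B \<longrightarrow> A = B}"
  have G: "finite G" "G \<subseteq> F" using assms(1) by (auto simp: G_def)
  have Un: "\<Union>G = \<Union>F"
  proof
    show "\<Union>F \<subseteq> \<Union>G"
    proof
      fix x assume "x \<in> \<Union>F"
      then obtain A where A: "A \<in> F" "x \<in> A" by auto
      from finite_has_maximal2 [OF assms(1) A(1)] obtain B where
        "B \<in> F" "A \<subseteq> B" "\<forall>C\<in>F. B \<subseteq> C \<longrightarrow> B = C" by auto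
      then show "x \<in> \<Union>G" using A by (auto simp: G_def)
    qed
  qed (use G in auto)
  have disj: "disjoint_family_on (\<lambda>A. A) G"
    unfolding disjoint_family_on_def
  proof (intro ballI impI)
    fix A B assume AB: "A \<in> G" "B \<in> G" "A \<noteq> B"
    then have "A \<subseteq> B \<or> B \<subseteq> A \<or> A \<inter> B = {}"
      using lam G(2) by (simp add: laminar_def subset_iff)
    with AB show "A \<inter> B = {}" unfolding G_def by blast
  qed
  have "c * emeasure M (\<Union>G) = (\<Sum>A\<in>G. c * emeasure M A)"
    using sum_emeasure [of "\<lambda>A. A" G M] disj G assms by (auto simp: sum_distrib_left [symmetric])
  also have "\<dots> \<le> (\<Sum>A\<in>G. emeasure N A)"
    using le G by (intro sum_mono) auto
  also have "\<dots> = emeasure N (\<Union>G)"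
    using sum_emeasure [of "\<lambda>A. A" G N] disj G assms by auto
  finally show ?thesis by (simp only: Un)
qed

text \<open>Finite subfamilies exhaust the union. Maximal members of the whole family cannot be
  chosen directly, since a countable laminar family may contain infinite increasing chains.\<close>

lemma emeasure_Union_laminar:
  assumes "countable F" "F \<subseteq> sets M" "sets N = sets M"
    and lam: "laminar F"
    and le: "\<And>A. A \<in> F \<Longrightarrow> c * emeasure M A \<le> emeasure N A"
  shows "c * emeasure M (\<Union>F) \<le> emeasure N (\<Union>F)"
proof (cases "F = {}")
  case False
  define U where "U n = \<Union>(from_nat_into F ` {..n::nat})" for n
  have F: "from_nat_into F n \<in> F" for n using from_nat_into [OF False] .
  have meas: "U n \<in> sets M" for n
    unfolding U_def using F assms(2) by (intro sets.finite_Union) auto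
  have "(\<Union>n. U n) = \<Union>(range (from_nat_into F))"
    by (auto simp: U_def)
  then have "\<Union>F = (\<Union>n. U n)"
    by (simp only: range_from_nat_into [OF False assms(1)])
  moreover have "incseq U"
    unfolding U_def incseq_def by (intro allI impI Union_mono image_mono) auto
  ultimately have SUP: "emeasure M (\<Union>F) = (SUP n. emeasure M (U n))"
    using SUP_emeasure_incseq [of U M] meas by (simp add: image_subset_iff)
  have "c * emeasure M (U n) \<le> emeasure N (\<Union>F)" for n
  proof -
    have "c * emeasure M (U n) \<le> emeasure N (U n)"
      unfolding U_def
    proof (rule sum_emeasure_laminar)
      have sub: "from_nat_into F ` {..n} \<subseteq> F" using F by auto
      then show "from_nat_into F ` {..n} \<subseteq> sets M" using assms(2) by blast
      show "laminar (from_nat_into F ` {..n})" by (rule laminar_subset [OF lam sub])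
      show "c * emeasure M A \<le> emeasure N A" if "A \<in> from_nat_into F ` {..n}" for A
        by (rule le) (use that sub in blast)
    qed (use assms in simp_all)
    also have "\<dots> \<le> emeasure N (\<Union>F)"
      using assms(1-3) F by (intro emeasure_mono sets.countable_Union) (auto simp: U_def)
    finally show ?thesis .
  qed
  then show ?thesis
    unfolding SUP SUP_mult_left_ennreal by (auto intro: SUP_least)
qed simp

abbreviation mean :: "'a measure \<Rightarrow> 'a set \<Rightarrow> ('a \<Rightarrow> ennreal) \<Rightarrow> ennreal" where
  "mean M A f \<equiv> (\<integral>\<^sup>+y\<in>A. f y \<partial>M) / emeasure M A"

definition maxop :: "'a measure \<Rightarrow> 'a set set \<Rightarrow> ('a \<Rightarrow> ennreal) \<Rightarrow> 'a \<Rightarrow> ennreal" where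
  "maxop M F f x = (SUP A\<in>F. indicator A x * (mean M A f))"

lemma borel_measurable_maxop [measurable]:
  assumes "countable F" "F \<subseteq> sets M"
  shows "maxop M F f \<in> borel_measurable M"
  unfolding maxop_def [abs_def] using assms by (intro borel_measurable_SUP) auto

text \<open>Laminarity replaces a covering lemma, so the constant is 1 for every measure, doubling
  or not. This is Doob's weak type inequality.\<close>

lemma maxop_weak_type:
  assumes F: "countable F" "F \<subseteq> sets M"
    and lam: "laminar F"
    and [measurable]: "f \<in> borel_measurable M"
  shows "c * emeasure M {x \<in> space M. c < maxop M F f x} \<le> (\<integral>\<^sup>+x. f x \<partial>M)"
proof -
  define G where "G = {A \<in> F. c < mean M A f}"
  have eq: "{x \<in> space M. c < maxop M F f x} = \<Union>G"
  proof -
    have "A \<subseteq> space M" if "A \<in> F" for A using that F(2) sets.sets_into_space by blast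
    moreover have "c < indicator A x * a \<longleftrightarrow> x \<in> A \<and> c < a" for A a and x :: 'a
      by (cases "x \<in> A") simp_all
    ultimately show ?thesis
      unfolding maxop_def less_SUP_iff G_def by blast
  qed
  have "c * emeasure M A \<le> emeasure (density M f) A" if "A \<in> G" for A
  proof -
    have A: "A \<in> sets M" "c < mean M A f" using that F by (auto simp: G_def)
    show ?thesis
    \<comment> \<open>A set of infinite measure has mean 0 and so cannot belong to
      \<open>G\<close>.\<close>
    proof (cases "emeasure M A = 0 \<or> emeasure M A = top")
      case False
      have "c * emeasure M A \<le> mean M A f * emeasure M A"
        using A by (intro mult_right_mono) auto
      also have "\<dots> = (\<integral>\<^sup>+y\<in>A. f y \<partial>M)"
        using False by (simp add: ennreal_divide_times ennreal_divide_self less_top)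
      finally show ?thesis using A by (simp add: emeasure_density)
    qed (use A in auto)
  qed
  then have "c * emeasure M (\<Union>G) \<le> emeasure (density M f) (\<Union>G)"
  proof (intro emeasure_Union_laminar)
    show "countable G" by (rule countable_subset [OF _ F(1)]) (auto simp: G_def)
    show "laminar G" by (rule laminar_subset [OF lam]) (auto simp: G_def)
  qed (use F in \<open>auto simp: G_def\<close>)
  also have "\<dots> \<le> emeasure (density M f) (space M)"
    using emeasure_space [of "density M f" "\<Union>G"] by simp
  also have "\<dots> = (\<integral>\<^sup>+x. f x \<partial>M)"
    by (simp add: emeasure_density cong: nn_integral_cong)
  finally show ?thesis unfolding eq .
qed

text \<open>The part of f below c adds at most c to any mean, so a mean above 2c forces the part
  above c to have mean larger than c. This is the truncation of Marcinkiewicz interpolation.\<close>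

lemma maxop_weak_type_truncated:
  assumes F: "countable F" "F \<subseteq> sets M"
    and lam: "laminar F"
    and [measurable]: "f \<in> borel_measurable M" and c: "c \<noteq> top"
  shows "c * emeasure M {x \<in> space M. c + c < maxop M F f x} \<le> (\<integral>\<^sup>+x. f x * indicator {x. c < f x} x \<partial>M)"
proof -
  define g where "g x = f x * indicator {x. c < f x} x" for x
  have [measurable]: "g \<in> borel_measurable M"
    unfolding g_def [abs_def] by measurable
  have fg: "f x \<le> g x + c" for x by (auto simp: g_def indicator_def)
  have "c < maxop M F g x" if "c + c < maxop M F f x" for x
  proof -
    from that obtain A where A: "A \<in> F" and *: "c + c < indicator A x * (mean M A f)"
      by (auto simp: maxop_def less_SUP_iff)
    then have x: "x \<in> A" and [measurable]: "A \<in> sets M" using F by (cases "x \<in> A"; auto)+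
    have "(\<integral>\<^sup>+y\<in>A. f y \<partial>M) \<le> (\<integral>\<^sup>+y. g y * indicator A y + c * indicator A y \<partial>M)"
      using fg by (intro nn_integral_mono) (auto simp: indicator_def)
    also have "\<dots> = (\<integral>\<^sup>+y\<in>A. g y \<partial>M) + c * emeasure M A"
      by (simp add: nn_integral_add nn_integral_cmult)
    finally have "mean M A f \<le> ((\<integral>\<^sup>+y\<in>A. g y \<partial>M) + c * emeasure M A) / emeasure M A"
      by (rule divide_right_mono_ennreal)
    also have "\<dots> = mean M A g + c * emeasure M A / emeasure M A"
      by (rule add_divide_distrib_ennreal)
    also have "c * emeasure M A / emeasure M A \<le> c"
      by (cases "emeasure M A = 0 \<or> emeasure M A = top")
         (auto simp: ennreal_mult_divide_eq)
    finally have le: "mean M A f \<le> c + mean M A g"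
      by (simp add: add.commute add_left_mono)
    from * x have "c + c < mean M A f" by simp
    from less_le_trans [OF this le] have "c < mean M A g"
      by (simp only: ennreal_add_left_cancel_less)
    also have "\<dots> \<le> maxop M F g x"
      unfolding maxop_def using A x by (intro SUP_upper2 [of A]) auto
    finally show ?thesis .
  qed
  then have "c * emeasure M {x \<in> space M. c + c < maxop M F f x} \<le> c * emeasure M {x \<in> space M. c < maxop M F g x}"
    using F by (intro mult_left_mono emeasure_mono) auto
  also have "\<dots> \<le> (\<integral>\<^sup>+x. g x \<partial>M)"
    by (intro maxop_weak_type F lam) auto
  finally show ?thesis by (simp add: g_def)
qed

text \<open>The layer-cake formula. The value \<open>y = top\<close> follows by comparison with the
  finite levels \<open>n powr (1 / r)\<close>, whose r-th powers are the integers n.\<close>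

lemma nn_integral_powr_layer:
  assumes "0 < r"
  shows "(\<integral>\<^sup>+t. ennreal (r * t powr (r - 1)) * indicator {0<..} t * indicator {t. ennreal t < y} t \<partial>lborel)
    = ennpowr y r"
proof -
  let ?I = "\<lambda>y. \<integral>\<^sup>+t. ennreal (r * t powr (r - 1)) * indicator {0<..} t * indicator {t. ennreal t < y} t \<partial>lborel"
  have fin: "?I (ennreal c)
    = ennpowr (ennreal c) r" if "0 \<le> c" for c
  proof -
    have I: "((\<lambda>t. r * t powr (r - 1)) has_integral (r * (c powr (r - 1 + 1) / (r - 1 + 1)))) {0..c}"
      using assms that by (intro has_integral_mult_right has_integral_powr_from_0) auto
    have "?I (ennreal c)
      = (\<integral>\<^sup>+t. ennreal (r * t powr (r - 1)) * indicator {0..c} t \<partial>lborel)"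
    proof (rule nn_integral_cong_AE)
      have "AE t in lborel. t \<noteq> 0" "AE t in lborel. t \<noteq> c"
        using AE_lborel_singleton [of 0] AE_lborel_singleton [of c] by auto
      then show "AE t in lborel. ennreal (r * t powr (r - 1)) * indicator {0<..} t * indicator {t. ennreal t < ennreal c} t
          = ennreal (r * t powr (r - 1)) * indicator {0..c} t"
        by eventually_elim (auto simp: indicator_def ennreal_less_iff)
    qed
    also have "\<dots> = ennreal (c powr r)"
      using nn_integral_has_integral_lebesgue' [OF _ I] assms by simp
    finally show ?thesis using that by (simp add: ennpowr_ennreal)
  qed
  show ?thesis
  proof (cases y rule: ennreal_cases)
    case (real c)
    show ?thesis unfolding real(2) by (rule fin [OF real(1)])
  next
    case top
    have "of_nat n \<le> ?I y" for n
    proof -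
      have "of_nat n = ennpowr (ennreal (real n powr (1 / r))) r"
        using assms by (simp add: ennpowr_ennreal powr_powr ennreal_of_nat_eq_real_of_nat)
      also have "\<dots> = ?I (ennreal (real n powr (1 / r)))"
        by (rule fin [symmetric]) simp
      also have "\<dots> \<le> ?I y"
        using top by (intro nn_integral_mono mult_left_mono) (auto simp: indicator_def)
      finally show ?thesis .
    qed
    then show ?thesis
      using top ennreal_Ex_less_of_nat by (metis ennpowr_top not_le top.not_eq_extremum)
  qed
qed

text \<open>Layer cake and Fubini applied to the truncated weak type at height t/2. The constant
  depends on r alone and not on the measure, so it is the same for every weighted measure.\<close>

lemma maxop_strong_type:
  assumes M: "sigma_finite_measure M"
    and F: "countable F" "F \<subseteq> sets M"
    and lam: "laminar F"
    and [measurable]: "f \<in> borel_measurable M" and r: "1 < r"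
  shows "(\<integral>\<^sup>+x. ennpowr (maxop M F f x) r \<partial>M)
    \<le> ennreal (2 powr r * r / (r - 1)) * (\<integral>\<^sup>+x. ennpowr (f x) r \<partial>M)"
proof -
  interpret M: sigma_finite_measure M by (rule M)
  interpret P: pair_sigma_finite M lborel ..
  note [measurable] = borel_measurable_maxop [OF F]
  define k where "k s t = ennreal (s * t powr (s - 1)) * indicator {0<..} t" for s t :: real
  have [measurable]: "k s \<in> borel_measurable borel" for s
    unfolding k_def [abs_def] by measurable
  have layer: "ennpowr y s = (\<integral>\<^sup>+t. k s t * indicator {t. ennreal t < y} t \<partial>lborel)" if "0 < s" for y s
    unfolding k_def by (rule nn_integral_powr_layer [OF that, symmetric])
  \<comment> \<open>The factor 2/t comes from the weak type bound at height t/2. It lowers the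
    kernel of the power r to that of the power r - 1, whose integral up to 2 f is (2 f)^(r -
    1).\<close>
  have k: "k r t * (ennreal (2 / t) * z) = ennreal (2 * r / (r - 1)) * (k (r - 1) t * z)" for t z
  proof (cases "0 < t")
    case True
    have "r * t powr (r - 1) * (2 / t) = 2 * r / (r - 1) * ((r - 1) * t powr (r - 1 - 1))"
      using r True powr_add [of t "r - 1 - 1" 1] by simp
    then have "ennreal (r * t powr (r - 1)) * ennreal (2 / t)
        = ennreal (2 * r / (r - 1)) * ennreal ((r - 1) * t powr (r - 1 - 1))"
      using r True by (simp flip: ennreal_mult)
    then show ?thesis using True by (simp add: k_def mult.assoc [symmetric])
  qed (simp add: k_def)
  have "(\<integral>\<^sup>+x. ennpowr (maxop M F f x) r \<partial>M)
      = (\<integral>\<^sup>+x. \<integral>\<^sup>+t. k r t * indicator {t. ennreal t < maxop M F f x} t \<partial>lborel \<partial>M)"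
    using r by (simp add: layer)
  also have "\<dots> = (\<integral>\<^sup>+t. \<integral>\<^sup>+x. k r t * indicator {t. ennreal t < maxop M F f x} t \<partial>M \<partial>lborel)"
    by (rule P.Fubini' [symmetric]) measurable
  also have "\<dots> \<le> (\<integral>\<^sup>+t. \<integral>\<^sup>+x. k r t * (ennreal (2 / t) * (f x * indicator {t. ennreal t < 2 * f x} t)) \<partial>M \<partial>lborel)"
  proof (rule nn_integral_mono)
    fix t :: real
    show "(\<integral>\<^sup>+x. k r t * indicator {t. ennreal t < maxop M F f x} t \<partial>M)
      \<le> (\<integral>\<^sup>+x. k r t * (ennreal (2 / t) * (f x * indicator {t. ennreal t < 2 * f x} t)) \<partial>M)"
    proof (cases "0 < t")
      case True
      have t: "ennreal t = ennreal (t / 2) + ennreal (t / 2)" using True by (simp flip: ennreal_plus)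
      have half: "ennreal t < 2 * y \<longleftrightarrow> ennreal (t / 2) < y" for y
        using True by (cases y rule: ennreal_cases)
          (auto simp: ennreal_less_iff ennreal_mult_top simp flip: ennreal_numeral ennreal_mult)
      have "(\<integral>\<^sup>+x. indicator {t. ennreal t < maxop M F f x} t \<partial>M)
          = (\<integral>\<^sup>+x. indicator {x \<in> space M. ennreal t < maxop M F f x} x \<partial>M)"
        by (intro nn_integral_cong) (auto simp: indicator_def)
      also have "\<dots> = emeasure M {x \<in> space M. ennreal t < maxop M F f x}"
        by (rule nn_integral_indicator) measurable
      also have "\<dots> = ennreal (2 / t) * (ennreal (t / 2) * emeasure M {x \<in> space M. ennreal t < maxop M F f x})"
        using True by (simp flip: mult.assoc ennreal_mult)
      also have "\<dots> \<le> ennreal (2 / t) * (\<integral>\<^sup>+x. f x * indicator {x. ennreal (t / 2) < f x} x \<partial>M)"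
        unfolding t by (intro mult_left_mono maxop_weak_type_truncated F lam) auto
      also have "(\<integral>\<^sup>+x. f x * indicator {x. ennreal (t / 2) < f x} x \<partial>M)
          = (\<integral>\<^sup>+x. f x * indicator {t. ennreal t < 2 * f x} t \<partial>M)"
        by (intro nn_integral_cong) (auto simp: indicator_def half)
      finally show ?thesis
        by (simp add: nn_integral_cmult mult_left_mono)
    qed (simp add: k_def)
  qed
  also have "\<dots> = (\<integral>\<^sup>+x. \<integral>\<^sup>+t. k r t * (ennreal (2 / t) * (f x * indicator {t. ennreal t < 2 * f x} t)) \<partial>lborel \<partial>M)"
    by (rule P.Fubini') measurable
  also have "\<dots> = (\<integral>\<^sup>+x. ennreal (2 * r / (r - 1)) * (f x * ennpowr (2 * f x) (r - 1)) \<partial>M)"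
  proof (rule nn_integral_cong)
    fix x
    have "k r t * (ennreal (2 / t) * (f x * indicator {t. ennreal t < 2 * f x} t))
        = ennreal (2 * r / (r - 1)) * (f x * (k (r - 1) t * indicator {t. ennreal t < 2 * f x} t))" for t
      unfolding k by (simp only: mult.left_commute)
    then show "(\<integral>\<^sup>+t. k r t * (ennreal (2 / t) * (f x * indicator {t. ennreal t < 2 * f x} t)) \<partial>lborel)
        = ennreal (2 * r / (r - 1)) * (f x * ennpowr (2 * f x) (r - 1))"
      using r by (simp add: nn_integral_cmult layer [symmetric])
  qed
  also have "\<dots> = (\<integral>\<^sup>+x. ennreal (2 powr r * r / (r - 1)) * ennpowr (f x) r \<partial>M)"
  proof (intro nn_integral_cong)
    fix x
    have 2: "ennpowr 2 (r - 1) = ennreal (2 powr (r - 1))"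
      using ennpowr_ennreal [of 2 "r - 1"] by simp
    have "f x * ennpowr (2 * f x) (r - 1) = ennreal (2 powr (r - 1)) * ennpowr (f x) r"
      using ennpowr_add [of "f x" 1 "r - 1"] by (simp add: ennpowr_mult 2 mult_ac)
    moreover have "ennreal (2 * r / (r - 1)) * ennreal (2 powr (r - 1)) = ennreal (2 powr r * r / (r - 1))"
      using r by (simp add: powr_diff divide_simps flip: ennreal_mult)
    ultimately show "ennreal (2 * r / (r - 1)) * (f x * ennpowr (2 * f x) (r - 1))
        = ennreal (2 powr r * r / (r - 1)) * ennpowr (f x) r"
      by (simp only: mult.assoc [symmetric])
  qed
  finally show ?thesis by (simp add: nn_integral_cmult)
qed

section \<open>Triadic grids\<close>

abbreviation lmeas :: "(real^'n \<Rightarrow> 'a::topological_space) set" where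
  "lmeas \<equiv> borel_measurable lebesgue"

text \<open>Triadic grids rather than dyadic ones: the shift by one half is then nested at all scales
  without alternating signs, and the end points of the two grids of one scale stay half a side apart.\<close>

definition grid_cell :: "('n \<Rightarrow> bool) \<Rightarrow> int \<Rightarrow> ('n \<Rightarrow> int) \<Rightarrow> (real^'n) set" where
  "grid_cell u k j = {y. \<forall>i. \<lfloor>3 powi k * y $ i - of_bool (u i) / 2\<rfloor> = j i}"

definition grid :: "('n::finite \<Rightarrow> bool) \<Rightarrow> (real^'n) set set" where
  "grid u = range (\<lambda>(k, j). grid_cell u k j)"

lemma countable_grid [simp]: "countable (grid u)"
  unfolding grid_def by simp

text \<open>Going to the coarser scale divides by 3 and moves the shift by 3 s - s = 2 s, which is
  the integer \<open>of_bool c\<close>. Hence the coarse index is a function of the fine one, and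
  cells are nested.\<close>

lemma grid_key_coarser:
  fixes a b s :: real
  assumes "s = of_bool c / 2" "\<lfloor>3 powi (k + 1) * a - s\<rfloor> = \<lfloor>3 powi (k + 1) * b - s\<rfloor>"
  shows "\<lfloor>3 powi k * a - s\<rfloor> = \<lfloor>3 powi k * b - s\<rfloor>"
proof -
  have "\<lfloor>3 powi k * x - s\<rfloor> = (\<lfloor>3 powi (k + 1) * x - s\<rfloor> - of_bool c) div 3" for x
  proof -
    have p: "(3::real) powi (k + 1) = 3 * 3 powi k" by (simp add: power_int_add_1)
    have "3 powi k * x - s = (3 powi (k + 1) * x - s - of_int (of_bool c)) / of_int 3"
      unfolding p by (simp add: assms(1) field_simps)
    then show ?thesis
      by (simp only: floor_divide_real_eq_div floor_diff_of_int)
  qed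
  then show ?thesis using assms(2) by presburger
qed

lemma grid_key_coarser':
  fixes a b s :: real
  assumes "s = of_bool c / 2" "k \<le> k'" "\<lfloor>3 powi k' * a - s\<rfloor> = \<lfloor>3 powi k' * b - s\<rfloor>"
  shows "\<lfloor>3 powi k * a - s\<rfloor> = \<lfloor>3 powi k * b - s\<rfloor>"
  using assms(2,3)
proof (induction k' rule: int_ge_induct)
  case (step l)
  then show ?case using grid_key_coarser [OF assms(1)] by blast
qed

lemma grid_cell_subset:
  assumes "k \<le> k'" "z \<in> grid_cell u k j" "z \<in> grid_cell u k' j'"
  shows "grid_cell u k' j' \<subseteq> grid_cell u k j"
proof
  fix y assume "y \<in> grid_cell u k' j'"
  then have "\<lfloor>3 powi k' * y $ i - of_bool (u i) / 2\<rfloor> = \<lfloor>3 powi k' * z $ i - of_bool (u i) / 2\<rfloor>" for i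
    using assms by (simp add: grid_cell_def)
  then have "\<lfloor>3 powi k * y $ i - of_bool (u i) / 2\<rfloor> = \<lfloor>3 powi k * z $ i - of_bool (u i) / 2\<rfloor>" for i
    using grid_key_coarser' [OF refl assms(1)] by blast
  then show "y \<in> grid_cell u k j" using assms by (simp add: grid_cell_def)
qed

lemma grid_laminar: "laminar (grid u)"
  unfolding laminar_def
proof (intro ballI)
  fix A B assume "A \<in> grid u" "B \<in> grid u"
  then obtain k j k' j' where eq: "A = grid_cell u k j" "B = grid_cell u k' j'"
    by (auto simp: grid_def)
  then show "A \<subseteq> B \<or> B \<subseteq> A \<or> A \<inter> B = {}"
    using grid_cell_subset [of k k' _ u j j'] grid_cell_subset [of k' k _ u j' j]
    by (cases "k \<le> k'") auto
qed

lemma emeasure_cube: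
  fixes a :: "real^'n"
  assumes "0 < l"
  shows "emeasure lebesgue (cbox a (\<chi> i. a $ i + l)) = ennreal (l ^ CARD('n))"
proof -
  have ne: "cbox a (\<chi> i. a $ i + l) \<noteq> {}"
    using assms by (auto simp: interval_ne_empty_cart less_imp_le)
  have "measure lebesgue (cbox a (\<chi> i. a $ i + l)) = l ^ CARD('n)"
    using content_cbox_cart [OF ne] by simp
  moreover have "emeasure lebesgue (cbox a (\<chi> i. a $ i + l)) \<noteq> top"
    using emeasure_lborel_cbox_finite [of a "\<chi> i. a $ i + l"] by simp
  ultimately show ?thesis
    using emeasure_eq_ennreal_measure by metis
qed

text \<open>The half-open cell lies between an open box and its closure, which differ by a null
  set.\<close>

lemma grid_cell_cube:
  obtains a :: "real^'n" where
    "AE x in lebesgue. x \<in> grid_cell u k j \<longleftrightarrow> x \<in> cbox a (\<chi> i. a $ i + 3 powi (- k))"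
    "grid_cell u k j \<in> sets lebesgue"
proof
  let ?a = "(\<chi> i. (of_int (j i) + of_bool (u i) / 2) * 3 powi (- k)) :: real^'n"
  let ?b = "(\<chi> i. ?a $ i + 3 powi (- k)) :: real^'n"
  have eq: "(\<lfloor>3 powi k * y - s\<rfloor> = m) \<longleftrightarrow> (of_int m + s) * 3 powi (- k) \<le> y \<and> y < (of_int m + s) * 3 powi (- k) + 3 powi (- k)"
    for y s :: real and m
    by (auto simp: floor_eq_iff power_int_minus field_simps)
  have sub: "box ?a ?b \<subseteq> grid_cell u k j" "grid_cell u k j \<subseteq> cbox ?a ?b"
    unfolding grid_cell_def eq by (simp_all add: subset_iff mem_box_cart less_imp_le)
  have null: "cbox ?a ?b - box ?a ?b \<in> null_sets lebesgue"
    using negligible_frontier_interval [of ?a ?b] by (simp add: negligible_iff_null_sets)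
  show "AE x in lebesgue. x \<in> grid_cell u k j \<longleftrightarrow> x \<in> cbox ?a ?b"
    by (rule AE_I' [OF null]) (use sub in auto)
  have un: "grid_cell u k j = box ?a ?b \<union> (grid_cell u k j - box ?a ?b)"
    using sub by auto
  moreover have "grid_cell u k j - box ?a ?b \<in> null_sets lebesgue"
    by (rule null_sets_completion_subset [OF _ null]) (use sub in auto)
  moreover have "box ?a ?b \<in> sets lebesgue" by simp
  ultimately show "grid_cell u k j \<in> sets lebesgue"
    by (subst un) (blast intro: sets.Un null_setsD2)
qed

lemma grid_sets:
  assumes "Q \<in> grid u"
  shows "Q \<in> sets lebesgue"
proof -
  obtain k j where Q: "Q = grid_cell u k j" using assms by (auto simp: grid_def)
  show ?thesis unfolding Q by (rule grid_cell_cube)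
qed

text \<open>Averages see a set only through its \<open>uniform_measure\<close>, so a weight
  condition on closed cubes can be read on half-open cells without loss.\<close>

lemma grid_cube:
  fixes Q :: "(real^'b) set"
  assumes "Q \<in> grid u"
  obtains R where "R \<in> cubes" "uniform_measure lebesgue Q = uniform_measure lebesgue R"
    "emeasure lebesgue Q = emeasure lebesgue R"
proof -
  obtain k j where Q: "Q = grid_cell u k j" using assms by (auto simp: grid_def)
  obtain a where a: "AE x in lebesgue. x \<in> grid_cell u k j \<longleftrightarrow> x \<in> cbox a (\<chi> i. a $ i + 3 powi (- k))"
    by (rule grid_cell_cube)
  let ?R = "cbox a (\<chi> i. a $ i + 3 powi (- k))"
  have Qs: "Q \<in> sets lebesgue" by (rule grid_sets [OF assms])
  have e: "emeasure lebesgue Q = emeasure lebesgue ?R"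
    using a Qs unfolding Q by (rule emeasure_eq_AE) simp
  have "uniform_measure lebesgue Q = uniform_measure lebesgue ?R"
    unfolding uniform_measure_def
  proof (rule density_cong)
    show "AE x in lebesgue. indicator Q x / emeasure lebesgue Q = indicator ?R x / emeasure lebesgue ?R"
      using a unfolding Q [symmetric] e by eventually_elim (simp add: indicator_def)
    have m: "(\<lambda>x. indicator S x / emeasure lebesgue S) \<in> lmeas"
      if [measurable]: "S \<in> sets lebesgue" for S :: "(real^'b) set"
      by measurable
    show "(\<lambda>x. indicator Q x / emeasure lebesgue Q) \<in> lmeas"
      by (rule m [OF Qs])
    show "(\<lambda>x. indicator ?R x / emeasure lebesgue ?R) \<in> lmeas"
      by (rule m) simp
  qed
  moreover have "?R \<in> cubes"
    unfolding cubes_def using zero_less_power_int [of 3 "- k"] by force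
  ultimately show ?thesis using that e by blast
qed

lemma cubes_emeasure:
  assumes "Q \<in> cubes"
  shows "Q \<in> sets lebesgue" "emeasure lebesgue Q \<noteq> 0" "emeasure lebesgue Q \<noteq> top"
proof -
  obtain a l where "Q = cbox a (\<chi> i. a $ i + l)" "0 < l" using assms by (auto simp: cubes_def)
  then show "Q \<in> sets lebesgue" "emeasure lebesgue Q \<noteq> 0" "emeasure lebesgue Q \<noteq> top"
    using emeasure_cube [of l a] by (simp_all add: ennreal_eq_0_iff not_le)
qed

lemma grid_emeasure:
  assumes "Q \<in> grid u"
  shows "emeasure lebesgue Q \<noteq> 0" "emeasure lebesgue Q \<noteq> top"
proof -
  obtain R where "R \<in> cubes" "uniform_measure lebesgue Q = uniform_measure lebesgue R"
      and e: "emeasure lebesgue Q = emeasure lebesgue R"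
    by (rule grid_cube [OF assms])
  then show "emeasure lebesgue Q \<noteq> 0" "emeasure lebesgue Q \<noteq> top"
    unfolding e by (simp_all only: cubes_emeasure not_False_eq_True)
qed

text \<open>The two floor functions jump at the integers and at the odd multiples of 1/2; an
  interval shorter than 1/2 cannot contain jumps of both kinds.\<close>

lemma floor_eq_or_floor_shift_eq:
  fixes x c :: real
  assumes "0 \<le> c" "c < 1 / 2"
  shows "\<lfloor>x + c\<rfloor> = \<lfloor>x\<rfloor> \<or> \<lfloor>x + c - 1 / 2\<rfloor> = \<lfloor>x - 1 / 2\<rfloor>"
proof (cases "x < of_int \<lfloor>x\<rfloor> + 1 / 2")
  case True
  then have "\<lfloor>x + c\<rfloor> = \<lfloor>x\<rfloor>" using assms by (intro floor_unique) linarith+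
  then show ?thesis ..
next
  case False
  then have "\<lfloor>x + c - 1 / 2\<rfloor> = \<lfloor>x\<rfloor>" "\<lfloor>x - 1 / 2\<rfloor> = \<lfloor>x\<rfloor>"
    using assms by (intro floor_unique; linarith)+
  then show ?thesis by simp
qed

text \<open>In each coordinate at least one of the two shifts does not separate the ends of the
  side, so one of the 2^n grids has a cell containing the cube.\<close>

lemma cube_subset_grid:
  fixes R :: "(real^'n) set"
  assumes "R \<in> cubes"
  obtains u Q where "Q \<in> grid u" "R \<subseteq> Q"
    "emeasure lebesgue Q \<le> ennreal (6 ^ CARD('n)) * emeasure lebesgue R"
proof -
  obtain a l where R: "R = cbox a (\<chi> i. a $ i + l)" and l: "0 < l"
    using assms by (auto simp: cubes_def)
  \<comment> \<open>The finest scale with cell side above 2 l, as the choice of shifts demands. Its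
    side is then at most 6 l, which is where 6^n comes from.\<close>
  define k where "k = - \<lfloor>log 3 (2 * l)\<rfloor> - 1"
  have pos: "0 < (3::real) powi k" by simp
  have powi: "(3::real) powi m = 3 powr of_int m" for m
    by (simp add: powr_real_of_int')
  have "log 3 (2 * l) < of_int (- k)" "of_int (- k) - 1 \<le> log 3 (2 * l)"
    unfolding k_def by linarith+
  then have "2 * l < 3 powr (- of_int k)" "3 powr (- of_int k - 1) \<le> 2 * l"
    using l by (simp_all add: log_less_iff le_log_iff)
  then have kl: "2 * l < 1 / 3 powi k" "1 / 3 powi k / 3 \<le> 2 * l"
    by (simp_all add: powi powr_minus powr_diff field_simps)
  define c where "c = 3 powi k * l"
  have c: "0 \<le> c" "c < 1 / 2"
    using kl(1) pos l by (auto simp: c_def field_simps)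
  \<comment> \<open>The shift is used exactly in those coordinates where the unshifted grid
    separates the two ends.\<close>
  define u where "u i \<longleftrightarrow> \<lfloor>3 powi k * a $ i + c\<rfloor> \<noteq> \<lfloor>3 powi k * a $ i\<rfloor>" for i
  define j where "j i = \<lfloor>3 powi k * a $ i - of_bool (u i) / 2\<rfloor>" for i
  have j: "\<lfloor>3 powi k * a $ i + c - of_bool (u i) / 2\<rfloor> = j i" for i
    using floor_eq_or_floor_shift_eq [OF c, of "3 powi k * a $ i"] by (auto simp: j_def u_def)
  have sub: "R \<subseteq> grid_cell u k j"
  proof
    fix y assume "y \<in> R"
    then have y: "a $ i \<le> y $ i" "y $ i \<le> a $ i + l" for i
      by (auto simp: R mem_box_cart)
    have "\<lfloor>3 powi k * y $ i - of_bool (u i) / 2\<rfloor> = j i" for i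
    proof (rule antisym)
      have "3 powi k * y $ i \<le> 3 powi k * (a $ i + l)"
        using pos y by (intro mult_left_mono) auto
      then show "\<lfloor>3 powi k * y $ i - of_bool (u i) / 2\<rfloor> \<le> j i"
        unfolding j [symmetric] by (intro floor_mono) (simp add: c_def algebra_simps)
      show "j i \<le> \<lfloor>3 powi k * y $ i - of_bool (u i) / 2\<rfloor>"
        unfolding j_def using pos y by (intro floor_mono diff_right_mono mult_left_mono) auto
    qed
    then show "y \<in> grid_cell u k j" by (simp add: grid_cell_def)
  qed
  have "emeasure lebesgue (grid_cell u k j) \<le> ennreal (6 ^ CARD('n)) * emeasure lebesgue R"
  proof -
    obtain b where b: "AE x in lebesgue. x \<in> grid_cell u k j \<longleftrightarrow> x \<in> cbox b (\<chi> i. b $ i + 3 powi (- k))"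
      "grid_cell u k j \<in> sets lebesgue"
      by (rule grid_cell_cube)
    have "emeasure lebesgue (grid_cell u k j) = emeasure lebesgue (cbox b (\<chi> i. b $ i + 3 powi (- k)))"
      using b by (rule emeasure_eq_AE) simp
    also have "\<dots> = ennreal ((3 powi (- k)) ^ CARD('n))"
      by (rule emeasure_cube) simp
    also have "\<dots> \<le> ennreal ((6 * l) ^ CARD('n))"
      using kl(2) by (intro ennreal_leI power_mono) (auto simp: power_int_minus field_simps)
    also have "\<dots> = ennreal (6 ^ CARD('n)) * emeasure lebesgue R"
      using l by (simp add: R emeasure_cube power_mult_distrib ennreal_mult del: emeasure_completion)
    finally show ?thesis .
  qed
  then show ?thesis using that sub unfolding grid_def by blast
qed

text \<open>With c = 6^n this carries bounds from grid cells to the cubes inside them. The loss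
  \<open>c powr \<nu>\<close> is 1 at the end point \<nu> = 0.\<close>

lemma Lnorm_uniform_mono:
  assumes "R \<subseteq> Q" and R: "R \<in> sets M" "emeasure M R \<noteq> 0" "emeasure M R \<noteq> top"
    and Q: "Q \<in> sets M" "emeasure M Q \<noteq> 0" "emeasure M Q \<noteq> top"
    and le: "emeasure M Q \<le> ennreal c * emeasure M R" and c: "0 < c"
    and [measurable]: "f \<in> borel_measurable M" and "0 \<le> \<nu>"
  shows "Lnorm (uniform_measure M R) \<nu> f \<le> ennreal (c powr \<nu>) * Lnorm (uniform_measure M Q) \<nu> f"
proof (cases "\<nu> = 0")
  case True
  have "AE x in uniform_measure M Q. f x \<le> esssup (uniform_measure M Q) f"
    by (rule esssup_AE)
  then have "AE x in M. x \<in> Q \<longrightarrow> f x \<le> esssup (uniform_measure M Q) f"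
    using Q by (subst (asm) AE_uniform_measure) (auto simp: less_top)
  then have "AE x in uniform_measure M R. f x \<le> esssup (uniform_measure M Q) f"
    using R assms(1) by (subst AE_uniform_measure) (auto simp: less_top elim: eventually_mono)
  then show ?thesis using True c by (auto simp: Lnorm_def intro: esssup_I)
next
  case False
  have *: "(\<integral>\<^sup>+x. g x \<partial>uniform_measure M R) \<le> ennreal c * (\<integral>\<^sup>+x. g x \<partial>uniform_measure M Q)"
    if [measurable]: "g \<in> borel_measurable M" for g
  proof -
    have "(\<integral>\<^sup>+x. g x \<partial>uniform_measure M R) = (\<integral>\<^sup>+x\<in>R. g x \<partial>M) * inverse (emeasure M R)"
      using R by (simp add: nn_integral_uniform_measure divide_ennreal_def)
    also have "\<dots> \<le> (\<integral>\<^sup>+x\<in>Q. g x \<partial>M) * (ennreal c * inverse (emeasure M Q))"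
    proof (intro mult_mono)
      show "(\<integral>\<^sup>+x\<in>R. g x \<partial>M) \<le> (\<integral>\<^sup>+x\<in>Q. g x \<partial>M)"
        using assms(1) by (intro nn_integral_mono mult_left_mono) (auto simp: indicator_def)
      obtain r q where "emeasure M R = ennreal r" "0 < r" "emeasure M Q = ennreal q" "0 < q"
        using R Q by (metis ennreal_cases ennreal_0 less_eq_real_def)
      then show "inverse (emeasure M R) \<le> ennreal c * inverse (emeasure M Q)"
        using le c by (simp add: inverse_ennreal ennreal_le_iff flip: ennreal_mult) (simp add: field_simps)
    qed auto
    also have "\<dots> = ennreal c * (\<integral>\<^sup>+x. g x \<partial>uniform_measure M Q)"
      using Q by (simp add: nn_integral_uniform_measure divide_ennreal_def mult_ac)
    finally show ?thesis .
  qed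
  have "ennpowr (\<integral>\<^sup>+x. ennpowr (f x) (1 / \<nu>) \<partial>uniform_measure M R) \<nu>
    \<le> ennpowr (ennreal c * (\<integral>\<^sup>+x. ennpowr (f x) (1 / \<nu>) \<partial>uniform_measure M Q)) \<nu>"
    using assms by (intro ennpowr_mono *) auto
  then show ?thesis
    using False c by (simp add: Lnorm_def ennpowr_mult ennpowr_ennreal)
qed

section \<open>The Rubio de Francia algorithm\<close>

text \<open>A geometric series in the iterates of N, with ratio 1/(4 b) instead of the classical
  1/(2 b): the spare factor 2^-k takes the place of Minkowski's inequality for the series. The bound
  on \<open>N g\<close> is recorded because it will make R positive everywhere.\<close>

lemma rubio_de_francia:
  fixes N :: "('a \<Rightarrow> ennreal) \<Rightarrow> 'a \<Rightarrow> ennreal"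
  assumes \<kappa>: "1 \<le> \<kappa>" and b: "0 < b"
    and meas: "\<And>f. f \<in> borel_measurable M \<Longrightarrow> N f \<in> borel_measurable M"
    and bounded: "\<And>f. f \<in> borel_measurable M \<Longrightarrow>
      (\<integral>\<^sup>+x. ennpowr (N f x) \<kappa> \<partial>M) \<le> ennreal (b powr \<kappa>) * (\<integral>\<^sup>+x. ennpowr (f x) \<kappa> \<partial>M)"
    and sublinear: "\<And>f c x. (\<And>k::nat. f k \<in> borel_measurable M) \<Longrightarrow>
      N (\<lambda>y. \<Sum>k. c k * f k y) x \<le> (\<Sum>k. c k * N (f k) x)"
    and [measurable]: "g \<in> borel_measurable M"
  obtains R where "R \<in> borel_measurable M" "\<And>x. g x \<le> R x" "\<And>x. N R x \<le> ennreal (4 * b) * R x"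
    "\<And>x. N g x \<le> ennreal (4 * b) * R x"
    "(\<integral>\<^sup>+x. ennpowr (R x) \<kappa> \<partial>M) \<le> ennreal (2 * 2 powr \<kappa>) * (\<integral>\<^sup>+x. ennpowr (g x) \<kappa> \<partial>M)"
proof
  define R where "R x = (\<Sum>k. ennreal ((1 / (4 * b)) ^ k) * (N ^^ k) g x)" for x
  have [measurable]: "(N ^^ k) g \<in> borel_measurable M" for k
    by (induction k) (auto intro: meas)
  show "R \<in> borel_measurable M" unfolding R_def by measurable
  have term_le: "ennreal ((1 / (4 * b)) ^ k) * (N ^^ k) g x \<le> R x" for k x
    using sum_le_suminf [of "\<lambda>k. ennreal ((1 / (4 * b)) ^ k) * (N ^^ k) g x" "{k}"] by (simp add: R_def)
  show "g x \<le> R x" for x using term_le [of 0 x] by simp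
  have coeff: "ennreal ((1 / (4 * b)) ^ k) * z = ennreal (4 * b) * (ennreal ((1 / (4 * b)) ^ Suc k) * z)" for k z
    using b by (simp flip: mult.assoc ennreal_mult)
  show "N g x \<le> ennreal (4 * b) * R x" for x
    using mult_left_mono [OF term_le [of 1 x], of "ennreal (4 * b)"] coeff [of 0 "N g x"] by simp
  show "N R x \<le> ennreal (4 * b) * R x" for x
  proof -
    have "N R x \<le> (\<Sum>k. ennreal ((1 / (4 * b)) ^ k) * (N ^^ Suc k) g x)"
      unfolding R_def [abs_def] using sublinear [of "\<lambda>k. (N ^^ k) g"] by simp
    also have "\<dots> = ennreal (4 * b) * (\<Sum>k. ennreal ((1 / (4 * b)) ^ Suc k) * (N ^^ Suc k) g x)"
      by (subst coeff) (rule ennreal_suminf_cmult)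
    also have "(\<Sum>k. ennreal ((1 / (4 * b)) ^ Suc k) * (N ^^ Suc k) g x) \<le> R x"
    proof -
      have "(\<Sum>k. f (Suc k)) \<le> (\<Sum>k. f k)" for f :: "nat \<Rightarrow> ennreal"
        using sums_unique [OF sums_Suc [OF summable_sums [OF summableI]], of f] by (metis le_iff_add)
      then show ?thesis unfolding R_def .
    qed
    finally show ?thesis by (simp add: mult_left_mono)
  qed
  show "(\<integral>\<^sup>+x. ennpowr (R x) \<kappa> \<partial>M) \<le> ennreal (2 * 2 powr \<kappa>) * (\<integral>\<^sup>+x. ennpowr (g x) \<kappa> \<partial>M)"
  proof -
    define I where "I = (\<integral>\<^sup>+x. ennpowr (g x) \<kappa> \<partial>M)"
    define c where "c = 1 / (2 * b)"
    have c: "0 < c" using b by (simp add: c_def)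
    have half: "(\<Sum>k. ennreal ((1 / 2) ^ k)) = 2"
      by (subst suminf_ennreal2) (auto simp: summable_geometric suminf_geometric)
    have iter: "(\<integral>\<^sup>+x. ennpowr ((N ^^ k) g x) \<kappa> \<partial>M) \<le> ennreal ((b powr \<kappa>) ^ k) * I" for k
    proof (induction k)
      case (Suc k)
      have "(\<integral>\<^sup>+x. ennpowr ((N ^^ Suc k) g x) \<kappa> \<partial>M) \<le> ennreal (b powr \<kappa>) * (\<integral>\<^sup>+x. ennpowr ((N ^^ k) g x) \<kappa> \<partial>M)"
        using bounded [of "(N ^^ k) g"] by simp
      also have "\<dots> \<le> ennreal (b powr \<kappa>) * (ennreal ((b powr \<kappa>) ^ k) * I)"
        by (intro mult_left_mono Suc) auto
      finally show ?case by (simp add: ennreal_mult mult.assoc)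
    qed (simp add: I_def)
    \<comment> \<open>The k-th term is 2^-k times \<open>c ^ k * (N ^^ k) g\<close>, and each of the
      latter is at most the power 1/\<kappa> of the sum of all their \<kappa>-th powers. Integration
      then gives a series of ratio (c b)^\<kappa> = 2^-\<kappa> \<le> 1/2, hence the constant 2 *
      2^\<kappa>.\<close>
    have "ennpowr (R x) \<kappa> \<le> ennreal (2 powr \<kappa>) * (\<Sum>k. ennpowr (ennreal (c ^ k) * (N ^^ k) g x) \<kappa>)" (is "_ \<le> _ * ?S") for x
    proof -
      have "ennreal (c ^ k) * (N ^^ k) g x \<le> ennpowr ?S (1 / \<kappa>)" for k
      proof (subst ennpowr_le_iff [symmetric])
        show "ennpowr (ennreal (c ^ k) * (N ^^ k) g x) \<kappa> \<le> ?S"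
          using sum_le_suminf [of "\<lambda>k. ennpowr (ennreal (c ^ k) * (N ^^ k) g x) \<kappa>" "{k}"] by simp
      qed (use \<kappa> in simp)
      then have "ennreal ((1 / 2) ^ k) * (ennreal (c ^ k) * (N ^^ k) g x) \<le> ennreal ((1 / 2) ^ k) * ennpowr ?S (1 / \<kappa>)" for k
        by (intro mult_left_mono) auto
      moreover have "ennreal ((1 / 2) ^ k) * (ennreal (c ^ k) * (N ^^ k) g x) = ennreal ((1 / (4 * b)) ^ k) * (N ^^ k) g x" for k
      proof -
        have "(1 / 2) ^ k * c ^ k = (1 / (4 * b)) ^ k"
          unfolding power_mult_distrib [symmetric] by (simp add: c_def)
        then have "ennreal ((1 / 2) ^ k) * ennreal (c ^ k) = ennreal ((1 / (4 * b)) ^ k)"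
          using c by (simp add: ennreal_mult [symmetric])
        then show ?thesis by (simp only: mult.assoc [symmetric])
      qed
      ultimately have "R x \<le> (\<Sum>k. ennreal ((1 / 2) ^ k) * ennpowr ?S (1 / \<kappa>))"
        unfolding R_def by (intro suminf_le) auto
      also have "\<dots> = 2 * ennpowr ?S (1 / \<kappa>)"
        using half by simp
      finally have "ennpowr (R x) \<kappa> \<le> ennpowr (2 * ennpowr ?S (1 / \<kappa>)) \<kappa>"
        using \<kappa> by (intro ennpowr_mono) auto
      also have "\<dots> = ennreal (2 powr \<kappa>) * ?S"
        using \<kappa> ennpowr_ennreal [of 2 \<kappa>] by (simp add: ennpowr_mult ennpowr_ennpowr)
      finally show ?thesis .
    qed
    then have "(\<integral>\<^sup>+x. ennpowr (R x) \<kappa> \<partial>M)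
        \<le> (\<integral>\<^sup>+x. ennreal (2 powr \<kappa>) * (\<Sum>k. ennpowr (ennreal (c ^ k) * (N ^^ k) g x) \<kappa>) \<partial>M)"
      by (intro nn_integral_mono)
    also have "\<dots> = ennreal (2 powr \<kappa>) * (\<Sum>k. ennreal ((c powr \<kappa>) ^ k) * (\<integral>\<^sup>+x. ennpowr ((N ^^ k) g x) \<kappa> \<partial>M))"
    proof -
      have "(\<integral>\<^sup>+x. ennpowr (ennreal (c ^ k) * (N ^^ k) g x) \<kappa> \<partial>M)
          = ennreal ((c powr \<kappa>) ^ k) * (\<integral>\<^sup>+x. ennpowr ((N ^^ k) g x) \<kappa> \<partial>M)" for k
      proof -
        have "(c ^ k) powr \<kappa> = (c powr \<kappa>) ^ k"
          using c by (simp add: powr_realpow [symmetric] powr_powr mult.commute)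
        then show ?thesis
          using c by (simp add: ennpowr_mult ennpowr_ennreal nn_integral_cmult)
      qed
      then show ?thesis
        by (simp add: nn_integral_cmult nn_integral_suminf)
    qed
    also have "\<dots> \<le> ennreal (2 powr \<kappa>) * (\<Sum>k. ennreal ((1 / 2) ^ k) * I)"
    proof (intro mult_left_mono suminf_le)
      fix k
      have "ennreal ((c powr \<kappa>) ^ k) * (\<integral>\<^sup>+x. ennpowr ((N ^^ k) g x) \<kappa> \<partial>M)
          \<le> ennreal ((c powr \<kappa>) ^ k) * (ennreal ((b powr \<kappa>) ^ k) * I)"
        by (intro mult_left_mono iter) auto
      also have "\<dots> = ennreal (((1 / 2) powr \<kappa>) ^ k) * I"
      proof -
        have "c * b = 1 / 2" using b by (simp add: c_def)
        then have "(c powr \<kappa>) ^ k * (b powr \<kappa>) ^ k = ((1 / 2) powr \<kappa>) ^ k"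
          using b c by (simp only: power_mult_distrib [symmetric] powr_mult [symmetric] less_imp_le)
        then show ?thesis by (simp flip: mult.assoc ennreal_mult)
      qed
      also have "\<dots> \<le> ennreal ((1 / 2) ^ k) * I"
        using powr_mono' [of 1 \<kappa> "1 / 2"] \<kappa> by (intro mult_right_mono ennreal_leI power_mono) auto
      finally show "ennreal ((c powr \<kappa>) ^ k) * (\<integral>\<^sup>+x. ennpowr ((N ^^ k) g x) \<kappa> \<partial>M) \<le> ennreal ((1 / 2) ^ k) * I" .
    qed auto
    also have "\<dots> = ennreal (2 * 2 powr \<kappa>) * I"
      using half by (simp add: ennreal_mult mult_ac)
    finally show ?thesis by (simp add: I_def)
  qed
qed

section \<open>Maximal operators with a coefficient attached to each cube\<close>

abbreviation unif :: "(real^'n) set \<Rightarrow> (real^'n) measure" where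
  "unif Q \<equiv> uniform_measure lebesgue Q"

abbreviation lint :: "(real^'n \<Rightarrow> ennreal) \<Rightarrow> ennreal" where
  "lint f \<equiv> \<integral>\<^sup>+x. f x \<partial>lebesgue"

abbreviation wpow :: "(real^'n \<Rightarrow> real) \<Rightarrow> real \<Rightarrow> (real^'n \<Rightarrow> ennreal) \<Rightarrow> ennreal" where
  "wpow s \<kappa> f \<equiv> \<integral>\<^sup>+x. ennpowr (f x) \<kappa> * ennreal (s x) \<partial>lebesgue"

abbreviation wavg :: "(real^'n) set \<Rightarrow> (real^'n \<Rightarrow> real) \<Rightarrow> ennreal" where
  "wavg Q s \<equiv> \<integral>\<^sup>+y. ennreal (s y) \<partial>unif Q"

abbreviation wnorm :: "real \<Rightarrow> (real^'n \<Rightarrow> ennreal) \<Rightarrow> (real^'n \<Rightarrow> real) \<Rightarrow> ennreal" where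
  "wnorm \<nu> f w \<equiv> Lnorm lebesgue \<nu> (\<lambda>x. f x * ennreal (w x))"

abbreviation tavg :: "(real^'n \<Rightarrow> ennreal) \<Rightarrow> (real^'n \<Rightarrow> ennreal) \<Rightarrow> (real^'n) set \<Rightarrow> ennreal" where
  "tavg \<tau> f Q \<equiv> \<integral>\<^sup>+y. \<tau> y * f y \<partial>unif Q"

text \<open>In a step \<tau> is a geometric mean of the two weights being changed, and
  \<open>b Q\<close> collects the averages of the other weights together with a power of the average
  of the second one.\<close>

definition avgop :: "(real^'n) set set \<Rightarrow> ((real^'n) set \<Rightarrow> ennreal) \<Rightarrow> (real^'n \<Rightarrow> ennreal)
    \<Rightarrow> (real^'n \<Rightarrow> ennreal) \<Rightarrow> real^'n \<Rightarrow> ennreal" where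
  "avgop F b \<tau> f x = (SUP Q\<in>F. indicator Q x * (b Q * tavg \<tau> f Q))"

lemma borel_measurable_avgop:
  assumes "countable F" "F \<subseteq> sets lebesgue"
  shows "avgop F b \<tau> f \<in> lmeas"
  unfolding avgop_def [abs_def] using assms by (intro borel_measurable_SUP) auto

lemma avgop_upper: "Q \<in> F \<Longrightarrow> x \<in> Q \<Longrightarrow> b Q * tavg \<tau> f Q \<le> avgop F b \<tau> f x"
  unfolding avgop_def by (intro SUP_upper2 [of Q]) auto

lemma avgop_least: "(\<And>Q. Q \<in> F \<Longrightarrow> x \<in> Q \<Longrightarrow> b Q * tavg \<tau> f Q \<le> z) \<Longrightarrow> avgop F b \<tau> f x \<le> z"
  unfolding avgop_def by (intro SUP_least) (auto simp: indicator_def)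

lemma avgop_sublinear:
  assumes [measurable]: "\<tau> \<in> lmeas" "\<And>k::nat. f k \<in> lmeas"
  shows "avgop F b \<tau> (\<lambda>y. \<Sum>k. c k * f k y) x \<le> (\<Sum>k. c k * avgop F b \<tau> (f k) x)"
proof (rule avgop_least)
  fix Q assume Q: "Q \<in> F" "x \<in> Q"
  have "b Q * (\<integral>\<^sup>+y. \<tau> y * (\<Sum>k. c k * f k y) \<partial>unif Q)
      = b Q * (\<integral>\<^sup>+y. (\<Sum>k. c k * (\<tau> y * f k y)) \<partial>unif Q)"
    by (simp only: ennreal_suminf_cmult [symmetric] mult.left_commute)
  also have "\<dots> = b Q * (\<Sum>k. c k * (tavg \<tau> (f k) Q))"
    by (simp add: nn_integral_suminf nn_integral_cmult)
  also have "\<dots> = (\<Sum>k. c k * (b Q * tavg \<tau> (f k) Q))"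
    by (simp only: ennreal_suminf_cmult [symmetric] mult.left_commute)
  also have "\<dots> \<le> (\<Sum>k. c k * avgop F b \<tau> (f k) x)"
    using Q by (intro suminf_le mult_left_mono avgop_upper) auto
  finally show "b Q * (\<integral>\<^sup>+y. \<tau> y * (\<Sum>k. c k * f k y) \<partial>unif Q) \<le> (\<Sum>k. c k * avgop F b \<tau> (f k) x)" .
qed

lemma sigma_finite_lebesgue: "sigma_finite_measure (lebesgue :: (real^'n) measure)"
proof
  have "countable (range (\<lambda>k::nat. cball 0 (real k) :: (real^'n) set))" by simp
  moreover have "\<Union>(range (\<lambda>k::nat. cball 0 (real k))) = (UNIV :: (real^'n) set)"
    by (auto intro: real_arch_simple)
  moreover have "emeasure lebesgue (cball 0 (real k) :: (real^'n) set) \<noteq> \<infinity>" for k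
    using emeasure_lborel_cball_finite [of "0 :: real^'n" "real k"] by simp
  ultimately show "\<exists>A :: (real^'n) set set. countable A \<and> A \<subseteq> sets lebesgue \<and> \<Union> A = space lebesgue \<and> (\<forall>a\<in>A. emeasure lebesgue a \<noteq> \<infinity>)"
    by (intro exI [of _ "range (\<lambda>k::nat. cball 0 (real k))"]) auto
qed

lemma sigma_finite_weight:
  fixes s :: "real^'n \<Rightarrow> real"
  assumes "s \<in> lmeas"
  shows "sigma_finite_measure (density lebesgue (\<lambda>x. ennreal (s x)))"
  using assms by (subst sigma_finite_measure.sigma_finite_iff_density_finite [OF sigma_finite_lebesgue]) auto

section \<open>Two-weight bounds for averaging operators\<close>

text \<open>This puts a Lebesgue average of a product into the form of a mean for the weighted
  measure, to which the maximal theorem applies.\<close>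

lemma unif_weighted_average:
  assumes Q: "Q \<in> sets lebesgue" "emeasure lebesgue Q \<noteq> 0" "emeasure lebesgue Q \<noteq> top"
    and [measurable]: "S \<in> lmeas" "f \<in> lmeas"
    and S: "(\<integral>\<^sup>+y. S y \<partial>unif Q) \<noteq> 0" "(\<integral>\<^sup>+y. S y \<partial>unif Q) \<noteq> top"
  shows "(\<integral>\<^sup>+y. S y * f y \<partial>unif Q)
    = mean (density lebesgue S) Q f * (\<integral>\<^sup>+y. S y \<partial>unif Q)"
proof -
  note [measurable] = Q(1)
  define m where "m = emeasure (density lebesgue S) Q"
  define q where "q = emeasure lebesgue Q"
  have avg: "(\<integral>\<^sup>+y. S y \<partial>unif Q) = m / q"
    by (simp add: nn_integral_uniform_measure m_def q_def emeasure_density)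
  have m: "m \<noteq> 0" "m \<noteq> top"
    using S Q unfolding avg by (auto simp: q_def ennreal_top_divide simp del: emeasure_completion)
  have "(\<integral>\<^sup>+y. S y * f y \<partial>unif Q) = (\<integral>\<^sup>+y\<in>Q. f y \<partial>density lebesgue S) / q"
    by (simp add: nn_integral_uniform_measure q_def nn_integral_density mult.assoc del: emeasure_completion)
  also have "(\<integral>\<^sup>+y\<in>Q. f y \<partial>density lebesgue S) = (\<integral>\<^sup>+y\<in>Q. f y \<partial>density lebesgue S) / m * m"
    using m by (simp add: ennreal_divide_times ennreal_divide_self less_top)
  finally show ?thesis
    unfolding avg m_def [symmetric] by (simp add: ennreal_times_divide)
qed

lemma unif_AE_in:
  assumes "Q \<in> sets lebesgue"
  shows "AE y in unif Q. y \<in> Q"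
  using assms by (intro AE_uniform_measureI) auto

text \<open>Since \<tau> \<psi> = s1 \<phi>, the average of \<tau> \<psi> is an s1-mean of \<phi>
  times the average of s1. The bound on \<open>b\<close> and the comparison \<open>RH\<close> with
  the geometric mean \<omega> convert all averages into one factor, the average of s2, on both
  sides. What is left is a pointwise bound by an s2-maximal function, taken of a power of an
  s1-maximal function times \<omega> / s2. The exponents \<kappa> and r make the weights match at
  both uses of the maximal theorem.\<close>

lemma avgop_weighted_bound:
  fixes s1 s2 :: "real^'n \<Rightarrow> real" and b :: "(real^'n) set \<Rightarrow> ennreal"
  assumes [measurable]: "s1 \<in> lmeas" "s2 \<in> lmeas"
      "\<psi> \<in> lmeas"
    and pos: "\<And>x. 0 < s1 x" "\<And>x. 0 < s2 x"
    and A: "0 < A1" "0 < A2" "0 < d" and K: "0 \<le> K"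
    and avg: "\<And>Q. Q \<in> grid u \<Longrightarrow> (wavg Q s1) \<notin> {0, top}"
      "\<And>Q. Q \<in> grid u \<Longrightarrow> (wavg Q s2) \<notin> {0, top}"
    and RH: "\<And>Q. Q \<in> grid u \<Longrightarrow>
      ennpowr (wavg Q s1) A1 * ennpowr (wavg Q s2) A2
      \<le> ennreal K * ennpowr (\<integral>\<^sup>+y. ennreal ((s1 y powr A1 * s2 y powr A2) powr (1 / (A1 + A2))) \<partial>unif Q) (A1 + A2)"
    and b: "\<And>Q. Q \<in> grid u \<Longrightarrow>
      ennpowr (b Q) (A1 + d) * ennpowr (wavg Q s1) A1
        * ennpowr (wavg Q s2) d \<le> ennreal K"
  defines "\<tau> \<equiv> \<lambda>x. ennreal ((s1 x powr A1 * s2 x powr d) powr (1 / (A1 + d)))"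
    and "\<kappa> \<equiv> (A1 + d) / d" and "r \<equiv> (A1 + A2) / A1"
  shows "(wpow s2 \<kappa> (avgop (grid u) b \<tau> \<psi>))
    \<le> ennreal (K powr (1 / d + 1 / A1)) * ennreal (2 powr r * r / (r - 1)) * ennreal (2 powr \<kappa> * \<kappa> / (\<kappa> - 1))
      * wpow s2 \<kappa> \<psi>"
proof -
  define a where "a = A1 / (A1 + A2)"
  have a: "0 < a" "a < 1" "1 - a = A2 / (A1 + A2)" "1 / a = r"
    using A add_pos_pos [OF A(1,2)] by (simp_all add: a_def r_def diff_divide_eq_iff)
  have \<kappa>: "1 < \<kappa>" "1 / \<kappa> = d / (A1 + d)" and r: "1 < r"
    using A by (simp_all add: \<kappa>_def r_def)
  define M1 where "M1 = density lebesgue (\<lambda>x. ennreal (s1 x))"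
  define M2 where "M2 = density lebesgue (\<lambda>x. ennreal (s2 x))"
  define \<omega> where "\<omega> x = (s1 x powr A1 * s2 x powr A2) powr (1 / (A1 + A2))" for x
  \<comment> \<open>With this factor the integral of \<phi>^\<kappa> s1 equals that of
    \<psi>^\<kappa> s2.\<close>
  define \<phi> where "\<phi> x = ennreal ((s2 x / s1 x) powr (1 / \<kappa>)) * \<psi> x" for x
  define F where "F = maxop M1 (grid u) \<phi>"
  \<comment> \<open>Then s2 \<Phi> = F^(\<kappa> a) \<omega>, as the pointwise estimate needs, and
    s2 \<Phi>^r = s1 F^\<kappa> because r = 1/a, which leads back from the second weight to the
    first.\<close>
  define \<Phi> where "\<Phi> x = ennpowr (F x) (\<kappa> * a) * ennreal (\<omega> x / s2 x)" for x
  define G where "G = maxop M2 (grid u) \<Phi>"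
  have sub: "grid u \<subseteq> sets lebesgue" using grid_sets by auto
  have [measurable_cong]: "sets M1 = sets lebesgue" "sets M2 = sets lebesgue"
    by (simp_all add: M1_def M2_def)
  have [measurable]: "\<omega> \<in> lmeas" "\<phi> \<in> lmeas"
    unfolding \<omega>_def [abs_def] \<phi>_def [abs_def] by measurable
  have "F \<in> borel_measurable M1"
    unfolding F_def using sub by (intro borel_measurable_maxop) (auto simp: M1_def)
  then have [measurable]: "F \<in> lmeas" by (simp add: M1_def)
  have [measurable]: "\<Phi> \<in> lmeas"
    unfolding \<Phi>_def [abs_def] by measurable
  have "G \<in> borel_measurable M2"
    unfolding G_def using sub by (intro borel_measurable_maxop) (auto simp: M2_def)
  then have [measurable]: "G \<in> lmeas" by (simp add: M2_def)
  have \<omega>pos: "0 < \<omega> x" for x using pos [of x] by (simp add: \<omega>_def)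
  have \<tau>: "\<tau> x * \<psi> x = ennreal (s1 x) * \<phi> x" for x
  proof -
    have "(s1 x powr A1 * s2 x powr d) powr (1 / (A1 + d)) = s1 x * (s2 x / s1 x) powr (1 / \<kappa>)"
    proof -
      have "s1 x powr (A1 / (A1 + d)) = s1 x powr (1 - d / (A1 + d))"
        using A add_pos_pos [OF A(1,3)] by (simp add: diff_divide_eq_iff)
      then show ?thesis
        using pos [of x] by (simp add: \<kappa>(2) powr_mult powr_powr powr_divide powr_diff)
    qed
    then show ?thesis using pos [of x] by (simp add: \<tau>_def \<phi>_def ennreal_mult mult.assoc)
  qed
  define C where "C = K powr (a / d + 1 / (A1 + A2))"
  have key: "ennpowr (avgop (grid u) b \<tau> \<psi> x) (\<kappa> * a) \<le> ennreal C * G x" for x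
  proof (subst ennpowr_le_iff)
    show "0 < \<kappa> * a" using \<kappa> a by simp
    show "avgop (grid u) b \<tau> \<psi> x \<le> ennpowr (ennreal C * G x) (1 / (\<kappa> * a))"
    proof (rule avgop_least)
      fix Q assume Q: "Q \<in> grid u" "x \<in> Q"
      note [measurable] = grid_sets [OF Q(1)]
      note Qe = grid_emeasure [OF Q(1)]
      define B1 where "B1 = (wavg Q s1)"
      define B2 where "B2 = (wavg Q s2)"
      define W where "W = (wavg Q \<omega>)"
      define X where "X = (tavg \<tau> \<psi> Q)"
      define E where "E = (\<integral>\<^sup>+y\<in>Q. \<phi> y \<partial>M1) / emeasure M1 Q"
      define E2 where "E2 = (\<integral>\<^sup>+y\<in>Q. \<Phi> y \<partial>M2) / emeasure M2 Q"
      have B: "B1 \<noteq> 0" "B1 \<noteq> top" "B2 \<noteq> 0" "B2 \<noteq> top"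
        using avg [OF Q(1)] by (auto simp: B1_def B2_def)
      have X: "X = E * B1"
        unfolding X_def \<tau> E_def B1_def M1_def
        by (rule unif_weighted_average) (use Qe B in \<open>simp_all add: B1_def del: emeasure_completion\<close>)
      have E2: "(\<integral>\<^sup>+y. ennreal (s2 y) * \<Phi> y \<partial>unif Q) = E2 * B2"
        unfolding E2_def B2_def M2_def
        by (rule unif_weighted_average) (use Qe B in \<open>simp_all add: B2_def del: emeasure_completion\<close>)
      have EF: "E \<le> F y" if "y \<in> Q" for y
        unfolding E_def F_def maxop_def using that Q by (intro SUP_upper2 [of Q]) auto
      have E2G: "E2 \<le> G x"
        unfolding E2_def G_def maxop_def using Q by (intro SUP_upper2 [of Q]) auto
      have RH': "ennpowr B1 A1 * ennpowr B2 A2 \<le> ennreal K * ennpowr W (A1 + A2)"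
        using RH [OF Q(1)] by (simp add: B1_def B2_def W_def \<omega>_def)
      have b': "ennpowr (b Q) (A1 + d) * ennpowr B1 A1 * ennpowr B2 d \<le> ennreal K"
        using b [OF Q(1)] by (simp add: B1_def B2_def)
      have 1: "ennpowr B1 a * ennpowr B2 (1 - a) \<le> ennreal (K powr (1 / (A1 + A2))) * W"
      proof -
        have "ennpowr (ennpowr B1 A1 * ennpowr B2 A2) (1 / (A1 + A2))
            \<le> ennpowr (ennreal K * ennpowr W (A1 + A2)) (1 / (A1 + A2))"
          using A by (intro ennpowr_mono RH') auto
        then show ?thesis
          using A K add_pos_pos [OF A(1,2)] unfolding a(3)
          by (simp add: ennpowr_mult ennpowr_ennpowr ennpowr_ennreal a_def)
      qed
      have 2: "ennpowr (b Q * X) (\<kappa> * a) * ennpowr B2 a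
          \<le> ennreal (K powr (a / d)) * (ennpowr E (\<kappa> * a) * ennpowr B1 a)"
      proof -
        have "ennpowr (b Q * X) (A1 + d) * ennpowr B2 d
            = (ennpowr (b Q) (A1 + d) * ennpowr B1 A1 * ennpowr B2 d) * (ennpowr E (A1 + d) * ennpowr B1 d)"
          unfolding X by (simp add: ennpowr_mult ennpowr_add mult_ac)
        also have "\<dots> \<le> ennreal K * (ennpowr E (A1 + d) * ennpowr B1 d)"
          by (intro mult_right_mono b') auto
        finally have "ennpowr (ennpowr (b Q * X) (A1 + d) * ennpowr B2 d) (a / d)
            \<le> ennpowr (ennreal K * (ennpowr E (A1 + d) * ennpowr B1 d)) (a / d)"
          using A a by (intro ennpowr_mono) auto
        then show ?thesis
          using A K by (simp add: ennpowr_mult ennpowr_ennpowr ennpowr_ennreal \<kappa>_def)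
      qed
      have 3: "ennpowr E (\<kappa> * a) * W \<le> G x * B2"
      proof -
        have "ennpowr E (\<kappa> * a) * W = (\<integral>\<^sup>+y. ennpowr E (\<kappa> * a) * ennreal (\<omega> y) \<partial>unif Q)"
          unfolding W_def by (rule nn_integral_cmult [symmetric]) measurable
        also have "\<dots> \<le> (\<integral>\<^sup>+y. ennreal (s2 y) * \<Phi> y \<partial>unif Q)"
        proof (rule nn_integral_mono_AE)
          show "AE y in unif Q. ennpowr E (\<kappa> * a) * ennreal (\<omega> y) \<le> ennreal (s2 y) * \<Phi> y"
            using unif_AE_in [OF grid_sets [OF Q(1)]]
          proof eventually_elim
            case (elim y)
            have "ennpowr E (\<kappa> * a) * ennreal (\<omega> y) \<le> ennpowr (F y) (\<kappa> * a) * ennreal (\<omega> y)"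
              using \<kappa> a EF [OF elim] by (intro mult_right_mono ennpowr_mono) auto
            also have "\<dots> = ennreal (s2 y) * \<Phi> y"
            proof -
              have "ennreal (\<omega> y) = ennreal (s2 y) * ennreal (\<omega> y / s2 y)"
                using pos(2) [of y] \<omega>pos [of y] by (simp add: ennreal_mult [symmetric])
              then show ?thesis by (simp only: \<Phi>_def mult.left_commute)
            qed
            finally show ?case .
          qed
        qed
        also have "\<dots> \<le> G x * B2" unfolding E2 by (intro mult_right_mono E2G) auto
        finally show ?thesis .
      qed
      \<comment> \<open>The powers a and 1 - a of \<open>B2\<close> are absorbed by \<open>2\<close>
        and \<open>1\<close>; a full factor \<open>B2\<close> returns through \<open>3\<close> and
        cancels.\<close>
      have "ennpowr (b Q * X) (\<kappa> * a) * B2 = (ennpowr (b Q * X) (\<kappa> * a) * ennpowr B2 a) * ennpowr B2 (1 - a)"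
        using ennpowr_add [of B2 a "1 - a"] by (simp add: mult.assoc)
      also have "\<dots> \<le> (ennreal (K powr (a / d)) * (ennpowr E (\<kappa> * a) * ennpowr B1 a)) * ennpowr B2 (1 - a)"
        by (intro mult_right_mono 2) auto
      also have "\<dots> = ennreal (K powr (a / d)) * ennpowr E (\<kappa> * a) * (ennpowr B1 a * ennpowr B2 (1 - a))"
        by (simp only: mult_ac)
      also have "\<dots> \<le> ennreal (K powr (a / d)) * ennpowr E (\<kappa> * a) * (ennreal (K powr (1 / (A1 + A2))) * W)"
        by (intro mult_left_mono 1) auto
      also have "\<dots> = ennreal C * (ennpowr E (\<kappa> * a) * W)"
        by (simp add: C_def powr_add ennreal_mult mult_ac)
      also have "\<dots> \<le> ennreal C * (G x * B2)"
        by (intro mult_left_mono 3) auto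
      finally have "B2 * ennpowr (b Q * X) (\<kappa> * a) \<le> B2 * (ennreal C * G x)"
        by (simp only: mult_ac)
      then have "ennpowr (b Q * X) (\<kappa> * a) \<le> ennreal C * G x"
        using B by (simp add: ennreal_mult_le_mult_iff)
      then show "b Q * tavg \<tau> \<psi> Q \<le> ennpowr (ennreal C * G x) (1 / (\<kappa> * a))"
        using \<kappa> a by (subst ennpowr_le_iff [symmetric]) (auto simp: X_def)
    qed
  qed
  have "(wpow s2 \<kappa> (avgop (grid u) b \<tau> \<psi>))
      \<le> (\<integral>\<^sup>+x. ennreal (C powr r) * (ennreal (s2 x) * ennpowr (G x) r) \<partial>lebesgue)"
  proof (intro nn_integral_mono)
    fix x
    have "ennpowr (ennpowr (avgop (grid u) b \<tau> \<psi> x) (\<kappa> * a)) r \<le> ennpowr (ennreal C * G x) r"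
      using r by (intro ennpowr_mono key) auto
    moreover have "\<kappa> * a * r = \<kappa>" using a by (simp flip: a(4))
    ultimately have "ennpowr (avgop (grid u) b \<tau> \<psi> x) \<kappa> \<le> ennreal (C powr r) * ennpowr (G x) r"
      by (simp add: ennpowr_ennpowr ennpowr_mult ennpowr_ennreal C_def)
    from mult_right_mono [OF this, of "ennreal (s2 x)"]
    show "ennpowr (avgop (grid u) b \<tau> \<psi> x) \<kappa> * ennreal (s2 x) \<le> ennreal (C powr r) * (ennreal (s2 x) * ennpowr (G x) r)"
      by (simp add: mult_ac)
  qed
  also have "\<dots> = ennreal (C powr r) * (\<integral>\<^sup>+x. ennpowr (G x) r \<partial>M2)"
    by (simp add: M2_def nn_integral_density nn_integral_cmult)
  also have "\<dots> \<le> ennreal (C powr r) * (ennreal (2 powr r * r / (r - 1)) * (\<integral>\<^sup>+x. ennpowr (\<Phi> x) r \<partial>M2))"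
    unfolding G_def
    by (intro mult_left_mono maxop_strong_type [OF _ _ _ grid_laminar])
      (use sub r in \<open>simp_all add: M2_def sigma_finite_weight\<close>)
  also have "(\<integral>\<^sup>+x. ennpowr (\<Phi> x) r \<partial>M2) = (\<integral>\<^sup>+x. ennpowr (F x) \<kappa> \<partial>M1)"
  proof -
    have "ennreal (s2 x) * ennpowr (\<Phi> x) r = ennreal (s1 x) * ennpowr (F x) \<kappa>" for x
    proof -
      have "s2 x * (\<omega> x / s2 x) powr r = s1 x"
      proof -
        have "(\<omega> x / s2 x) powr r = s1 x powr 1 * s2 x powr (A2 / A1) / s2 x powr (1 + A2 / A1)"
        proof -
          have e: "A1 * (1 / (A1 + A2) * r) = 1" "A2 * (1 / (A1 + A2) * r) = A2 / A1"
            using A add_pos_pos [OF A(1,2)] by (simp_all add: r_def)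
          have e': "r = 1 + A2 / A1"
            using A by (simp add: r_def add_divide_distrib)
          have "\<omega> x powr r = s1 x powr 1 * s2 x powr (A2 / A1)"
            unfolding \<omega>_def powr_powr using pos [of x] by (simp only: powr_mult powr_powr e powr_ge_zero)
          then show ?thesis using pos [of x] \<omega>pos [of x] by (simp add: powr_divide e')
        qed
        then show ?thesis using pos [of x] by (simp add: powr_add)
      qed
      then have "ennreal (s2 x) * ennreal ((\<omega> x / s2 x) powr r) = ennreal (s1 x)"
        using pos [of x] by (simp flip: ennreal_mult)
      moreover have "ennpowr (\<Phi> x) r = ennpowr (F x) \<kappa> * ennreal ((\<omega> x / s2 x) powr r)"
      proof -
        have "\<kappa> * a * r = \<kappa>" using a by (simp flip: a(4))
        moreover have "0 \<le> \<omega> x / s2 x" using pos [of x] \<omega>pos [of x] by simp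
        ultimately show ?thesis
          unfolding \<Phi>_def ennpowr_mult ennpowr_ennpowr by (simp only: ennpowr_ennreal)
      qed
      ultimately show ?thesis by (metis mult.left_commute mult.commute)
    qed
    then show ?thesis by (simp add: M1_def M2_def nn_integral_density)
  qed
  also have "\<dots> \<le> ennreal (2 powr \<kappa> * \<kappa> / (\<kappa> - 1)) * (\<integral>\<^sup>+x. ennpowr (\<phi> x) \<kappa> \<partial>M1)"
    unfolding F_def
    by (rule maxop_strong_type [OF _ _ _ grid_laminar])
      (use sub \<kappa> in \<open>simp_all add: M1_def sigma_finite_weight\<close>)
  also have "(\<integral>\<^sup>+x. ennpowr (\<phi> x) \<kappa> \<partial>M1) = (wpow s2 \<kappa> \<psi>)"
  proof -
    have "ennreal (s1 x) * ennpowr (\<phi> x) \<kappa> = ennpowr (\<psi> x) \<kappa> * ennreal (s2 x)" for x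
    proof -
      have "ennreal (s1 x) * ennreal (s2 x / s1 x) = ennreal (s2 x)"
        using pos [of x] by (simp flip: ennreal_mult)
      moreover have "ennpowr (\<phi> x) \<kappa> = ennreal (s2 x / s1 x) * ennpowr (\<psi> x) \<kappa>"
      proof -
        have "1 / \<kappa> * \<kappa> = 1" using \<kappa>(1) by simp
        then show ?thesis
          using pos [of x] unfolding \<phi>_def ennpowr_mult
          by (subst ennpowr_ennreal) (simp_all only: powr_powr powr_one powr_ge_zero divide_nonneg_nonneg less_imp_le)
      qed
      ultimately show ?thesis by (metis mult.assoc mult.commute)
    qed
    then show ?thesis by (simp add: M1_def nn_integral_density)
  qed
  also have "C powr r = K powr (1 / d + 1 / A1)"
  proof -
    have "a * r = 1" "1 / (A1 + A2) * r = 1 / A1"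
      using A add_pos_pos [OF A(1,2)] by (simp_all add: r_def a_def)
    then have "(a / d + 1 / (A1 + A2)) * r = 1 / d + 1 / A1"
      unfolding distrib_right by simp
    then show ?thesis by (simp only: C_def powr_powr)
  qed
  finally show ?thesis by (simp add: mult.assoc mult_left_mono)
qed

section \<open>The operator over all grids, and majorants adapted to it\<close>

definition all_grid :: "(real^'n) set set" where
  "all_grid = (\<Union>u. grid u)"

lemma all_grid_props:
  "countable all_grid" "all_grid \<subseteq> sets lebesgue"
  "Q \<in> all_grid \<Longrightarrow> Q \<in> sets lebesgue"
  "Q \<in> all_grid \<Longrightarrow> emeasure lebesgue Q \<noteq> 0"
  "Q \<in> all_grid \<Longrightarrow> emeasure lebesgue Q \<noteq> top"
proof -
  show "countable all_grid"
    unfolding all_grid_def by (intro countable_UN countable_grid) (simp add: countable_finite)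
qed (use grid_sets grid_emeasure in \<open>unfold all_grid_def; blast\<close>)+

text \<open>\<open>A1\<close> and \<open>A2\<close> stand for the exponents of the two weights
  before a step, d for the amount moved. The first inequality compares the pair with its geometric
  mean on each cell; in the second, the left side will be the whole product that defines the
  class.\<close>

definition step_data :: "real \<Rightarrow> real \<Rightarrow> real \<Rightarrow> real \<Rightarrow> (real^'n \<Rightarrow> real) \<Rightarrow> (real^'n \<Rightarrow> real)
    \<Rightarrow> ((real^'n) set \<Rightarrow> ennreal) \<Rightarrow> bool" where
  "step_data A1 A2 d K s1 s2 b \<longleftrightarrow>
    s1 \<in> lmeas \<and> s2 \<in> lmeas \<and>
    (\<forall>x. 0 < s1 x) \<and> (\<forall>x. 0 < s2 x) \<and>
    (\<forall>Q\<in>all_grid. b Q \<noteq> 0 \<and>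
      (wavg Q s1) \<notin> {0, top} \<and> (wavg Q s2) \<notin> {0, top} \<and>
      ennpowr (wavg Q s1) A1 * ennpowr (wavg Q s2) A2
        \<le> ennreal K * ennpowr (\<integral>\<^sup>+y. ennreal ((s1 y powr A1 * s2 y powr A2) powr (1 / (A1 + A2))) \<partial>unif Q) (A1 + A2) \<and>
      ennpowr (b Q) (A1 + d) * ennpowr (wavg Q s1) A1
        * ennpowr (wavg Q s2) d \<le> ennreal K)"

definition mix :: "real \<Rightarrow> real \<Rightarrow> (real^'n \<Rightarrow> real) \<Rightarrow> (real^'n \<Rightarrow> real) \<Rightarrow> real^'n \<Rightarrow> real" where
  "mix A1 d s1 s2 x = (s1 x powr A1 * s2 x powr d) powr (1 / (A1 + d))"

text \<open>There are 2^n grids, and the \<kappa>-th power of the supremum over them is at most the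
  sum of the \<kappa>-th powers.\<close>

lemma avgop_all_grid_bound:
  fixes s1 s2 :: "real^'n \<Rightarrow> real"
  assumes data: "step_data A1 A2 d K s1 s2 b" and [measurable]: "\<psi> \<in> lmeas"
    and A: "0 < A1" "0 < A2" "0 < d" and K: "0 \<le> K"
  defines "\<kappa> \<equiv> (A1 + d) / d" and "r \<equiv> (A1 + A2) / A1"
  shows "(wpow s2 \<kappa> (avgop all_grid b (\<lambda>x. ennreal (mix A1 d s1 s2 x)) \<psi>))
    \<le> ennreal (2 ^ CARD('n) * (K powr (1 / d + 1 / A1) * (2 powr r * r / (r - 1)) * (2 powr \<kappa> * \<kappa> / (\<kappa> - 1))))
      * wpow s2 \<kappa> \<psi>"
proof -
  let ?\<tau> = "\<lambda>x. ennreal (mix A1 d s1 s2 x)"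
  let ?I = "\<integral>\<^sup>+x. ennpowr (\<psi> x) \<kappa> * ennreal (s2 x) \<partial>lebesgue"
  define C where "C = K powr (1 / d + 1 / A1) * (2 powr r * r / (r - 1)) * (2 powr \<kappa> * \<kappa> / (\<kappa> - 1))"
  have \<kappa>: "1 < \<kappa>" and r: "1 < r" using A by (simp_all add: \<kappa>_def r_def)
  have [measurable]: "s2 \<in> lmeas" using data by (simp add: step_data_def)
  have [measurable]: "avgop (grid u) b ?\<tau> \<psi> \<in> lmeas" for u
    using grid_sets by (intro borel_measurable_avgop) auto
  have single: "(wpow s2 \<kappa> (avgop (grid u) b ?\<tau> \<psi>)) \<le> ennreal C * ?I" for u
  proof -
    have sub: "Q \<in> all_grid" if "Q \<in> grid u" for Q using that by (auto simp: all_grid_def)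
    have "(wpow s2 \<kappa> (avgop (grid u) b ?\<tau> \<psi>))
      \<le> ennreal (K powr (1 / d + 1 / A1)) * ennreal (2 powr r * r / (r - 1)) * ennreal (2 powr \<kappa> * \<kappa> / (\<kappa> - 1)) * ?I"
      unfolding mix_def \<kappa>_def r_def
      by (rule avgop_weighted_bound) (use data sub A K in \<open>simp_all add: step_data_def\<close>)
    moreover have "ennreal C = ennreal (K powr (1 / d + 1 / A1)) * ennreal (2 powr r * r / (r - 1))
        * ennreal (2 powr \<kappa> * \<kappa> / (\<kappa> - 1))"
    proof -
      have nn: "0 \<le> 2 powr \<kappa> * \<kappa> / (\<kappa> - 1)" "0 \<le> 2 powr r * r / (r - 1)"
        using \<kappa> r by simp_all
      show ?thesis by (simp only: C_def ennreal_mult'' [OF nn(1)] ennreal_mult'' [OF nn(2)])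
    qed
    ultimately show ?thesis by simp
  qed
  have "avgop all_grid b ?\<tau> \<psi> x = (SUP u. avgop (grid u) b ?\<tau> \<psi> x)" for x
    unfolding avgop_def all_grid_def by (simp add: SUP_UNION)
  then have "ennpowr (avgop all_grid b ?\<tau> \<psi> x) \<kappa> = (SUP u. ennpowr (avgop (grid u) b ?\<tau> \<psi> x) \<kappa>)" for x
    using \<kappa> by (simp add: ennpowr_SUP)
  moreover have "(SUP u. ennpowr (avgop (grid u) b ?\<tau> \<psi> x) \<kappa>) \<le> (\<Sum>u\<in>UNIV. ennpowr (avgop (grid u) b ?\<tau> \<psi> x) \<kappa>)" for x
    by (intro SUP_least member_le_sum) auto
  ultimately have "(wpow s2 \<kappa> (avgop all_grid b ?\<tau> \<psi>))
      \<le> (\<integral>\<^sup>+x. (\<Sum>u\<in>UNIV. ennpowr (avgop (grid u) b ?\<tau> \<psi> x) \<kappa> * ennreal (s2 x)) \<partial>lebesgue)"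
    by (intro nn_integral_mono) (simp add: sum_distrib_right [symmetric] mult_right_mono)
  also have "\<dots> = (\<Sum>u\<in>UNIV. \<integral>\<^sup>+x. ennpowr (avgop (grid u) b ?\<tau> \<psi> x) \<kappa> * ennreal (s2 x) \<partial>lebesgue)"
    by (rule nn_integral_sum) measurable
  also have "\<dots> \<le> (\<Sum>u\<in>(UNIV :: ('n \<Rightarrow> bool) set). ennreal C * ?I)"
    by (intro sum_mono single)
  also have "\<dots> = ennreal (2 ^ CARD('n) * C) * ?I"
  proof -
    have card: "of_nat CARD('n \<Rightarrow> bool) = ennreal (2 ^ CARD('n))"
      by (simp only: ennreal_of_nat_eq_real_of_nat card_fun card_UNIV_bool) simp
    have "ennreal (2 ^ CARD('n) * C) = ennreal (2 ^ CARD('n)) * ennreal C"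
      by (rule ennreal_mult') simp
    then show ?thesis by (simp only: sum_constant card mult.assoc)
  qed
  finally show ?thesis by (simp add: C_def)
qed

lemma AE_not_False_unif:
  assumes "Q \<in> sets lebesgue" "emeasure lebesgue Q \<noteq> 0" "emeasure lebesgue Q \<noteq> top"
  shows "\<not> (AE x in unif Q. False)"
proof -
  have "emeasure (unif Q) Q = 1" using assms by (intro emeasure_uniform_measure_1) auto
  moreover have "emeasure (unif Q) Q \<le> emeasure (unif Q) (space (unif Q))"
    by (rule emeasure_space)
  ultimately have "ae_filter (unif Q) \<noteq> bot"
    by (auto simp: ae_filter_eq_bot_iff)
  then show ?thesis by (simp add: eventually_False)
qed

text \<open>Cubes centred at x exhaust the space and each lies in some cell, so the value 0 at x
  would make \<psi> vanish almost everywhere. This yields weights that are positive at every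
  point.\<close>

lemma avgop_all_grid_nonzero:
  fixes \<psi> :: "real^'n \<Rightarrow> ennreal"
  assumes b: "\<And>Q. Q \<in> all_grid \<Longrightarrow> b Q \<noteq> 0" and \<tau>: "\<And>x. \<tau> x \<noteq> 0"
    and [measurable]: "\<tau> \<in> lmeas" "\<psi> \<in> lmeas"
    and \<psi>: "\<not> (AE x in lebesgue. \<psi> x = 0)"
  shows "avgop all_grid b \<tau> \<psi> x \<noteq> 0"
proof
  assume 0: "avgop all_grid b \<tau> \<psi> x = 0"
  \<comment> \<open>The cube with centre x and half-side m + 1, which is nondegenerate also for m =
    0.\<close>
  define R where "R m = cbox (\<chi> i. x $ i - real (Suc m)) (\<chi> i. (\<chi> i. x $ i - real (Suc m)) $ i + 2 * real (Suc m))" for m :: nat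
  have R: "R m \<in> cubes" for m
    unfolding R_def cubes_def by (intro CollectI exI conjI) (rule refl, simp)
  have "AE y in lebesgue. y \<in> R m \<longrightarrow> \<psi> y = 0" for m
  proof -
    obtain u Q where Q: "Q \<in> grid u" "R m \<subseteq> Q" by (rule cube_subset_grid [OF R])
    then have Qa: "Q \<in> all_grid" by (auto simp: all_grid_def)
    note [measurable] = all_grid_props(3) [OF Qa]
    have "x \<in> R m" by (simp add: R_def mem_box_cart)
    with Q have "b Q * tavg \<tau> \<psi> Q \<le> 0"
      using avgop_upper [OF Qa, of x b \<tau> \<psi>] 0 by auto
    then have "(tavg \<tau> \<psi> Q) = 0" using b [OF Qa] by simp
    then have "AE y in unif Q. \<psi> y = 0" using \<tau> by (simp add: nn_integral_0_iff_AE)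
    then have "AE y in lebesgue. y \<in> Q \<longrightarrow> \<psi> y = 0"
      using all_grid_props(4,5) [OF Qa] by (subst (asm) AE_uniform_measure) (auto simp: less_top simp del: emeasure_completion)
    then show ?thesis using Q(2) by (auto elim: eventually_mono)
  qed
  then have "AE y in lebesgue. \<forall>m. y \<in> R m \<longrightarrow> \<psi> y = 0" by (simp only: AE_all_countable simp_thms)
  moreover have "\<exists>m. y \<in> R m" for y
  proof -
    obtain m :: nat where m: "norm (y - x) \<le> real m" using real_arch_simple by blast
    have "\<bar>y $ i - x $ i\<bar> \<le> real m" for i
      using component_le_norm_cart [of "y - x"] m by (metis order_trans vector_minus_component)
    from this [unfolded abs_le_iff]
    have "x $ i - real (Suc m) \<le> y $ i \<and> y $ i \<le> x $ i - real (Suc m) + 2 * real (Suc m)" for i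
      by (simp add: add_increasing algebra_simps)
    then have "y \<in> R m" by (simp only: R_def mem_box_cart vec_lambda_beta simp_thms)
    then show ?thesis ..
  qed
  ultimately have "AE y in lebesgue. \<psi> y = 0" by (auto elim!: eventually_mono)
  with \<psi> show False ..
qed

text \<open>The majorant of h is s2 r^\<kappa> with \<kappa> = (A1 + d) / d. It is kept in terms of
  r because the last clause, a condition of type A_1 with constant \<open>D\<close>, concerns r
  itself; \<open>E\<close> is the cost of the majorant in norm.\<close>

definition majorizes :: "real \<Rightarrow> real \<Rightarrow> real \<Rightarrow> real \<Rightarrow> (real^'n \<Rightarrow> real) \<Rightarrow> (real^'n \<Rightarrow> real)
    \<Rightarrow> ((real^'n) set \<Rightarrow> ennreal) \<Rightarrow> (real^'n \<Rightarrow> ennreal) \<Rightarrow> (real^'n \<Rightarrow> real) \<Rightarrow> bool" where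
  "majorizes A1 d D E s1 s2 b h r \<longleftrightarrow> r \<in> lmeas \<and> (\<forall>x. 0 < r x) \<and>
     (AE x in lebesgue. h x \<le> ennreal (s2 x * r x powr ((A1 + d) / d))) \<and>
     (\<integral>\<^sup>+x. ennreal (s2 x * r x powr ((A1 + d) / d)) \<partial>lebesgue) \<le> ennreal E * lint h \<and>
     (\<forall>Q\<in>all_grid. let Y = wavg Q (\<lambda>y. mix A1 d s1 s2 y * r y) in
       Y \<noteq> 0 \<and> Y \<noteq> top \<and> (AE x in unif Q. b Q * Y \<le> ennreal (D * r x)))"

text \<open>The Rubio de Francia algorithm in L^\<kappa>(s2). \<open>D\<close> and \<open>E\<close>
  are fixed before the weights, the coefficients and h, so they depend only on the exponents, the
  dimension and \<open>K\<close>.\<close>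

lemma weighted_majorant:
  fixes A1 A2 d K :: real
  assumes A: "0 < A1" "0 < A2" "0 < d" and K: "0 \<le> K"
  obtains D E :: real where "0 < D" "0 < E"
    "\<And>(s1 :: real^'n \<Rightarrow> real) s2 b h.
      step_data A1 A2 d K s1 s2 b \<Longrightarrow> h \<in> lmeas \<Longrightarrow>
      lint h \<noteq> 0 \<Longrightarrow> lint h \<noteq> top \<Longrightarrow>
      \<exists>r. majorizes A1 d D E s1 s2 b h r"
proof
  define \<kappa> where "\<kappa> = (A1 + d) / d"
  define \<rho> where "\<rho> = (A1 + A2) / A1"
  have \<kappa>: "1 < \<kappa>" using A by (simp add: \<kappa>_def)
  define C where "C = 2 ^ CARD('n) * (K powr (1 / d + 1 / A1) * (2 powr \<rho> * \<rho> / (\<rho> - 1)) * (2 powr \<kappa> * \<kappa> / (\<kappa> - 1)))"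
  \<comment> \<open>The constant is enlarged to \<open>\<bar>C\<bar> + 1\<close> because the
    algorithm wants a positive operator bound.\<close>
  define \<beta> where "\<beta> = (\<bar>C\<bar> + 1) powr (1 / \<kappa>)"
  have \<beta>: "0 < \<beta>" "\<beta> powr \<kappa> = \<bar>C\<bar> + 1" using \<kappa> by (simp_all add: \<beta>_def powr_powr)
  show "0 < 4 * \<beta>" "0 < 2 * 2 powr \<kappa>" using \<beta> by simp_all
  fix s1 s2 :: "real^'n \<Rightarrow> real" and b :: "(real^'n) set \<Rightarrow> ennreal" and h :: "real^'n \<Rightarrow> ennreal"
  assume data: "step_data A1 A2 d K s1 s2 b" and [measurable]: "h \<in> lmeas"
    and h: "lint h \<noteq> 0" "lint h \<noteq> top"
  have [measurable]: "s1 \<in> lmeas" "s2 \<in> lmeas"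
    and pos: "0 < s1 x" "0 < s2 x" for x using data by (auto simp: step_data_def)
  define \<tau> where "\<tau> x = ennreal (mix A1 d s1 s2 x)" for x
  have mix: "0 < mix A1 d s1 s2 x" for x using pos [of x] by (simp add: mix_def)
  have [measurable]: "mix A1 d s1 s2 \<in> lmeas" unfolding mix_def [abs_def] by measurable
  then have [measurable]: "\<tau> \<in> lmeas" unfolding \<tau>_def [abs_def] by measurable
  define M where "M = density lebesgue (\<lambda>x. ennreal (s2 x))"
  have sM [measurable_cong]: "sets M = sets lebesgue" by (simp add: M_def)
  have int_M: "(\<integral>\<^sup>+x. f x \<partial>M) = (\<integral>\<^sup>+x. f x * ennreal (s2 x) \<partial>lebesgue)"
    if "f \<in> lmeas" for f
    using that by (simp add: M_def nn_integral_density mult.commute)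
  define N where "N = avgop all_grid b \<tau>"
  have meas: "N f \<in> lmeas" for f
    unfolding N_def by (intro borel_measurable_avgop all_grid_props)
  \<comment> \<open>The starting function is such that \<psi>^\<kappa> s2 = h, so a majorant of
    \<psi> gives one of h.\<close>
  define \<psi> where "\<psi> x = ennpowr (h x * ennreal (1 / s2 x)) (1 / \<kappa>)" for x
  have [measurable]: "\<psi> \<in> lmeas" unfolding \<psi>_def [abs_def] by measurable
  have \<psi>h: "ennpowr (\<psi> x) \<kappa> * ennreal (s2 x) = h x" for x
    using \<kappa> pos [of x] by (simp add: \<psi>_def ennpowr_ennpowr mult.assoc flip: ennreal_mult)
  have bounded: "(\<integral>\<^sup>+x. ennpowr (N f x) \<kappa> \<partial>M) \<le> ennreal (\<beta> powr \<kappa>) * (\<integral>\<^sup>+x. ennpowr (f x) \<kappa> \<partial>M)"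
    if f: "f \<in> borel_measurable M" for f
  proof -
    have [measurable]: "f \<in> lmeas" using f by (simp add: M_def)
    note [measurable] = meas
    have "(\<integral>\<^sup>+x. ennpowr (N f x) \<kappa> \<partial>M) \<le> ennreal C * (\<integral>\<^sup>+x. ennpowr (f x) \<kappa> \<partial>M)"
    proof -
      have "(wpow s2 \<kappa> (N f))
          \<le> ennreal C * (wpow s2 \<kappa> f)"
        unfolding N_def C_def \<rho>_def \<kappa>_def \<tau>_def [abs_def]
        by (rule avgop_all_grid_bound [OF data _ A K]) measurable
      then show ?thesis by (subst (1 2) int_M) measurable
    qed
    also have "\<dots> \<le> ennreal (\<beta> powr \<kappa>) * (\<integral>\<^sup>+x. ennpowr (f x) \<kappa> \<partial>M)"
      unfolding \<beta> by (intro mult_right_mono ennreal_leI) auto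
    finally show ?thesis .
  qed
  obtain R where R: "R \<in> borel_measurable M" "\<And>x. \<psi> x \<le> R x" "\<And>x. N R x \<le> ennreal (4 * \<beta>) * R x"
    "\<And>x. N \<psi> x \<le> ennreal (4 * \<beta>) * R x"
    "(\<integral>\<^sup>+x. ennpowr (R x) \<kappa> \<partial>M) \<le> ennreal (2 * 2 powr \<kappa>) * (\<integral>\<^sup>+x. ennpowr (\<psi> x) \<kappa> \<partial>M)"
  proof (rule rubio_de_francia [of \<kappa> \<beta> M N \<psi>])
    show "N (\<lambda>y. \<Sum>k. c k * f k y) x \<le> (\<Sum>k. c k * N (f k) x)"
      if "\<And>k::nat. f k \<in> borel_measurable M" for f c x
      unfolding N_def by (rule avgop_sublinear) (use that in \<open>simp_all add: M_def\<close>)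
  qed (use \<kappa> \<beta> meas bounded in \<open>simp_all add: M_def\<close>)
  have [measurable]: "R \<in> lmeas" using R(1) by (simp add: M_def)
  have intR: "(wpow s2 \<kappa> R) \<le> ennreal (2 * 2 powr \<kappa>) * lint h"
    using R(5) by (simp add: int_M \<psi>h)
  have \<psi>0: "\<not> (AE x in lebesgue. \<psi> x = 0)"
  proof
    assume "AE x in lebesgue. \<psi> x = 0"
    then have "AE x in lebesgue. h x = 0" by eventually_elim (simp flip: \<psi>h)
    with h show False by (simp add: nn_integral_0_iff_AE)
  qed
  have R0: "R x \<noteq> 0" for x
  proof -
    have "N \<psi> x \<noteq> 0" unfolding N_def
      by (rule avgop_all_grid_nonzero [OF _ _ _ _ \<psi>0])
        (use data mix in \<open>simp_all add: step_data_def \<tau>_def ennreal_eq_0_iff not_le\<close>)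
    with R(4) [of x] show ?thesis by auto
  qed
  have Rtop: "AE x in lebesgue. R x \<noteq> top"
  proof -
    have "(wpow s2 \<kappa> R) \<noteq> \<infinity>"
      using intR h by (auto simp: top_unique ennreal_mult_eq_top_iff)
    then have "AE x in lebesgue. ennpowr (R x) \<kappa> * ennreal (s2 x) \<noteq> \<infinity>"
      by (intro nn_integral_PInf_AE) measurable
    then show ?thesis
    proof eventually_elim
      case (elim x)
      then show ?case using pos(2) [of x] by (auto simp: ennreal_top_mult ennreal_eq_0_iff not_le)
    qed
  qed
  \<comment> \<open>\<open>R\<close> is infinite only on a null set; the value 1 there keeps r real
    and positive.\<close>
  define r where "r x = (if R x = top then 1 else enn2real (R x))" for x
  have r_pos: "0 < r x" for x
    using R0 [of x] by (auto simp: r_def enn2real_positive_iff less_top zero_less_iff_neq_zero)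
  have rR: "ennreal (r x) = R x" if "R x \<noteq> top" for x
    using that by (simp add: r_def less_top)
  have [measurable]: "r \<in> lmeas" unfolding r_def [abs_def] by measurable
  have H: "AE x in lebesgue. ennreal (s2 x * r x powr \<kappa>) = ennpowr (R x) \<kappa> * ennreal (s2 x)"
    using Rtop
  proof eventually_elim
    case (elim x)
    then show ?case
      using pos [of x] r_pos [of x] by (simp flip: rR) (simp add: ennpowr_ennreal ennreal_mult mult.commute)
  qed
  have 1: "AE x in lebesgue. h x \<le> ennreal (s2 x * r x powr \<kappa>)"
    using H
  proof eventually_elim
    case (elim x)
    have "h x \<le> ennpowr (R x) \<kappa> * ennreal (s2 x)"
      unfolding \<psi>h [of x, symmetric] using \<kappa> R(2) [of x] by (intro mult_right_mono ennpowr_mono) auto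
    then show ?case using elim by simp
  qed
  have 2: "(\<integral>\<^sup>+x. ennreal (s2 x * r x powr \<kappa>) \<partial>lebesgue) \<le> ennreal (2 * 2 powr \<kappa>) * lint h"
    using intR nn_integral_cong_AE [OF H] by simp
  have 3: "let Y = \<integral>\<^sup>+y. ennreal (mix A1 d s1 s2 y * r y) \<partial>unif Q in
      Y \<noteq> 0 \<and> Y \<noteq> top \<and> (AE x in unif Q. b Q * Y \<le> ennreal (4 * \<beta> * r x))" if Q: "Q \<in> all_grid" for Q
  proof -
    note [measurable] = all_grid_props(3) [OF Q]
    note NF = AE_not_False_unif [OF all_grid_props(3-5) [OF Q]]
    define Y where "Y = (\<integral>\<^sup>+y. ennreal (mix A1 d s1 s2 y * r y) \<partial>unif Q)"
    have top: "AE x in unif Q. R x \<noteq> top"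
      using Rtop by (intro AE_uniform_measureI) auto
    have Y: "Y = (tavg \<tau> R Q)"
      unfolding Y_def
    proof (rule nn_integral_cong_AE)
      show "AE y in unif Q. ennreal (mix A1 d s1 s2 y * r y) = \<tau> y * R y"
        using top
      proof eventually_elim
        case (elim y)
        then show ?case using mix [of y] r_pos [of y] by (simp add: \<tau>_def ennreal_mult rR)
      qed
    qed
    have bY: "AE x in unif Q. b Q * Y \<le> ennreal (4 * \<beta> * r x)"
      using top unif_AE_in [OF all_grid_props(3) [OF Q]]
    proof eventually_elim
      case (elim x)
      have "b Q * Y \<le> N R x" unfolding Y N_def by (rule avgop_upper [OF Q elim(2)])
      also have "\<dots> \<le> ennreal (4 * \<beta>) * R x" by (rule R)
      also have "\<dots> = ennreal (4 * \<beta> * r x)"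
        using elim(1) \<beta> r_pos [of x] by (simp add: rR [symmetric] ennreal_mult del: rR)
      finally show ?case .
    qed
    have "Y \<noteq> top"
    proof
      assume "Y = top"
      moreover have "b Q \<noteq> 0" using data Q by (simp add: step_data_def)
      ultimately have "b Q * Y = top" by (simp add: ennreal_mult_top)
      with bY have "AE x in unif Q. False" by (simp add: top_unique)
      with NF show False ..
    qed
    moreover have "Y \<noteq> 0"
    proof
      assume "Y = 0"
      then have "AE x in unif Q. ennreal (mix A1 d s1 s2 x * r x) = 0"
        by (subst (asm) Y_def) (simp add: nn_integral_0_iff_AE)
      then have "AE x in unif Q. False"
      proof eventually_elim
        case (elim x)
        then show ?case using mult_pos_pos [OF mix [of x] r_pos [of x]] by (simp add: ennreal_eq_0_iff)
      qed
      with NF show False ..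
    qed
    ultimately show ?thesis using bY by (simp add: Let_def Y_def)
  qed
  show "\<exists>r. majorizes A1 d (4 * \<beta>) (2 * 2 powr \<kappa>) s1 s2 b h r"
    using 1 2 3 r_pos unfolding majorizes_def \<kappa>_def [symmetric] by (intro exI [of _ r] conjI) auto
qed

section \<open>Changing two exponents at a time\<close>

lemma prod_UNIV_two:
  fixes g :: "'k::finite \<Rightarrow> 'a::comm_monoid_mult"
  assumes "i \<noteq> j"
  shows "(\<Prod>k\<in>UNIV. g k) = g i * (g j * (\<Prod>k\<in>UNIV - {i, j}. g k))"
proof -
  have "UNIV - {i} - {j} = UNIV - {i, j}" by auto
  then show ?thesis
    using prod.remove [of UNIV i g] prod.remove [of "UNIV - {i}" j g] assms by auto
qed

lemma prod_ennreal_eq_0_iff: "finite I \<Longrightarrow> (\<Prod>i\<in>I. g i) = (0 :: ennreal) \<longleftrightarrow> (\<exists>i\<in>I. g i = 0)"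
  by (induction I rule: finite_induct) auto

lemma prod_ennreal_eq_topD:
  assumes "finite I" "(\<Prod>i\<in>I. g i) \<noteq> (top :: ennreal)" "\<And>i. i \<in> I \<Longrightarrow> g i \<noteq> 0" "i \<in> I"
  shows "g i \<noteq> top"
proof
  assume "g i = top"
  then have "(\<Prod>i\<in>I. g i) = top * (\<Prod>i\<in>I - {i}. g i)"
    using assms by (simp add: prod.remove)
  then show False
    using assms prod_ennreal_eq_0_iff [of "I - {i}" g] by (auto simp: ennreal_top_mult)
qed

lemma prod_ennreal_eq_top_imp:
  "finite I \<Longrightarrow> (\<Prod>i\<in>I. g i) = (top :: ennreal) \<Longrightarrow> \<exists>i\<in>I. g i = top"
  by (induction I rule: finite_induct) (auto simp: ennreal_mult_eq_top_iff)

section \<open>The symmetric weight classes\<close>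

abbreviation wprod :: "('k::finite \<Rightarrow> real) \<Rightarrow> ('k \<Rightarrow> real^'n \<Rightarrow> ennreal) \<Rightarrow> ('k \<Rightarrow> real^'n \<Rightarrow> real) \<Rightarrow> ennreal" where
  "wprod \<nu> f v \<equiv> \<Prod>k\<in>UNIV. wnorm (\<nu> k) (f k) (v k)"

definition dual_prod :: "('k::finite \<Rightarrow> real) \<Rightarrow> (real^'n) set \<Rightarrow> ('k \<Rightarrow> real^'n \<Rightarrow> real) \<Rightarrow> ennreal" where
  "dual_prod \<alpha> Q v = (\<Prod>i\<in>UNIV. Lnorm (unif Q) (\<alpha> i) (\<lambda>x. ennreal (1 / v i x)))"

text \<open>The class \<open>A\<^sub>p\<close> in symmetric form: the reciprocal of the product weight is treated as one more weight,
  so that all weights together have product 1, and \<open>\<alpha>\<^sub>i\<close> is the exponent that the \<open>i\<close>-th factor carries.\<close>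

definition mclass :: "('k::finite \<Rightarrow> real) \<Rightarrow> real \<Rightarrow> ('k \<Rightarrow> real^'n \<Rightarrow> real) set" where
  "mclass \<alpha> K = {v. (\<forall>i. v i \<in> lmeas) \<and> (\<forall>i x. 0 < v i x) \<and>
     (\<forall>x. (\<Prod>i\<in>UNIV. v i x) = 1) \<and> (\<forall>Q\<in>cubes. dual_prod \<alpha> Q v \<le> ennreal K)}"

lemma mclass_all_grid:
  assumes "v \<in> mclass \<alpha> K" "Q \<in> all_grid"
  shows "dual_prod \<alpha> Q v \<le> ennreal K"
proof -
  obtain u where "Q \<in> grid u" using assms(2) by (auto simp: all_grid_def)
  then obtain R where "R \<in> cubes" "unif Q = unif R" by (rule grid_cube)
  then show ?thesis using assms(1) by (simp add: mclass_def dual_prod_def)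
qed

text \<open>Maximal functions control averages over grid cells only, so new weights are tested
  there. Enclosing a cube in a cell costs 6^n to the power \<open>\<alpha> i\<close> in the i-th
  factor.\<close>

lemma mclassI_all_grid:
  fixes v :: "'k::finite \<Rightarrow> real^'n \<Rightarrow> real"
  assumes meas [measurable]: "\<And>i. v i \<in> lmeas"
    and "\<And>i x. 0 < v i x" "\<And>x. (\<Prod>i\<in>UNIV. v i x) = 1" and \<alpha>: "\<And>i. 0 \<le> \<alpha> i"
    and le: "\<And>Q. Q \<in> all_grid \<Longrightarrow> dual_prod \<alpha> Q v \<le> ennreal K"
  shows "v \<in> mclass \<alpha> ((\<Prod>i\<in>UNIV. (6 ^ CARD('n)) powr \<alpha> i) * K)"
proof -
  have "dual_prod \<alpha> R v \<le> ennreal ((\<Prod>i\<in>UNIV. (6 ^ CARD('n)) powr \<alpha> i) * K)"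
    if R: "R \<in> cubes" for R
  proof -
    obtain u Q where Q: "Q \<in> grid u" "R \<subseteq> Q"
      "emeasure lebesgue Q \<le> ennreal (6 ^ CARD('n)) * emeasure lebesgue R"
      by (rule cube_subset_grid [OF R])
    have "dual_prod \<alpha> R v \<le> (\<Prod>i\<in>UNIV. ennreal ((6 ^ CARD('n)) powr \<alpha> i) * Lnorm (unif Q) (\<alpha> i) (\<lambda>x. ennreal (1 / v i x)))"
      unfolding dual_prod_def
    proof (rule prod_mono_ennreal)
      fix i
      show "Lnorm (unif R) (\<alpha> i) (\<lambda>x. ennreal (1 / v i x))
          \<le> ennreal ((6 ^ CARD('n)) powr \<alpha> i) * Lnorm (unif Q) (\<alpha> i) (\<lambda>x. ennreal (1 / v i x))"
        by (rule Lnorm_uniform_mono [OF Q(2) cubes_emeasure [OF R] grid_sets [OF Q(1)] grid_emeasure [OF Q(1)] Q(3)])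
          (use \<alpha> in auto)
    qed
    also have "\<dots> = ennreal (\<Prod>i\<in>UNIV. (6 ^ CARD('n)) powr \<alpha> i) * dual_prod \<alpha> Q v"
      by (simp add: prod.distrib dual_prod_def prod_ennreal)
    also have "\<dots> \<le> ennreal (\<Prod>i\<in>UNIV. (6 ^ CARD('n)) powr \<alpha> i) * ennreal K"
      using Q by (intro mult_left_mono le) (auto simp: all_grid_def)
    finally show ?thesis by (simp add: ennreal_mult' prod_nonneg)
  qed
  then show ?thesis using assms by (auto simp: mclass_def)
qed

lemma Lnorm_unif_nonzero:
  assumes Q: "Q \<in> sets lebesgue" "emeasure lebesgue Q \<noteq> 0" "emeasure lebesgue Q \<noteq> top"
    and [measurable]: "f \<in> lmeas" and "\<And>x. f x \<noteq> 0"
  shows "Lnorm (unif Q) \<nu> f \<noteq> 0"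
  using AE_not_False_unif [OF Q] assms(5) by (subst Lnorm_eq_0_iff) auto

lemma emeasure_unif_space:
  assumes "emeasure lebesgue Q \<noteq> 0" "emeasure lebesgue Q \<noteq> top"
  shows "emeasure (unif Q) (space (unif Q)) = 1"
  using assms emeasure_notin_sets [of Q lebesgue]
  by (cases "Q \<in> sets lebesgue") (simp_all add: less_top ennreal_divide_self del: emeasure_completion)

lemma one_mem_mclass:
  fixes \<alpha> :: "'k::finite \<Rightarrow> real"
  assumes \<alpha>: "\<And>i. 0 \<le> \<alpha> i" and "1 \<le> K"
  shows "(\<lambda>i x. 1) \<in> (mclass \<alpha> K :: ('k \<Rightarrow> real^'n \<Rightarrow> real) set)"
proof -
  have "dual_prod \<alpha> Q (\<lambda>i x. 1) = 1" if "Q \<in> cubes" for Q :: "(real^'n) set"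
    using emeasure_unif_space [OF cubes_emeasure(2,3) [OF that]] by (simp add: dual_prod_def Lnorm_const \<alpha>)
  then show ?thesis using ennreal_leI [OF assms(2)] by (simp add: mclass_def)
qed

text \<open>\<alpha> and \<beta> describe the weight classes, \<nu> and \<mu> the norms, before and
  after. The order of the quantifiers matters: \<open>W\<close> may depend on f, whereas
  \<open>C\<close> and \<open>K'\<close> depend on \<open>K\<close> only. The type argument fixes
  the dimension.\<close>

definition transfer :: "'n::finite itself \<Rightarrow> ('k::finite \<Rightarrow> real) \<Rightarrow> ('k \<Rightarrow> real) \<Rightarrow> ('k \<Rightarrow> real) \<Rightarrow> ('k \<Rightarrow> real) \<Rightarrow> bool" where
  "transfer T \<alpha> \<nu> \<beta> \<mu> \<longleftrightarrow> (\<forall>K. \<exists>C K'. C \<noteq> top \<and>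
    (\<forall>v \<in> (mclass \<alpha> K :: ('k \<Rightarrow> real^'n \<Rightarrow> real) set). \<forall>f. (\<forall>i. f i \<in> lmeas) \<longrightarrow>
      (\<exists>W \<in> mclass \<beta> K'. wprod \<mu> f W
         \<le> C * wprod \<nu> f v)))"

lemma transfer_refl: "transfer T \<alpha> \<nu> \<alpha> \<nu>"
  unfolding transfer_def by (intro allI exI [of _ 1] exI conjI ballI impI bexI) auto

lemma transfer_trans:
  fixes T :: "'n::finite itself" and \<alpha> :: "'k::finite \<Rightarrow> real"
  assumes "transfer T \<alpha> \<nu> \<alpha>' \<nu>'" "transfer T \<alpha>' \<nu>' \<alpha>'' \<nu>''"
  shows "transfer T \<alpha> \<nu> \<alpha>'' \<nu>''"
  unfolding transfer_def
proof
  fix K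
  from assms(1) obtain C1 K1 where C1: "C1 \<noteq> top" and 1:
    "\<And>v f. v \<in> mclass \<alpha> K \<Longrightarrow> (\<And>i. f i \<in> lmeas) \<Longrightarrow>
      (\<exists>W \<in> mclass \<alpha>' K1. wprod \<nu>' f W
         \<le> C1 * wprod \<nu> (f :: 'k \<Rightarrow> real^'n \<Rightarrow> ennreal) v)"
    unfolding transfer_def by meson
  from assms(2) obtain C2 K2 where C2: "C2 \<noteq> top" and 2:
    "\<And>v f. v \<in> mclass \<alpha>' K1 \<Longrightarrow> (\<And>i. f i \<in> lmeas) \<Longrightarrow>
      (\<exists>W \<in> mclass \<alpha>'' K2. wprod \<nu>'' f W
         \<le> C2 * wprod \<nu>' (f :: 'k \<Rightarrow> real^'n \<Rightarrow> ennreal) v)"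
    unfolding transfer_def by meson
  show "\<exists>C K'. C \<noteq> top \<and> (\<forall>v \<in> (mclass \<alpha> K :: ('k \<Rightarrow> real^'n \<Rightarrow> real) set). \<forall>f. (\<forall>i. f i \<in> lmeas) \<longrightarrow>
      (\<exists>W \<in> mclass \<alpha>'' K'. wprod \<nu>'' f W
         \<le> C * wprod \<nu> f v))"
  proof (intro exI conjI ballI allI impI)
    show "C2 * C1 \<noteq> top" using C1 C2 by (simp add: ennreal_mult_eq_top_iff)
    fix v and f :: "'k \<Rightarrow> real^'n \<Rightarrow> ennreal"
    assume v: "v \<in> (mclass \<alpha> K :: ('k \<Rightarrow> real^'n \<Rightarrow> real) set)" and f: "\<forall>i. f i \<in> lmeas"
    from 1 [OF v, of f] f obtain W1 where W1: "W1 \<in> mclass \<alpha>' K1"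
      "wprod \<nu>' f W1
         \<le> C1 * wprod \<nu> f v" by auto
    from 2 [OF W1(1), of f] f obtain W2 where W2: "W2 \<in> mclass \<alpha>'' K2"
      "wprod \<nu>'' f W2
         \<le> C2 * wprod \<nu>' f W1" by auto
    note W2(2)
    also have "C2 * wprod \<nu>' f W1
      \<le> C2 * (C1 * wprod \<nu> f v)"
      by (intro mult_left_mono W1) auto
    finally show "\<exists>W \<in> mclass \<alpha>'' K2. wprod \<nu>'' f W
         \<le> C2 * C1 * wprod \<nu> f v"
      using W2(1) by (auto simp: mult.assoc)
  qed
qed

text \<open>If one norm vanishes, that function is zero almost everywhere and, as 0 * \<infinity> =
  0, the product on the left is zero too; an infinite product on the right leaves nothing to prove.
  So the constant weights 1 serve here, and otherwise all norms are positive and finite.\<close>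

lemma transfer_degenerate:
  fixes f :: "'k::finite \<Rightarrow> real^'n \<Rightarrow> ennreal"
  assumes [measurable]: "\<And>i. f i \<in> lmeas" "\<And>i. v i \<in> lmeas"
    and v: "\<And>i x. 0 < v i x"
    and "wprod \<nu> f v \<in> {0, top}" and C: "C \<noteq> 0"
  shows "(\<Prod>i\<in>UNIV. Lnorm lebesgue (\<mu> i) (\<lambda>x. f i x * ennreal 1))
         \<le> C * wprod \<nu> f v"
proof (cases "wprod \<nu> f v = 0")
  case True
  then obtain i where "wnorm (\<nu> i) (f i) (v i) = 0"
    by (auto simp: prod_ennreal_eq_0_iff)
  then have "AE x in lebesgue. f i x * ennreal (v i x) = 0"
    by (subst (asm) Lnorm_eq_0_iff) auto
  then have "AE x in lebesgue. f i x = 0"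
  proof eventually_elim
    case (elim x)
    then show ?case using v [of i x] by (auto simp: ennreal_eq_0_iff)
  qed
  then have "Lnorm lebesgue (\<mu> i) (\<lambda>x. f i x * ennreal 1) = 0"
    by (subst Lnorm_eq_0_iff) auto
  then have "(\<Prod>i\<in>UNIV. Lnorm lebesgue (\<mu> i) (\<lambda>x. f i x * ennreal 1)) = 0"
    by (subst prod_ennreal_eq_0_iff) auto
  then show ?thesis by (simp only: zero_le)
next
  case False
  with assms(4) have "wprod \<nu> f v = top" by blast
  then show ?thesis using C by (simp only: ennreal_mult_top if_False top_greatest)
qed

lemma Lnorm_pos: "0 < \<nu> \<Longrightarrow> Lnorm M \<nu> f = ennpowr (\<integral>\<^sup>+x. ennpowr (f x) (1 / \<nu>) \<partial>M) \<nu>"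
  by (simp add: Lnorm_def)

text \<open>For k = i, j the power in \<open>s\<close> makes the k-th factor of the class equal to
  the average of \<open>s k\<close> to the power \<open>\<alpha> k\<close>. \<open>B\<close> holds
  the untouched factors and the part of the average of \<open>s j\<close> that remains after moving
  d, so the bound on \<open>b\<close> is the class condition itself. The comparison with the
  geometric mean results from multiplying the i-th and j-th factors by a Hoelder lower bound in
  which both weights are replaced by that mean.\<close>

lemma mclass_step_data:
  fixes v :: "'k::finite \<Rightarrow> real^'n \<Rightarrow> real"
  assumes v: "v \<in> mclass \<alpha> K" and ij: "i \<noteq> j" and A: "0 < \<alpha> i" "0 < \<alpha> j" "0 < d" "d \<le> \<alpha> j"
    and \<alpha>: "\<And>k. 0 \<le> \<alpha> k"
  defines "s \<equiv> \<lambda>k x. (1 / v k x) powr (1 / \<alpha> k)"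
    and "P \<equiv> \<lambda>Q. \<Prod>k\<in>UNIV - {i, j}. Lnorm (unif Q) (\<alpha> k) (\<lambda>x. ennreal (1 / v k x))"
  defines "B \<equiv> \<lambda>Q. P Q * ennpowr (wavg Q (s j)) (\<alpha> j - d)"
  shows "step_data (\<alpha> i) (\<alpha> j) d (max 0 K) (s i) (s j) (\<lambda>Q. ennpowr (B Q) (1 / (\<alpha> i + d)))"
    "\<And>Q. Q \<in> all_grid \<Longrightarrow> B Q \<noteq> 0 \<and> B Q \<noteq> top"
proof -
  have [measurable]: "v k \<in> lmeas" and pos: "0 < v k x"
    and one: "(\<Prod>k\<in>UNIV. v k x) = 1" for k x using v by (auto simp: mclass_def)
  have [measurable]: "s k \<in> lmeas" for k unfolding s_def by measurable
  have spos: "0 < s k x" for k x using pos [of k x] by (simp add: s_def)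
  have main: "(wavg Q (s i)) \<notin> {0, top} \<and> (wavg Q (s j)) \<notin> {0, top}
      \<and> P Q \<notin> {0, top}
      \<and> ennpowr (wavg Q (s i)) (\<alpha> i) * ennpowr (wavg Q (s j)) (\<alpha> j) * P Q \<le> ennreal (max 0 K)
      \<and> ennpowr (wavg Q (s i)) (\<alpha> i) * ennpowr (wavg Q (s j)) (\<alpha> j)
        \<le> ennreal (max 0 K) * ennpowr (\<integral>\<^sup>+y. ennreal ((s i y powr \<alpha> i * s j y powr \<alpha> j) powr (1 / (\<alpha> i + \<alpha> j))) \<partial>unif Q) (\<alpha> i + \<alpha> j)"
    if Q: "Q \<in> all_grid" for Q
  proof -
    note [measurable] = all_grid_props(3) [OF Q]
    define L where "L k = Lnorm (unif Q) (\<alpha> k) (\<lambda>x. ennreal (1 / v k x))" for k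
    have L0: "L k \<noteq> 0" for k
      unfolding L_def using pos by (intro Lnorm_unif_nonzero all_grid_props(3-5) [OF Q]) (auto simp: ennreal_eq_0_iff not_le)
    have le: "(\<Prod>k\<in>UNIV. L k) \<le> ennreal (max 0 K)"
      using mclass_all_grid [OF v Q] order_trans [OF _ ennreal_leI [of K "max 0 K"]] by (simp add: dual_prod_def L_def)
    then have "(\<Prod>k\<in>UNIV. L k) \<noteq> top" by (auto simp: top_unique)
    then have Lt: "L k \<noteq> top" for k using L0 by (intro prod_ennreal_eq_topD [of UNIV L]) auto
    have LP: "(\<Prod>k\<in>UNIV. L k) = L i * L j * P Q"
      unfolding prod_UNIV_two [OF ij] by (simp add: P_def L_def mult.assoc)
    have Ls: "L k = ennpowr (wavg Q (s k)) (\<alpha> k)" if "0 < \<alpha> k" for k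
      using that pos by (simp add: L_def Lnorm_pos ennpowr_ennreal less_imp_le s_def)
    have P: "P Q \<noteq> 0" "P Q \<noteq> top"
    proof -
      show "P Q \<noteq> 0" using L0 by (simp add: P_def L_def [symmetric] prod_ennreal_eq_0_iff)
      show "P Q \<noteq> top"
        using Lt prod_ennreal_eq_top_imp [of "UNIV - {i, j}" L] by (auto simp: P_def L_def [symmetric])
    qed
    define \<omega> where "\<omega> y = (s i y powr \<alpha> i * s j y powr \<alpha> j) powr (1 / (\<alpha> i + \<alpha> j))" for y
    have [measurable]: "\<omega> \<in> lmeas" unfolding \<omega>_def [abs_def] by measurable
    have \<omega>pos: "0 < \<omega> y" for y using spos [of i y] spos [of j y] by (simp add: \<omega>_def)
    \<comment> \<open>Powers of the geometric mean in places i and j keep the pointwise product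
      equal to 1, so Hoelder's inequality bounds the product of averages from below.\<close>
    define g where "g k y = ennreal (if k = i then \<omega> y powr \<alpha> i else if k = j then \<omega> y powr \<alpha> j else 1 / v k y)" for k y
    have [measurable]: "g k \<in> lmeas" for k
      unfolding g_def [abs_def] by (cases "k = i"; cases "k = j") simp_all
    have gprod: "(\<Prod>k\<in>UNIV. g k y) = 1" for y
    proof -
      have \<omega>2: "\<omega> y powr \<alpha> i * \<omega> y powr \<alpha> j = (1 / v i y) * (1 / v j y)"
        unfolding powr_add [symmetric] using A pos [of i y] pos [of j y] spos [of i y] spos [of j y]
        by (simp add: \<omega>_def powr_powr) (simp add: s_def powr_powr)
      have "(\<Prod>k\<in>UNIV. g k y) = g i y * (g j y * (\<Prod>k\<in>UNIV - {i, j}. g k y))"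
        by (rule prod_UNIV_two [OF ij])
      also have "(\<Prod>k\<in>UNIV - {i, j}. g k y) = (\<Prod>k\<in>UNIV - {i, j}. ennreal (1 / v k y))"
        by (intro prod.cong) (auto simp: g_def)
      also have "g i y * (g j y * (\<Prod>k\<in>UNIV - {i, j}. ennreal (1 / v k y)))
          = ennreal (\<omega> y powr \<alpha> i * \<omega> y powr \<alpha> j) * (\<Prod>k\<in>UNIV - {i, j}. ennreal (1 / v k y))"
      proof -
        have "g i y = ennreal (\<omega> y powr \<alpha> i)" "g j y = ennreal (\<omega> y powr \<alpha> j)"
          using ij by (simp_all add: g_def)
        then show ?thesis by (simp only: ennreal_mult'' [OF powr_ge_zero] mult.assoc)
      qed
      also have "\<dots> = ennreal (1 / v i y) * (ennreal (1 / v j y) * (\<Prod>k\<in>UNIV - {i, j}. ennreal (1 / v k y)))"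
      proof -
        have "0 \<le> 1 / v j y" using pos [of j y] by simp
        then show ?thesis by (simp only: \<omega>2 ennreal_mult'' mult.assoc)
      qed
      also have "\<dots> = (\<Prod>k\<in>UNIV. ennreal (1 / v k y))"
        by (rule prod_UNIV_two [OF ij, symmetric])
      also have "\<dots> = ennreal (\<Prod>k\<in>UNIV. 1 / v k y)"
        using pos by (intro prod_ennreal) (simp add: less_imp_le)
      also have "\<dots> = 1" using one by (simp add: prod_dividef)
      finally show ?thesis .
    qed
    have "1 \<le> (\<Prod>k\<in>UNIV. Lnorm (unif Q) (\<alpha> k) (g k))"
    proof (rule one_le_prod_Lnorm)
      show "emeasure (unif Q) (space (unif Q)) = 1"
        by (rule emeasure_unif_space [OF all_grid_props(4,5) [OF Q]])
    qed (use \<alpha> gprod in auto)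
    also have "\<dots> = Lnorm (unif Q) (\<alpha> i) (g i) * (Lnorm (unif Q) (\<alpha> j) (g j) * (\<Prod>k\<in>UNIV - {i, j}. Lnorm (unif Q) (\<alpha> k) (g k)))"
      by (rule prod_UNIV_two [OF ij])
    also have "(\<Prod>k\<in>UNIV - {i, j}. Lnorm (unif Q) (\<alpha> k) (g k)) = P Q"
      unfolding P_def by (intro prod.cong) (auto simp: g_def [abs_def])
    also have "Lnorm (unif Q) (\<alpha> i) (g i) = ennpowr (wavg Q \<omega>) (\<alpha> i)"
      using A \<omega>pos by (simp add: Lnorm_pos g_def ennpowr_ennreal powr_powr less_imp_le)
    also have "Lnorm (unif Q) (\<alpha> j) (g j) = ennpowr (wavg Q \<omega>) (\<alpha> j)"
      using A ij \<omega>pos by (simp add: Lnorm_pos g_def ennpowr_ennreal powr_powr less_imp_le)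
    finally have \<omega>1: "1 \<le> ennpowr (wavg Q \<omega>) (\<alpha> i + \<alpha> j) * P Q"
      by (simp add: ennpowr_add mult.assoc)
    have "L i * L j = L i * L j * 1" by simp
    also have "\<dots> \<le> L i * L j * (ennpowr (wavg Q \<omega>) (\<alpha> i + \<alpha> j) * P Q)"
      by (intro mult_left_mono \<omega>1) auto
    also have "\<dots> = L i * L j * P Q * ennpowr (wavg Q \<omega>) (\<alpha> i + \<alpha> j)"
      by (simp only: mult_ac)
    also have "\<dots> \<le> ennreal (max 0 K) * ennpowr (wavg Q \<omega>) (\<alpha> i + \<alpha> j)"
      using le unfolding LP by (intro mult_right_mono) auto
    finally show ?thesis
      using L0 [of i] L0 [of j] Lt [of i] Lt [of j] P le unfolding LP
      by (simp add: Ls A \<omega>_def)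
  qed
  show B: "B Q \<noteq> 0 \<and> B Q \<noteq> top" if "Q \<in> all_grid" for Q
    using main [OF that] by (auto simp: B_def ennreal_mult_eq_top_iff)
  have "ennpowr (ennpowr (B Q) (1 / (\<alpha> i + d))) (\<alpha> i + d) * ennpowr (wavg Q (s i)) (\<alpha> i)
        * ennpowr (wavg Q (s j)) d \<le> ennreal (max 0 K)" if "Q \<in> all_grid" for Q
  proof -
    have "ennpowr (ennpowr (B Q) (1 / (\<alpha> i + d))) (\<alpha> i + d) = B Q"
      using add_pos_pos [OF A(1,3)] by (simp add: ennpowr_ennpowr)
    moreover have "B Q * ennpowr (wavg Q (s i)) (\<alpha> i) * ennpowr (wavg Q (s j)) d
        = ennpowr (wavg Q (s i)) (\<alpha> i) * ennpowr (wavg Q (s j)) (\<alpha> j) * P Q"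
      using ennpowr_add [of "\<integral>\<^sup>+y. ennreal (s j y) \<partial>unif Q" "\<alpha> j - d" d] by (simp add: B_def mult_ac)
    ultimately show ?thesis using main [OF that] by simp
  qed
  then show "step_data (\<alpha> i) (\<alpha> j) d (max 0 K) (s i) (s j) (\<lambda>Q. ennpowr (B Q) (1 / (\<alpha> i + d)))"
    using main B spos unfolding step_data_def by auto
qed

text \<open>Let H = s_j r^\<kappa> majorise h = (|f_i| v_i)^(1/\<nu>_i). Dividing v_i by H^d leaves
  the i-th norm at most (\<integral>h)^(\<nu>_i - d); multiplying v_j by H^d costs (\<integral>H)^d
  by Hoelder, and the powers of \<integral>h recombine to the old i-th norm. In the class the i-th
  factor becomes X^a, with X the average in the A_1 condition, and this condition supplies X^-a in
  the j-th factor.\<close>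

lemma transfer_step:
  fixes \<alpha> \<nu> :: "'k::finite \<Rightarrow> real"
  assumes ij: "i \<noteq> j" and A: "0 < \<alpha> i" "0 < \<alpha> j" "0 < d" "d \<le> \<alpha> j" and d: "d \<le> \<nu> i"
    and \<alpha>: "\<And>k. 0 \<le> \<alpha> k" and \<nu>: "\<And>k. 0 \<le> \<nu> k"
  shows "transfer TYPE('n::finite) \<alpha> \<nu> (\<alpha>(i := \<alpha> i + d, j := \<alpha> j - d)) (\<nu>(i := \<nu> i - d, j := \<nu> j + d))"
  unfolding transfer_def
proof
  fix K
  let ?\<beta> = "\<alpha>(i := \<alpha> i + d, j := \<alpha> j - d)" and ?\<mu> = "\<nu>(i := \<nu> i - d, j := \<nu> j + d)"
  have \<beta>: "0 \<le> ?\<beta> k" for k using A \<alpha> by auto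
  define a where "a = \<alpha> i + d"
  have a: "0 < a" using A by (simp add: a_def)
  define \<kappa> where "\<kappa> = a / d"
  have \<kappa>: "\<kappa> * d = a" "\<kappa> * d / a = 1" using A a by (simp_all add: \<kappa>_def)
  obtain D E :: real where D: "0 < D" and E: "0 < E" and majorant:
    "\<And>(s1 :: real^'n \<Rightarrow> real) s2 b h.
      step_data (\<alpha> i) (\<alpha> j) d (max 0 K) s1 s2 b \<Longrightarrow> h \<in> lmeas \<Longrightarrow>
      lint h \<noteq> 0 \<Longrightarrow> lint h \<noteq> top \<Longrightarrow>
      \<exists>r. majorizes (\<alpha> i) d D E s1 s2 b h r"
    using weighted_majorant [OF A(1-3), of "max 0 K"] by auto
  \<comment> \<open>The maximum with 1 admits the constant weights of the degenerate case.\<close>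
  define K' where "K' = max 1 ((\<Prod>k\<in>UNIV. (6 ^ CARD('n)) powr ?\<beta> k) * D powr a)"
  have K'_mono: "w \<in> mclass ?\<beta> K'" if "w \<in> mclass ?\<beta> ((\<Prod>k\<in>UNIV. (6 ^ CARD('n)) powr ?\<beta> k) * D powr a)"
    for w :: "'k \<Rightarrow> real^'n \<Rightarrow> real"
  proof -
    have "dual_prod ?\<beta> Q w \<le> ennreal K'" if "Q \<in> cubes" for Q
      using \<open>w \<in> _\<close> that order_trans [OF _ ennreal_leI [OF max.cobounded2]] unfolding mclass_def K'_def by blast
    then show ?thesis using that unfolding mclass_def by blast
  qed
  show "\<exists>C K'. C \<noteq> top \<and> (\<forall>v \<in> (mclass \<alpha> K :: ('k \<Rightarrow> real^'n \<Rightarrow> real) set). \<forall>f. (\<forall>k. f k \<in> lmeas) \<longrightarrow>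
      (\<exists>W \<in> mclass ?\<beta> K'. wprod ?\<mu> f W
         \<le> C * wprod \<nu> f v))"
  proof (intro exI conjI ballI allI impI)
    show "ennreal (E powr d) \<noteq> top" by simp
    fix v and f :: "'k \<Rightarrow> real^'n \<Rightarrow> ennreal"
    assume v: "v \<in> (mclass \<alpha> K :: ('k \<Rightarrow> real^'n \<Rightarrow> real) set)" and "\<forall>k. f k \<in> lmeas"
    then have [measurable]: "f k \<in> lmeas" for k by blast
    have [measurable]: "v k \<in> lmeas" and pos: "0 < v k x"
      and one: "(\<Prod>k\<in>UNIV. v k x) = 1" for k x using v by (auto simp: mclass_def)
    define L where "L k = wnorm (\<nu> k) (f k) (v k)" for k
    show "\<exists>W \<in> mclass ?\<beta> K'. wprod ?\<mu> f W
         \<le> ennreal (E powr d) * wprod \<nu> f v"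
    proof (cases "wprod \<nu> f v \<in> {0, top}")
      case True
      show ?thesis
      proof (rule bexI)
        show "(\<lambda>k x. 1) \<in> mclass ?\<beta> K'" by (intro one_mem_mclass \<beta>) (simp add: K'_def)
        show "(\<Prod>k\<in>UNIV. Lnorm lebesgue (?\<mu> k) (\<lambda>x. f k x * ennreal 1))
          \<le> ennreal (E powr d) * wprod \<nu> f v"
          by (rule transfer_degenerate [OF _ _ pos True]) (use E in auto)
      qed
    next
      case False
      then have Lprod: "(\<Prod>k\<in>UNIV. L k) \<noteq> 0" "(\<Prod>k\<in>UNIV. L k) \<noteq> top" by (auto simp: L_def)
      then have L0: "L k \<noteq> 0" for k by (auto simp: prod_ennreal_eq_0_iff)
      have Lt: "L k \<noteq> top" for k using Lprod L0 by (intro prod_ennreal_eq_topD [of UNIV L]) auto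
      have \<nu>i: "0 < \<nu> i" using A d by simp
      define h where "h x = ennpowr (f i x * ennreal (v i x)) (1 / \<nu> i)" for x
      have [measurable]: "h \<in> lmeas" unfolding h_def [abs_def] by measurable
      have Lh: "L i = ennpowr (lint h) (\<nu> i)"
        using \<nu>i by (simp add: L_def h_def Lnorm_pos)
      then have h: "lint h \<noteq> 0" "lint h \<noteq> top"
        using L0 [of i] Lt [of i] by auto
      define s where "s k x = (1 / v k x) powr (1 / \<alpha> k)" for k x
      have [measurable]: "s k \<in> lmeas" for k unfolding s_def by measurable
      have spos: "0 < s k x" for k x using pos [of k x] by (simp add: s_def)
      define P where "P Q = (\<Prod>k\<in>UNIV - {i, j}. Lnorm (unif Q) (\<alpha> k) (\<lambda>x. ennreal (1 / v k x)))" for Q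
      define B where "B Q = P Q * ennpowr (wavg Q (s j)) (\<alpha> j - d)" for Q
      have data: "step_data (\<alpha> i) (\<alpha> j) d (max 0 K) (s i) (s j) (\<lambda>Q. ennpowr (B Q) (1 / a))"
        using mclass_step_data(1) [OF v ij A \<alpha>, folded s_def P_def, folded B_def]
        by (simp add: s_def [abs_def] a_def B_def)
      have BQ: "B Q \<noteq> 0" "B Q \<noteq> top" if "Q \<in> all_grid" for Q
        using mclass_step_data(2) [OF v ij A \<alpha>, folded s_def P_def, folded B_def] that
        by (simp_all add: s_def [abs_def] B_def)
      obtain r where [measurable]: "r \<in> lmeas" and rpos: "\<And>x. 0 < r x"
        and hH: "AE x in lebesgue. h x \<le> ennreal (s j x * r x powr \<kappa>)"
        and intH: "(\<integral>\<^sup>+x. ennreal (s j x * r x powr \<kappa>) \<partial>lebesgue) \<le> ennreal E * lint h"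
        and Y: "\<And>Q. Q \<in> all_grid \<Longrightarrow> let Y = \<integral>\<^sup>+y. ennreal (mix (\<alpha> i) d (s i) (s j) y * r y) \<partial>unif Q in
          Y \<noteq> 0 \<and> Y \<noteq> top \<and> (AE x in unif Q. ennpowr (B Q) (1 / a) * Y \<le> ennreal (D * r x))"
        using majorant [OF data _ h] unfolding majorizes_def \<kappa>_def a_def by auto
      define H where "H x = s j x * r x powr \<kappa>" for x
      have [measurable]: "H \<in> lmeas" unfolding H_def [abs_def] by measurable
      have Hpos: "0 < H x" for x using spos [of j x] rpos [of x] by (simp add: H_def)
      define W where "W = v(i := (\<lambda>x. v i x * H x powr (- d)), j := (\<lambda>x. v j x * H x powr d))"
      have W: "W i = (\<lambda>x. v i x * H x powr (- d))" "W j = (\<lambda>x. v j x * H x powr d)"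
        "\<And>k. k \<noteq> i \<Longrightarrow> k \<noteq> j \<Longrightarrow> W k = v k" using ij by (auto simp: W_def)
      have [measurable]: "W k \<in> lmeas" for k
        by (cases "k = i"; cases "k = j") (simp_all add: W)
      have Wpos: "0 < W k x" for k x
        using pos [of k x] Hpos [of x] by (cases "k = i"; cases "k = j") (auto simp: W)
      have Wone: "(\<Prod>k\<in>UNIV. W k x) = 1" for x
      proof -
        have "(\<Prod>k\<in>UNIV - {i, j}. W k x) = (\<Prod>k\<in>UNIV - {i, j}. v k x)"
          by (intro prod.cong) (auto simp: W)
        moreover have "W i x * W j x = v i x * v j x"
          using Hpos [of x] by (simp add: W powr_minus)
        ultimately show ?thesis
          using one [of x] unfolding prod_UNIV_two [OF ij] by (simp flip: mult.assoc)
      qed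
      have "dual_prod ?\<beta> Q W \<le> ennreal (D powr a)" if Q: "Q \<in> all_grid" for Q
      proof -
        note [measurable] = all_grid_props(3) [OF Q]
        define X where "X = (\<integral>\<^sup>+y. ennreal (mix (\<alpha> i) d (s i) (s j) y * r y) \<partial>unif Q)"
        have X: "X \<noteq> 0" "X \<noteq> top" "AE x in unif Q. ennpowr (B Q) (1 / a) * X \<le> ennreal (D * r x)"
          using Y [OF Q] by (simp_all add: X_def Let_def)
        \<comment> \<open>The A_1 condition reads B X^a \<le> (D r)^a, that is, r^-a \<le>
          m.\<close>
        define m where "m = ennreal (D powr a) * inverse (B Q * ennpowr X a)"
        \<comment> \<open>Since \<kappa> d = a, H^d = s_j^d r^a, and so the power 1/a of 1 / W_i is
          precisely the integrand of X.\<close>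
        have 1: "Lnorm (unif Q) (?\<beta> i) (\<lambda>x. ennreal (1 / W i x)) = ennpowr X a"
        proof -
          have "(1 / W i x) powr (1 / a) = mix (\<alpha> i) d (s i) (s j) x * r x" for x
          proof -
            have "1 / W i x = (s i x powr \<alpha> i * s j x powr d) * r x powr a"
              using A pos [of i x] rpos [of x] spos [of j x]
              by (simp add: W H_def s_def [of i] powr_powr powr_mult powr_minus \<kappa> field_simps)
            then show ?thesis
              using a rpos [of x] by (simp add: mix_def powr_mult powr_powr a_def [symmetric])
          qed
          moreover have "0 \<le> 1 / W i x" for x using Wpos [of i x] by simp
          ultimately have "ennpowr (ennreal (1 / W i x)) (1 / a) = ennreal (mix (\<alpha> i) d (s i) (s j) x * r x)" for x
            by (simp only: ennpowr_ennreal)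
          moreover have "?\<beta> i = a" using ij by (simp add: a_def)
          ultimately show ?thesis using a by (simp add: Lnorm_pos X_def)
        qed
        have 2: "Lnorm (unif Q) (?\<beta> j) (\<lambda>x. ennreal (1 / W j x))
          \<le> m * ennpowr (wavg Q (s j)) (\<alpha> j - d)"
        proof -
          have "AE x in unif Q. ennreal (1 / W j x) \<le> m * ennreal (s j x powr (\<alpha> j - d))"
            using X(3)
          proof eventually_elim
            case (elim x)
            have "ennpowr (ennpowr (B Q) (1 / a) * X) a \<le> ennpowr (ennreal (D * r x)) a"
              using elim a by (intro ennpowr_mono) auto
            then have *: "B Q * ennpowr X a \<le> ennreal (D powr a * r x powr a)"
              using a D rpos [of x] by (simp add: ennpowr_mult ennpowr_ennpowr ennpowr_ennreal powr_mult)
            obtain z where z: "B Q * ennpowr X a = ennreal z" "0 < z"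
            proof -
              have "B Q * ennpowr X a \<noteq> 0" "B Q * ennpowr X a \<noteq> top"
                using BQ [OF Q] X by (auto simp: ennreal_mult_eq_top_iff)
              then show thesis using that
                by (cases "B Q * ennpowr X a" rule: ennreal_cases) (auto simp: less_eq_real_def)
            qed
            have zle: "z \<le> D powr a * r x powr a"
              using * D rpos [of x] unfolding z by (simp add: ennreal_le_iff)
            have "1 / W j x = s j x powr (\<alpha> j - d) / r x powr a"
              using A pos [of j x] rpos [of x]
              by (simp add: W H_def s_def powr_powr powr_mult powr_diff \<kappa> field_simps)
            also have "\<dots> \<le> D powr a * (1 / z) * s j x powr (\<alpha> j - d)"
            proof -
              have "1 / r x powr a \<le> D powr a * (1 / z)"
                using zle z(2) rpos [of x] by (simp add: field_simps)
              from mult_right_mono [OF this, of "s j x powr (\<alpha> j - d)"] show ?thesis by simp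
            qed
            finally have "ennreal (1 / W j x) \<le> ennreal (D powr a * (1 / z) * s j x powr (\<alpha> j - d))"
              by (rule ennreal_leI)
            also have "\<dots> = m * ennreal (s j x powr (\<alpha> j - d))"
            proof -
              have "inverse (ennreal z) = ennreal (1 / z)" "0 \<le> 1 / z"
                using z(2) by (simp_all add: inverse_ennreal inverse_eq_divide)
              then show ?thesis by (simp only: m_def z(1) ennreal_mult'' powr_ge_zero)
            qed
            finally show ?case .
          qed
          then have "Lnorm (unif Q) (\<alpha> j - d) (\<lambda>x. ennreal (1 / W j x))
              \<le> Lnorm (unif Q) (\<alpha> j - d) (\<lambda>x. m * ennreal (s j x powr (\<alpha> j - d)))"
            using A by (intro Lnorm_mono_AE) auto
          also have "\<dots> \<le> m * Lnorm (unif Q) (\<alpha> j - d) (\<lambda>x. ennreal (s j x powr (\<alpha> j - d)))"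
            using A by (intro Lnorm_cmult_le) auto
          also have "Lnorm (unif Q) (\<alpha> j - d) (\<lambda>x. ennreal (s j x powr (\<alpha> j - d)))
              = ennpowr (wavg Q (s j)) (\<alpha> j - d)"
          \<comment> \<open>When the exponent drops to 0 the j-th factor is an essential supremum of
            the constant 1, and the power 0 of a positive finite average is 1 as well.\<close>
          proof (cases "\<alpha> j = d")
            case True
            have "(wavg Q (s j)) \<notin> {0, top}"
              using data Q by (simp add: step_data_def)
            then obtain z where z: "(wavg Q (s j)) = ennreal z" "0 < z"
              by (cases "\<integral>\<^sup>+y. ennreal (s j y) \<partial>unif Q" rule: ennreal_cases) (auto simp: less_eq_real_def)
            have s1: "s j x powr (\<alpha> j - d) = 1" for x using True spos [of j x] by simp
            show ?thesis
              unfolding s1 z(1) using True z(2)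
                Lnorm_const [OF emeasure_unif_space [OF all_grid_props(4,5) [OF Q]], of 0 1]
              by (simp add: ennpowr_ennreal)
          next
            case False
            have "ennpowr (ennreal (s j x powr (\<alpha> j - d))) (1 / (\<alpha> j - d)) = ennreal (s j x)" for x
              using False spos [of j x] by (simp add: ennpowr_ennreal powr_powr)
            then show ?thesis using False A by (simp add: Lnorm_pos)
          qed
          finally show ?thesis using ij by simp
        qed
        have 3: "(\<Prod>k\<in>UNIV - {i, j}. Lnorm (unif Q) (?\<beta> k) (\<lambda>x. ennreal (1 / W k x))) = P Q"
          unfolding P_def by (intro prod.cong) (auto simp: W)
        \<comment> \<open>\<open>P Q\<close> and the remaining power of the average of
          \<open>s j\<close> multiply to \<open>B Q\<close>, which cancels against its inverse in
          \<open>m\<close>.\<close>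
        have "dual_prod ?\<beta> Q W \<le> ennpowr X a * (m * ennpowr (wavg Q (s j)) (\<alpha> j - d) * P Q)"
          unfolding dual_prod_def prod_UNIV_two [OF ij] 1 3 by (intro mult_left_mono mult_right_mono 2) auto
        also have "\<dots> = ennreal (D powr a) * ((B Q * ennpowr X a) * inverse (B Q * ennpowr X a))"
          by (simp only: B_def m_def mult_ac)
        also have "\<dots> = ennreal (D powr a)"
        proof -
          have "B Q * ennpowr X a \<noteq> 0" "B Q * ennpowr X a \<noteq> top"
            using BQ [OF Q] X by (auto simp: ennreal_mult_eq_top_iff)
          then have "(B Q * ennpowr X a) * inverse (B Q * ennpowr X a) = 1"
            using ennreal_divide_self [of "B Q * ennpowr X a"] by (simp add: divide_ennreal_def less_top)
          then show ?thesis by simp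
        qed
        finally show ?thesis .
      qed
      then have WC: "W \<in> mclass ?\<beta> K'"
        by (intro K'_mono mclassI_all_grid Wpos Wone \<beta>) auto
      have N1: "wnorm (?\<mu> i) (f i) (W i) \<le> ennpowr (lint h) (\<nu> i - d)"
      proof -
        have le: "AE x in lebesgue. f i x * ennreal (W i x) \<le> ennpowr (h x) (\<nu> i - d) \<or> \<nu> i = d \<and> f i x * ennreal (W i x) \<le> 1"
          using hH
        proof eventually_elim
          case (elim x)
          have "h x \<noteq> top" using elim by (auto simp: top_unique)
          then have "f i x * ennreal (v i x) \<noteq> top" using \<nu>i by (simp add: h_def)
          then obtain y where y: "f i x * ennreal (v i x) = ennreal y" "0 \<le> y"
            by (metis ennreal_cases)
          have hy: "h x = ennreal (y powr (1 / \<nu> i))" using y by (simp add: h_def ennpowr_ennreal)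
          have yH: "y powr (1 / \<nu> i) \<le> H x"
            using elim Hpos [of x] unfolding hy H_def [symmetric] by (simp add: ennreal_le_iff)
          have fW: "f i x * ennreal (W i x) = ennreal (y * H x powr (- d))"
            using pos [of i x] y by (simp add: W ennreal_mult mult.assoc [symmetric])
          show ?case
          proof (cases "y = 0")
            case True
            then show ?thesis by (simp add: fW)
          next
            case False
            then have y0: "0 < y" using y by simp
            have "y * H x powr (- d) \<le> y * (y powr (1 / \<nu> i)) powr (- d)"
              using yH y0 A by (intro mult_left_mono powr_mono2') auto
            also have "\<dots> = (y powr (1 / \<nu> i)) powr (\<nu> i - d)"
              using y0 \<nu>i by (simp add: powr_powr powr_diff diff_divide_distrib powr_minus field_simps)
            finally have "ennreal (y * H x powr (- d)) \<le> ennpowr (h x) (\<nu> i - d)"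
              unfolding hy by (simp add: ennpowr_ennreal ennreal_leI)
            then show ?thesis by (simp add: fW)
          qed
        qed
        show ?thesis
        proof (cases "\<nu> i = d")
          case True
          obtain z where z: "(lint h) = ennreal z" "0 < z"
            using h by (cases "\<integral>\<^sup>+x. h x \<partial>lebesgue" rule: ennreal_cases) (auto simp: less_eq_real_def)
          \<comment> \<open>Here the new i-th norm is the one of L^\<infinity>. The power 0 is 0 at
            0 and 1 at positive reals, but infinite at infinity; the finite majorant excludes that
            value almost everywhere.\<close>
          have "ennpowr t 0 \<le> 1 \<or> t = top" for t
            by (cases t rule: ennreal_cases) (auto simp: ennpowr_ennreal)
          moreover have "AE x in lebesgue. h x \<noteq> top"
            using hH by eventually_elim (auto simp: top_unique)
          ultimately have "AE x in lebesgue. f i x * ennreal (W i x) \<le> 1"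
            using le by (auto simp: True elim!: eventually_elim2 intro: order_trans)
          then show ?thesis
            using True ij z by (simp add: Lnorm_def ennpowr_ennreal esssup_I)
        next
          case False
          then have \<nu>d: "0 < \<nu> i - d" using d by simp
          have "wnorm (\<nu> i - d) (f i) (W i) \<le> Lnorm lebesgue (\<nu> i - d) (\<lambda>x. ennpowr (h x) (\<nu> i - d))"
            using le False \<nu>d by (intro Lnorm_mono_AE) auto
          then show ?thesis
            using \<nu>d ij by (simp add: Lnorm_pos ennpowr_ennpowr)
        qed
      qed
      have N2: "wnorm (?\<mu> j) (f j) (W j)
          \<le> ennreal (E powr d) * ennpowr (lint h) d * L j"
      proof -
        have "Lnorm lebesgue (d + \<nu> j) (\<lambda>x. ennreal (H x powr d) * (f j x * ennreal (v j x)))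
            \<le> Lnorm lebesgue d (\<lambda>x. ennreal (H x powr d)) * L j"
          unfolding L_def using A \<nu> by (intro Lnorm_Holder) auto
        also have "Lnorm lebesgue d (\<lambda>x. ennreal (H x powr d)) = ennpowr (\<integral>\<^sup>+x. ennreal (H x) \<partial>lebesgue) d"
          using A Hpos by (simp add: Lnorm_pos ennpowr_ennreal powr_powr less_imp_le)
        also have "ennpowr (\<integral>\<^sup>+x. ennreal (H x) \<partial>lebesgue) d \<le> ennpowr (ennreal E * lint h) d"
          using intH A by (intro ennpowr_mono) (auto simp: H_def)
        also have "\<dots> = ennreal (E powr d) * ennpowr (lint h) d"
          using E by (simp add: ennpowr_mult ennpowr_ennreal)
        finally have "Lnorm lebesgue (d + \<nu> j) (\<lambda>x. ennreal (H x powr d) * (f j x * ennreal (v j x)))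
            \<le> ennreal (E powr d) * ennpowr (lint h) d * L j"
          by (simp add: mult_right_mono)
        moreover have "ennreal (H x powr d) * (f j x * ennreal (v j x)) = f j x * ennreal (W j x)" for x
          using pos [of j x] by (simp add: W ennreal_mult mult_ac)
        ultimately show ?thesis using ij by (simp add: add.commute)
      qed
      have N3: "(\<Prod>k\<in>UNIV - {i, j}. wnorm (?\<mu> k) (f k) (W k)) = (\<Prod>k\<in>UNIV - {i, j}. L k)"
        unfolding L_def by (intro prod.cong) (auto simp: W)
      have "wprod ?\<mu> f W
        \<le> ennpowr (lint h) (\<nu> i - d) * (ennreal (E powr d) * ennpowr (lint h) d * L j
            * (\<Prod>k\<in>UNIV - {i, j}. L k))"
        unfolding prod_UNIV_two [OF ij, of "\<lambda>k. wnorm (?\<mu> k) (f k) (W k)"] N3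
        by (intro mult_mono N1 N2) auto
      also have "\<dots> = ennreal (E powr d) * (ennpowr (lint h) (\<nu> i - d) * ennpowr (lint h) d
          * (L j * (\<Prod>k\<in>UNIV - {i, j}. L k)))"
        by (simp only: mult_ac)
      also have "ennpowr (lint h) (\<nu> i - d) * ennpowr (lint h) d = L i"
        by (simp add: Lh ennpowr_add [symmetric])
      also have "L i * (L j * (\<Prod>k\<in>UNIV - {i, j}. L k)) = (\<Prod>k\<in>UNIV. L k)"
        by (rule prod_UNIV_two [OF ij, symmetric])
      finally show ?thesis using WC unfolding L_def by (rule bexI)
    qed
  qed
qed

section \<open>Multilinear weight classes and extrapolation\<close>

text \<open>Moving the largest d that overshoots neither target makes at least one more coordinate
  final, so the number of disagreements drops. As \<open>\<alpha> k + \<nu> k\<close> is preserved,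
  d is at most \<open>\<nu> i - \<mu> i\<close>, so no norm exponent becomes negative. A lowered
  coordinate stays at or above its target, hence is positive as long as it still has to
  move.\<close>

lemma transfer_all:
  fixes \<alpha> \<beta> \<nu> \<mu> :: "'k::finite \<Rightarrow> real"
  assumes "\<And>k. \<alpha> k + \<nu> k = \<beta> k + \<mu> k" "(\<Sum>k\<in>UNIV. \<alpha> k) = (\<Sum>k\<in>UNIV. \<beta> k)"
    and "\<And>k. 0 < \<alpha> k \<or> \<alpha> k = \<beta> k" "\<And>k. 0 \<le> \<nu> k" "\<And>k. 0 \<le> \<beta> k" "\<And>k. 0 \<le> \<mu> k"
  shows "transfer TYPE('n::finite) \<alpha> \<nu> \<beta> \<mu>"
  using assms(1-4)
proof (induction "card {k. \<alpha> k \<noteq> \<beta> k}" arbitrary: \<alpha> \<nu> rule: less_induct)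
  case less
  note \<rho> = less.prems(1) and sum = less.prems(2) and pos = less.prems(3) and \<nu> = less.prems(4)
  have \<alpha>: "0 \<le> \<alpha> k" for k using pos [of k] assms(5) [of k] by auto
  show ?case
  proof (cases "\<alpha> = \<beta>")
    case True
    then have "\<nu> = \<mu>" using \<rho> by auto
    then show ?thesis using True transfer_refl by simp
  next
    case False
    have "\<exists>i. \<alpha> i < \<beta> i"
    proof (rule ccontr)
      assume "\<nexists>i. \<alpha> i < \<beta> i"
      then have "\<beta> k \<le> \<alpha> k" for k by (simp add: not_less)
      moreover from this obtain k where "\<beta> k < \<alpha> k" using False by (metis ext order_le_less)
      ultimately have "sum \<beta> UNIV < sum \<alpha> UNIV" by (intro sum_strict_mono_ex1) auto
      then show False using sum by simp
    qed
    moreover have "\<exists>j. \<beta> j < \<alpha> j"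
    proof (rule ccontr)
      assume "\<nexists>j. \<beta> j < \<alpha> j"
      then have "\<alpha> k \<le> \<beta> k" for k by (simp add: not_less)
      moreover from this obtain k where "\<alpha> k < \<beta> k" using False by (metis ext order_le_less)
      ultimately have "sum \<alpha> UNIV < sum \<beta> UNIV" by (intro sum_strict_mono_ex1) auto
      then show False using sum by simp
    qed
    ultimately obtain i j where i: "\<alpha> i < \<beta> i" and j: "\<beta> j < \<alpha> j" by blast
    then have ij: "i \<noteq> j" by auto
    define d where "d = min (\<beta> i - \<alpha> i) (\<alpha> j - \<beta> j)"
    have d: "0 < d" "d \<le> \<beta> i - \<alpha> i" "d \<le> \<alpha> j - \<beta> j" "d = \<beta> i - \<alpha> i \<or> d = \<alpha> j - \<beta> j"
      using i j by (auto simp: d_def min_def)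
    let ?\<alpha> = "\<alpha>(i := \<alpha> i + d, j := \<alpha> j - d)" and ?\<nu> = "\<nu>(i := \<nu> i - d, j := \<nu> j + d)"
    have step: "transfer TYPE('n) \<alpha> \<nu> ?\<alpha> ?\<nu>"
    proof (rule transfer_step [OF ij])
      show "0 < \<alpha> i" "0 < \<alpha> j" using pos [of i] pos [of j] i j by auto
      show "d \<le> \<alpha> j" using d(3) assms(5) [of j] by linarith
      show "d \<le> \<nu> i" using d(2) \<rho> [of i] assms(6) [of i] by linarith
    qed (use d \<alpha> \<nu> in auto)
    have "transfer TYPE('n) ?\<alpha> ?\<nu> \<beta> \<mu>"
    proof (rule less.hyps)
      have "{k. ?\<alpha> k \<noteq> \<beta> k} \<subset> {k. \<alpha> k \<noteq> \<beta> k}"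
        using i j ij d(4) by (auto split: if_splits)
      then show "card {k. ?\<alpha> k \<noteq> \<beta> k} < card {k. \<alpha> k \<noteq> \<beta> k}" by (intro psubset_card_mono) auto
      show "?\<alpha> k + ?\<nu> k = \<beta> k + \<mu> k" for k using \<rho> [of k] by auto
      have "sum ?\<alpha> UNIV = sum \<alpha> UNIV"
      proof -
        have "sum a UNIV = a i + (a j + sum a (UNIV - {i} - {j}))" for a :: "'k \<Rightarrow> real"
          using ij by (simp add: sum.remove [of UNIV i] sum.remove [of "UNIV - {i}" j])
        moreover have "sum ?\<alpha> (UNIV - {i} - {j}) = sum \<alpha> (UNIV - {i} - {j})"
          by (intro sum.cong) auto
        ultimately show ?thesis using ij by simp
      qed
      then show "sum ?\<alpha> UNIV = sum \<beta> UNIV" using sum by simp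
      show "0 < ?\<alpha> k \<or> ?\<alpha> k = \<beta> k" for k
        using pos [of k] pos [of i] d i assms(5) [of j] by auto
      show "0 \<le> ?\<nu> k" for k
        using \<nu> [of k] d(1,2) \<rho> [of i] assms(6) [of i] by auto
    qed
    then show ?thesis by (rule transfer_trans [OF step])
  qed
qed

section \<open>Translating \<open>Ap_class\<close> into the symmetric classes\<close>

abbreviation rec :: "ennreal \<Rightarrow> real" where
  "rec p \<equiv> enn2real (inverse p)"

lemma Lp_ennnorm_eq_Lnorm:
  assumes "p \<noteq> 0"
  shows "Lp_ennnorm p g = Lnorm lebesgue (rec p) g"
proof (cases p rule: ennreal_cases)
  case (real r)
  then have "0 < r" using assms by (auto simp: less_eq_real_def)
  then show ?thesis
    using real by (simp add: Lp_ennnorm_def Lnorm_def inverse_ennreal inverse_eq_divide)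
next
  case top
  then show ?thesis by (simp add: Lp_ennnorm_def Lnorm_def)
qed

lemma rec_le_one: "1 \<le> p \<Longrightarrow> rec p \<le> 1" "1 < p \<Longrightarrow> rec p < 1"
  "1 \<le> p \<Longrightarrow> inverse p = ennreal (rec p)"
proof -
  have real: "1 \<le> r" "inverse p = ennreal (inverse r)" "rec p = inverse r" if "1 \<le> p" "p = ennreal r" "0 \<le> r" for r
  proof -
    show "1 \<le> r" using that by simp
    then show "inverse p = ennreal (inverse r)" "rec p = inverse r"
      using that by (simp_all add: inverse_ennreal)
  qed
  show "inverse p = ennreal (rec p)" if "1 \<le> p"
    using that real by (cases p rule: ennreal_cases) auto
  show "rec p \<le> 1" if "1 \<le> p"
    using that real by (cases p rule: ennreal_cases) (auto simp: inverse_le_1_iff)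
  show "rec p < 1" if "1 < p"
  proof (cases p rule: ennreal_cases)
    case (real r)
    moreover have "r \<noteq> 1" using that real by auto
    ultimately have "1 < r" using that by (auto simp: less_eq_real_def)
    then show ?thesis using real by (simp add: inverse_ennreal inverse_less_1_iff)
  qed simp
qed

lemma rec_harmonic_exponent:
  assumes "\<And>i. 1 \<le> p i"
  shows "rec (harmonic_exponent p) = (\<Sum>i\<in>UNIV. rec (p i))" "harmonic_exponent p \<noteq> 0"
proof -
  have eq: "(\<Sum>i\<in>UNIV. inverse (p i)) = ennreal (\<Sum>i\<in>UNIV. rec (p i))"
  proof -
    have "(\<Sum>i\<in>UNIV. inverse (p i)) = (\<Sum>i\<in>UNIV. ennreal (rec (p i)))"
      by (intro sum.cong refl rec_le_one(3) assms)
    also have "\<dots> = ennreal (\<Sum>i\<in>UNIV. rec (p i))" by (rule sum_ennreal) simp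
    finally show ?thesis .
  qed
  then show "rec (harmonic_exponent p) = (\<Sum>i\<in>UNIV. rec (p i))"
  proof -
    have inv: "enn2real (inverse (inverse (ennreal x))) = x" if "0 \<le> x" for x
      using that by (cases "x = 0") (auto simp: inverse_ennreal)
    show ?thesis unfolding harmonic_exponent_def eq by (intro inv sum_nonneg) simp
  qed
  show "harmonic_exponent p \<noteq> 0" unfolding harmonic_exponent_def eq by simp
qed

text \<open>For a set of positive finite measure, restricted and uniform measure have the same null
  sets, hence the same essential suprema.\<close>

lemma esssup_on_eq:
  assumes Q: "Q \<in> sets lebesgue" "emeasure lebesgue Q \<noteq> 0" "emeasure lebesgue Q \<noteq> top"
    and h [measurable]: "h \<in> lmeas" "k \<in> lmeas"
    and eq: "AE x in lebesgue. h x = k x"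
  shows "esssup_on Q h = esssup (unif Q) k"
proof -
  have ae: "(AE x in restrict_space lebesgue Q. P x) \<longleftrightarrow> (AE x in unif Q. P x)" for P
    using Q by (subst AE_restrict_space_iff, simp, subst AE_uniform_measure) (simp_all add: less_top del: emeasure_completion)
  have hm: "h \<in> borel_measurable (restrict_space lebesgue Q)" by (rule measurable_restrict_space1) measurable
  have eqQ: "AE x in unif Q. h x = k x"
    using eq Q by (intro AE_uniform_measureI) auto
  show ?thesis unfolding esssup_on_def
  proof (rule antisym)
    have "AE x in unif Q. k x \<le> esssup (unif Q) k" by (rule esssup_AE)
    with eqQ have "AE x in unif Q. h x \<le> esssup (unif Q) k" by eventually_elim simp
    then show "esssup (restrict_space lebesgue Q) h \<le> esssup (unif Q) k"
      using hm by (intro esssup_I) (simp_all only: ae)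
    have "AE x in unif Q. h x \<le> esssup (restrict_space lebesgue Q) h"
      unfolding ae [symmetric] by (rule esssup_AE)
    with eqQ have "AE x in unif Q. k x \<le> esssup (restrict_space lebesgue Q) h" by eventually_elim simp
    then show "esssup (unif Q) k \<le> esssup (restrict_space lebesgue Q) h"
      by (intro esssup_I) auto
  qed
qed

lemma average_eq:
  assumes Q: "Q \<in> sets lebesgue"
    and [measurable]: "h \<in> lmeas" "k \<in> lmeas"
    and eq: "AE x in lebesgue. h x = k x"
  shows "average Q h = (\<integral>\<^sup>+x. k x \<partial>unif Q)"
proof -
  have "(\<integral>\<^sup>+x\<in>Q. h x \<partial>lebesgue) = (\<integral>\<^sup>+x\<in>Q. k x \<partial>lebesgue)"
    by (rule nn_integral_cong_AE) (use eq in \<open>auto elim: eventually_mono\<close>)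
  then show ?thesis
    using Q by (simp add: average_def nn_integral_uniform_measure)
qed

text \<open>Because 1/r' = 1 - 1/r, the separate case r = 1 of the definition is the case \<nu> = 0
  of \<open>Lnorm\<close>, and r = \<infinity> corresponds to \<nu> = 1.\<close>

lemma dual_factor_eq_Lnorm:
  assumes r: "1 \<le> r" and Q: "Q \<in> cubes"
    and [measurable]: "u \<in> lmeas" "y \<in> lmeas"
    and y: "\<And>x. 0 < y x" and uy: "AE x in lebesgue. u x = y x"
  shows "dual_factor r Q u = Lnorm (unif Q) (1 - rec r) (\<lambda>x. ennreal (1 / y x))"
proof (cases "r = 1")
  case True
  have "esssup_on Q (\<lambda>x. ennreal (inverse (u x))) = esssup (unif Q) (\<lambda>x. ennreal (1 / y x))"
    by (rule esssup_on_eq [OF cubes_emeasure [OF Q]])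
      (use uy in \<open>auto simp: inverse_eq_divide elim: eventually_mono\<close>)
  then show ?thesis using True by (simp add: dual_factor_def Lnorm_def)
next
  case False
  then have r1: "rec r < 1" using r by (intro rec_le_one) auto
  define t where "t = 1 - rec r"
  have t: "0 < t" using r1 by (simp add: t_def)
  have "1 - inverse r = ennreal t"
    by (subst rec_le_one(3) [OF r], subst ennreal_1 [symmetric], subst ennreal_minus) (simp_all only: t_def enn2real_nonneg)
  then have conj: "enn2real (conjugate_exponent r) = 1 / t"
    using t by (simp add: conjugate_exponent_def inverse_ennreal inverse_eq_divide)
  have "average Q (\<lambda>x. ennreal (u x powr (- (1 / t)))) = (\<integral>\<^sup>+x. ennreal (y x powr (- (1 / t))) \<partial>unif Q)"
    by (rule average_eq [OF cubes_emeasure(1) [OF Q]]) (use uy in \<open>auto elim: eventually_mono\<close>)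
  also have "\<dots> = (\<integral>\<^sup>+x. ennpowr (ennreal (1 / y x)) (1 / t) \<partial>unif Q)"
    using y by (simp add: ennpowr_ennreal less_imp_le powr_minus powr_divide inverse_eq_divide)
  finally show ?thesis
    using False t by (simp add: dual_factor_def conj Let_def Lnorm_def t_def [symmetric])
qed

lemma product_factor_eq_Lnorm:
  assumes P: "P \<noteq> 0" and Q: "Q \<in> cubes"
    and [measurable]: "W \<in> lmeas" "y \<in> lmeas"
    and y: "\<And>x. 0 < y x" and uy: "AE x in lebesgue. W x = 1 / y x"
  shows "product_factor P Q W = Lnorm (unif Q) (rec P) (\<lambda>x. ennreal (1 / y x))"
proof (cases "P = top")
  case True
  have "esssup_on Q (\<lambda>x. ennreal (W x)) = esssup (unif Q) (\<lambda>x. ennreal (1 / y x))"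
    by (rule esssup_on_eq [OF cubes_emeasure [OF Q]]) (use uy in \<open>auto elim: eventually_mono\<close>)
  then show ?thesis using True by (simp add: product_factor_def Lnorm_def)
next
  case False
  then obtain t where t: "P = ennreal t" "0 < t"
    using P by (cases P rule: ennreal_cases) (auto simp: less_eq_real_def)
  have "average Q (\<lambda>x. ennreal (W x powr t)) = (\<integral>\<^sup>+x. ennreal ((1 / y x) powr t) \<partial>unif Q)"
    by (rule average_eq [OF cubes_emeasure(1) [OF Q]]) (use uy in \<open>auto elim: eventually_mono\<close>)
  also have "\<dots> = (\<integral>\<^sup>+x. ennpowr (ennreal (1 / y x)) t \<partial>unif Q)"
    using y by (simp add: ennpowr_ennreal less_imp_le)
  finally show ?thesis
    using t by (simp add: product_factor_def Lnorm_def inverse_ennreal inverse_eq_divide)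
qed

text \<open>The index \<open>None\<close> carries the reciprocal of the product weight.\<close>

definition exponents :: "('m::finite \<Rightarrow> ennreal) \<Rightarrow> 'm option \<Rightarrow> real" where
  "exponents p k = (case k of None \<Rightarrow> \<Sum>i\<in>UNIV. rec (p i) | Some i \<Rightarrow> 1 - rec (p i))"

lemma exponents_simps [simp]:
  "exponents p None = (\<Sum>i\<in>UNIV. rec (p i))" "exponents p (Some i) = 1 - rec (p i)"
  by (simp_all add: exponents_def)

lemma prod_UNIV_option: "(\<Prod>k\<in>UNIV. g k) = g None * (\<Prod>i\<in>(UNIV :: 'm::finite set). g (Some i))"
proof -
  have "(\<Prod>k\<in>UNIV. g k) = g None * (\<Prod>k\<in>Some ` (UNIV :: 'm set). g k)"
    unfolding UNIV_option_conv by (rule prod.insert) auto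
  then show ?thesis by (simp add: prod.reindex)
qed

lemma sum_UNIV_option: "(\<Sum>k\<in>UNIV. g k) = g None + (\<Sum>i\<in>(UNIV :: 'm::finite set). g (Some i))"
proof -
  have "(\<Sum>k\<in>UNIV. g k) = g None + (\<Sum>k\<in>Some ` (UNIV :: 'm set). g k)"
    unfolding UNIV_option_conv by (rule sum.insert) auto
  then show ?thesis by (simp add: sum.reindex)
qed

lemma prod_weight_eq_AE:
  fixes w :: "'m::finite \<Rightarrow> real^'n \<Rightarrow> real" and V :: "'m option \<Rightarrow> real^'n \<Rightarrow> real"
  assumes V: "\<And>k x. 0 < V k x" "\<And>x. (\<Prod>k\<in>UNIV. V k x) = 1"
    and wV: "\<And>i. AE x in lebesgue. w i x = V (Some i) x"
  shows "AE x in lebesgue. prod_weight w x = 1 / V None x"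
proof -
  have "AE x in lebesgue. \<forall>i\<in>UNIV. w i x = V (Some i) x"
    by (rule AE_finite_allI) (use wV in auto)
  then show ?thesis
  proof eventually_elim
    case (elim x)
    have "V None x * (\<Prod>i\<in>UNIV. V (Some i) x) = 1" using V(2) [of x] by (simp add: prod_UNIV_option)
    then show ?case using elim V(1) [of None x] by (simp add: prod_weight_def field_simps)
  qed
qed

lemma Ap_factors_eq_dual_prod:
  fixes w :: "'m::finite \<Rightarrow> real^'n \<Rightarrow> real" and V :: "'m option \<Rightarrow> real^'n \<Rightarrow> real"
  assumes p: "\<And>i. 1 \<le> p i" and Q: "Q \<in> cubes"
    and [measurable]: "\<And>i. w i \<in> lmeas" "\<And>k. V k \<in> lmeas"
    and V: "\<And>k x. 0 < V k x" "\<And>x. (\<Prod>k\<in>UNIV. V k x) = 1"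
    and wV: "\<And>i. AE x in lebesgue. w i x = V (Some i) x"
  shows "product_factor (harmonic_exponent p) Q (prod_weight w) * (\<Prod>i\<in>UNIV. dual_factor (p i) Q (w i))
      = dual_prod (exponents p) Q V"
proof -
  note prod = prod_weight_eq_AE [OF V wV]
  have [measurable]: "prod_weight w \<in> lmeas"
    unfolding prod_weight_def [abs_def] by measurable
  have "product_factor (harmonic_exponent p) Q (prod_weight w) = Lnorm (unif Q) (exponents p None) (\<lambda>x. ennreal (1 / V None x))"
    using product_factor_eq_Lnorm [OF rec_harmonic_exponent(2) [OF p] Q _ _ V(1) prod]
    by (simp add: rec_harmonic_exponent(1) [OF p])
  moreover have "dual_factor (p i) Q (w i) = Lnorm (unif Q) (exponents p (Some i)) (\<lambda>x. ennreal (1 / V (Some i) x))" for i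
    using dual_factor_eq_Lnorm [OF p Q _ _ V(1) wV] by simp
  ultimately show "product_factor (harmonic_exponent p) Q (prod_weight w) * (\<Prod>i\<in>UNIV. dual_factor (p i) Q (w i))
      = dual_prod (exponents p) Q V"
    by (simp only: dual_prod_def prod_UNIV_option)
qed

lemma Ap_class_to_mclass:
  fixes w :: "'m::finite \<Rightarrow> real^'n \<Rightarrow> real"
  assumes p: "\<And>i. 1 \<le> p i" and w: "w \<in> Ap_class p" and K: "Ap_constant p w \<le> ennreal K"
  obtains V where "V \<in> mclass (exponents p) K" "\<And>i. AE x in lebesgue. w i x = V (Some i) x"
    "AE x in lebesgue. prod_weight w x = 1 / V None x"
proof -
  \<comment> \<open>Weights in \<open>Ap_class\<close> are positive almost everywhere, those in
    \<open>mclass\<close> at every point; the value 1 is put on the exceptional null set.\<close>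
  define u where "u i x = (if 0 < w i x then w i x else 1)" for i x
  define V where "V k x = (case k of None \<Rightarrow> 1 / (\<Prod>i\<in>UNIV. u i x) | Some i \<Rightarrow> u i x)" for k x
  have wm [measurable]: "w i \<in> lmeas" and pos: "AE x in lebesgue. 0 < w i x" for i
    using w by (auto simp: Ap_class_def)
  have [measurable]: "u i \<in> lmeas" for i unfolding u_def [abs_def] by measurable
  have upos: "0 < u i x" for i x by (simp add: u_def)
  have V: "V k \<in> lmeas" "0 < V k x" for k x
    using upos by (cases k; simp add: V_def [abs_def] prod_pos)+
  have one: "(\<Prod>k\<in>UNIV. V k x) = 1" for x
    using upos [THEN less_imp_neq, of _ x] by (auto simp: prod_UNIV_option V_def)
  have wV: "AE x in lebesgue. w i x = V (Some i) x" for i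
    using pos [of i] by eventually_elim (simp add: V_def u_def)
  note eq = Ap_factors_eq_dual_prod [OF p _ wm V(1) V(2) one wV]
  have "dual_prod (exponents p) Q V \<le> ennreal K" if Q: "Q \<in> cubes" for Q
  proof -
    have "product_factor (harmonic_exponent p) Q (prod_weight w) * (\<Prod>i\<in>UNIV. dual_factor (p i) Q (w i))
        \<le> Ap_constant p w"
      unfolding Ap_constant_def by (rule SUP_upper [OF Q])
    then have "dual_prod (exponents p) Q V \<le> Ap_constant p w"
      by (simp only: eq [OF Q])
    then show ?thesis using K by (rule order_trans)
  qed
  then have "V \<in> mclass (exponents p) K" using V one by (simp add: mclass_def)
  moreover have "AE x in lebesgue. prod_weight w x = 1 / V None x"
    by (rule prod_weight_eq_AE [OF V(2) one wV])
  ultimately show ?thesis using that wV by blast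
qed

lemma mclass_to_Ap_class:
  fixes V :: "'m::finite option \<Rightarrow> real^'n \<Rightarrow> real"
  assumes p: "\<And>i. 1 \<le> p i" and V: "V \<in> mclass (exponents p) K"
  shows "(\<lambda>i. V (Some i)) \<in> Ap_class p" "Ap_constant p (\<lambda>i. V (Some i)) \<le> ennreal K"
    "prod_weight (\<lambda>i. V (Some i)) x = 1 / V None x"
proof -
  have meas: "V k \<in> lmeas" and pos: "0 < V k x" and one: "(\<Prod>k\<in>UNIV. V k x) = 1"
    and le: "Q \<in> cubes \<Longrightarrow> dual_prod (exponents p) Q V \<le> ennreal K" for k x Q
    using V by (auto simp: mclass_def)
  show K: "Ap_constant p (\<lambda>i. V (Some i)) \<le> ennreal K"
    unfolding Ap_constant_def
  proof (rule SUP_least)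
    fix Q :: "(real^'n) set" assume Q: "Q \<in> cubes"
    show "product_factor (harmonic_exponent p) Q (prod_weight (\<lambda>i. V (Some i))) * (\<Prod>i\<in>UNIV. dual_factor (p i) Q (V (Some i))) \<le> ennreal K"
      using le [OF Q] by (subst Ap_factors_eq_dual_prod [OF p Q meas meas pos one]) auto
  qed
  then show "(\<lambda>i. V (Some i)) \<in> Ap_class p"
    using meas pos by (auto simp: Ap_class_def less_top [symmetric] top_unique)
  show "prod_weight (\<lambda>i. V (Some i)) x = 1 / V None x"
    using one [of x] pos [of None x] by (simp add: prod_weight_def prod_UNIV_option field_simps)
qed

lemma rec_sum_pos:
  assumes "\<And>i. 1 < q i" "0 < (\<Sum>i\<in>UNIV. inverse (q i))"
  shows "0 < (\<Sum>i\<in>(UNIV :: 'm::finite set). rec (q i))"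
proof -
  obtain i where "inverse (q i) \<noteq> 0"
    using assms(2) by (metis less_irrefl sum.neutral)
  moreover have "inverse (q i) = ennreal (rec (q i))"
    using assms(1) [of i] by (intro rec_le_one) auto
  ultimately have "0 < rec (q i)" by (metis ennreal_0 enn2real_nonneg less_eq_real_def)
  then show ?thesis by (intro sum_pos2 [of _ i]) auto
qed

text \<open>Truncations in height and to balls increase to z and have finite norm. So it suffices to
  treat finite norms, where a power of the norm can be divided out.\<close>

lemma Lnorm_truncate_bound:
  fixes z :: "real^'n \<Rightarrow> ennreal"
  assumes \<nu>: "0 < \<nu>" and [measurable]: "z \<in> lmeas"
    and bound: "\<And>y. y \<in> lmeas \<Longrightarrow> (\<And>x. y x \<le> z x) \<Longrightarrow>
      (\<integral>\<^sup>+x. ennpowr (y x) (1 / \<nu>) \<partial>lebesgue) \<noteq> top \<Longrightarrow> Lnorm lebesgue \<nu> y \<le> C"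
  shows "Lnorm lebesgue \<nu> z \<le> C"
proof -
  define S :: "nat \<Rightarrow> (real^'n) set" where "S k = cball 0 (real k)" for k
  have [measurable]: "S k \<in> sets lebesgue" for k by (simp add: S_def)
  define y where "y k x = min (z x) (of_nat k) * indicator (S k) x" for k x
  have [measurable]: "y k \<in> lmeas" for k
    unfolding y_def [abs_def] by measurable
  have yz: "y k x \<le> z x" for k x by (auto simp: y_def indicator_def)
  have inc: "y k x \<le> y l x" if "k \<le> l" for k l x
    using that by (auto simp: y_def S_def indicator_def intro: min.coboundedI2 order_trans)
  have sup: "(SUP k. y k x) = z x" for x
  proof (rule antisym)
    show "z x \<le> (SUP k. y k x)"
    proof (rule dense_le)
      fix t assume t: "t < z x"
      then have "t < top" by (rule less_le_trans) simp
      then obtain m where m: "t < of_nat m" using ennreal_Ex_less_of_nat by blast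
      obtain l :: nat where l: "norm x \<le> real l" using real_arch_simple by blast
      have "of_nat m \<le> (of_nat (max m l) :: ennreal)" by simp
      with t m have "t \<le> min (z x) (of_nat (max m l))" by (auto intro: order_trans less_imp_le)
      also have "\<dots> = y (max m l) x" using l by (simp add: y_def S_def le_max_iff_disj)
      finally show "t \<le> (SUP k. y k x)" by (rule order_trans) (auto intro: SUP_upper)
    qed
  qed (auto intro: SUP_least yz)
  have fin: "(\<integral>\<^sup>+x. ennpowr (y k x) (1 / \<nu>) \<partial>lebesgue) \<noteq> top" for k
  proof -
    have "(\<integral>\<^sup>+x. ennpowr (y k x) (1 / \<nu>) \<partial>lebesgue)
        \<le> (\<integral>\<^sup>+x. ennpowr (of_nat k) (1 / \<nu>) * indicator (S k) x \<partial>lebesgue)"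
      using \<nu> by (intro nn_integral_mono) (auto simp: y_def indicator_def intro: ennpowr_mono)
    also have "\<dots> = ennpowr (of_nat k) (1 / \<nu>) * emeasure lebesgue (S k)"
      by (rule nn_integral_cmult_indicator) simp
    also have "\<dots> < top"
      using emeasure_lborel_cball_finite [of "0 :: real^'n" "real k"]
      by (simp add: S_def ennreal_mult_eq_top_iff less_top [symmetric])
    finally show ?thesis by simp
  qed
  have "(\<integral>\<^sup>+x. ennpowr (z x) (1 / \<nu>) \<partial>lebesgue) = (\<integral>\<^sup>+x. (SUP k. ennpowr (y k x) (1 / \<nu>)) \<partial>lebesgue)"
    using \<nu> by (simp add: sup [symmetric] ennpowr_SUP)
  also have "\<dots> = (SUP k. \<integral>\<^sup>+x. ennpowr (y k x) (1 / \<nu>) \<partial>lebesgue)"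
    using \<nu> inc by (intro nn_integral_monotone_convergence_SUP) (auto simp: incseq_def le_fun_def intro: ennpowr_mono)
  finally have "Lnorm lebesgue \<nu> z = (SUP k. Lnorm lebesgue \<nu> (y k))"
    using \<nu> by (simp add: Lnorm_pos ennpowr_SUP)
  also have "\<dots> \<le> C" by (intro SUP_least bound yz fin) auto
  finally show ?thesis .
qed

text \<open>Let y \<le> g / V_None, with Z the integral of y^(1/S). A function of norm Z^(t - S),
  made from a power of y, is adjoined in the slot \<open>None\<close>, and all m + 1 functions are
  transferred together. For the new weights the p-estimate and Hoelder bound g times the adjoined
  function in L^(1/t), where its norm is at least Z^t. Dividing by Z^(t - S) leaves Z^S, the norm of
  y.\<close>

lemma tuple_extrapolation:
  fixes p q :: "'m::finite \<Rightarrow> ennreal"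
  assumes p: "\<And>i. 1 \<le> p i" and q: "\<And>i. 1 < q i" "0 < (\<Sum>i\<in>UNIV. inverse (q i))"
  obtains C K' where "C \<noteq> top"
    "\<forall>V (g :: real^'n \<Rightarrow> ennreal) f B. V \<in> mclass (exponents q) K \<longrightarrow>
      g \<in> lmeas \<longrightarrow> (\<forall>i. f i \<in> lmeas) \<longrightarrow>
      (\<forall>W\<in>mclass (exponents p) K'.
        wnorm (\<Sum>i\<in>UNIV. rec (p i)) g (\<lambda>x. 1 / W None x)
          \<le> B * (\<Prod>i\<in>UNIV. wnorm (rec (p i)) (f i) (W (Some i)))) \<longrightarrow>
      wnorm (\<Sum>i\<in>UNIV. rec (q i)) g (\<lambda>x. 1 / V None x)
          \<le> B * C * (\<Prod>i\<in>UNIV. wnorm (rec (q i)) (f i) (V (Some i)))"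
proof -
  define P where "P = (\<Sum>i\<in>UNIV. rec (p i))"
  define S where "S = (\<Sum>i\<in>UNIV. rec (q i))"
  have P: "0 \<le> P" and S: "0 < S"
    unfolding P_def S_def using rec_sum_pos [OF q] by (auto intro: sum_nonneg)
  \<comment> \<open>A value above both P and S, so that t - S and t - P are admissible norms for the
    adjoined function even if p or q is below 1. The sum of class and norm exponent is then t in the
    slot \<open>None\<close> and 1 in the others, before and after.\<close>
  define t where "t = P + S + 1"
  have t: "0 < t" "0 < t - S" "0 < t - P" using P S by (auto simp: t_def)
  define \<nu> where "\<nu> k = (case k of None \<Rightarrow> t - S | Some i \<Rightarrow> rec (q i))" for k
  define \<mu> where "\<mu> k = (case k of None \<Rightarrow> t - P | Some i \<Rightarrow> rec (p i))" for k
  have \<nu>: "\<nu> None = t - S" "\<nu> (Some i) = rec (q i)" and \<mu>: "\<mu> None = t - P" "\<mu> (Some i) = rec (p i)" for i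
    by (simp_all add: \<nu>_def \<mu>_def)
  have "transfer TYPE('n) (exponents q) \<nu> (exponents p) \<mu>"
  proof (rule transfer_all)
    fix k :: "'m option"
    show "exponents q k + \<nu> k = exponents p k + \<mu> k"
      by (cases k) (simp_all add: \<nu> \<mu> P_def S_def)
    show "0 < exponents q k \<or> exponents q k = exponents p k"
      using S rec_le_one(2) [OF q(1)] by (cases k) (simp_all add: S_def)
    show "0 \<le> exponents p k"
      using P rec_le_one(1) [OF p] by (cases k) (simp_all add: P_def)
    show "0 \<le> \<nu> k" "0 \<le> \<mu> k" using t by (cases k; simp add: \<nu> \<mu>)+
  next
    show "(\<Sum>k\<in>UNIV. exponents q k) = (\<Sum>k\<in>UNIV. exponents p k)"
      by (simp add: sum_UNIV_option sum_subtractf)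
  qed
  then obtain C K' where C: "C \<noteq> top" and tr:
    "\<And>V F. V \<in> (mclass (exponents q) K :: ('m option \<Rightarrow> real^'n \<Rightarrow> real) set) \<Longrightarrow> (\<And>k. F k \<in> lmeas) \<Longrightarrow>
      (\<exists>W \<in> mclass (exponents p) K'. wprod \<mu> F W
         \<le> C * wprod \<nu> F V)"
    unfolding transfer_def by meson
  show thesis
  proof (rule that [OF C, folded P_def S_def], intro allI impI)
    fix V :: "'m option \<Rightarrow> real^'n \<Rightarrow> real" and g :: "real^'n \<Rightarrow> ennreal"
      and f :: "'m \<Rightarrow> real^'n \<Rightarrow> ennreal" and B :: ennreal
    assume V: "V \<in> mclass (exponents q) K" and [measurable]: "g \<in> lmeas"
      and f: "\<forall>i. f i \<in> lmeas"
      and hyp: "\<forall>W\<in>mclass (exponents p) K'.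
        wnorm P g (\<lambda>x. 1 / W None x)
          \<le> B * (\<Prod>i\<in>UNIV. wnorm (rec (p i)) (f i) (W (Some i)))"
    have [measurable]: "f i \<in> lmeas" for i using f by blast
    have [measurable]: "V k \<in> lmeas" and Vpos: "0 < V k x" for k x
      using V by (auto simp: mclass_def)
    let ?R = "\<Prod>i\<in>UNIV. wnorm (rec (q i)) (f i) (V (Some i))"
    show "wnorm S g (\<lambda>x. 1 / V None x) \<le> B * C * ?R"
    proof (rule Lnorm_truncate_bound [OF S])
      fix y :: "real^'n \<Rightarrow> ennreal"
      assume [measurable]: "y \<in> lmeas"
        and yz: "\<And>x. y x \<le> g x * ennreal (1 / V None x)"
        and fin: "(\<integral>\<^sup>+x. ennpowr (y x) (1 / S) \<partial>lebesgue) \<noteq> top"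
      define Z where "Z = (\<integral>\<^sup>+x. ennpowr (y x) (1 / S) \<partial>lebesgue)"
      text \<open>The extremal function of the duality between \<open>L\<^sup>q\<close> and \<open>L\<^sup>t\<close>.\<close>
      define F where "F k x = (case k of None \<Rightarrow> ennreal (1 / V None x) * ennpowr (y x) ((t - S) / S) | Some i \<Rightarrow> f i x)" for k x
      have F: "F None x = ennreal (1 / V None x) * ennpowr (y x) ((t - S) / S)" "F (Some i) = f i" for i x
        by (auto simp: F_def)
      have Fm [measurable]: "F k \<in> lmeas" for k
        by (cases k) (simp_all add: F_def [abs_def])
      have FV: "wnorm (\<nu> None) (F None) (V None) = ennpowr Z (t - S)"
      proof -
        have "ennreal (1 / V None x) * ennreal (V None x) = 1" for x
          using Vpos [of None x] by (simp flip: ennreal_mult)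
        then have "F None x * ennreal (V None x) = ennpowr (y x) ((t - S) / S)" for x
          unfolding F by (metis mult.assoc mult.commute mult_1)
        then show ?thesis using t S by (simp add: \<nu> Lnorm_pos ennpowr_ennpowr Z_def)
      qed
      obtain W where W: "W \<in> mclass (exponents p) K'"
        and WF: "wprod \<mu> F W
          \<le> C * wprod \<nu> F V"
        using tr [OF V, of F] Fm by blast
      have [measurable]: "W k \<in> lmeas" and Wpos: "0 < W k x" for k x
        using W by (auto simp: mclass_def)
      let ?N = "wnorm (t - P) (F None) (W None)"
      have "ennpowr Z t = Lnorm lebesgue t (\<lambda>x. ennpowr (y x) (t / S))"
        using t S by (simp add: Lnorm_pos ennpowr_ennpowr Z_def)
      also have "\<dots> \<le> Lnorm lebesgue t (\<lambda>x. (g x * ennreal (1 / W None x)) * (F None x * ennreal (W None x)))"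
      proof (intro Lnorm_mono_AE AE_I2)
        fix x
        have "ennreal (1 / W None x) * ennreal (W None x) = 1"
          using Wpos [of None x] by (simp flip: ennreal_mult)
        then have eq: "(g x * ennreal (1 / W None x)) * (F None x * ennreal (W None x)) = g x * F None x"
          by (metis mult.assoc mult.commute mult_1)
        have "t / S = 1 + (t - S) / S" using S by (simp add: diff_divide_distrib)
        then have "ennpowr (y x) (t / S) = y x * ennpowr (y x) ((t - S) / S)"
          using ennpowr_add [of "y x" 1 "(t - S) / S"] by simp
        also have "\<dots> \<le> (g x * ennreal (1 / V None x)) * ennpowr (y x) ((t - S) / S)"
          by (intro mult_right_mono yz) auto
        finally show "ennpowr (y x) (t / S) \<le> (g x * ennreal (1 / W None x)) * (F None x * ennreal (W None x))"
          unfolding eq unfolding F by (simp only: mult.assoc)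
      qed (use t in auto)
      also have "\<dots> \<le> wnorm P g (\<lambda>x. 1 / W None x) * ?N"
        using Lnorm_Holder [of "\<lambda>x. g x * ennreal (1 / W None x)" lebesgue "\<lambda>x. F None x * ennreal (W None x)" P "t - P"] P t
        by simp
      also have "\<dots> \<le> (B * (\<Prod>i\<in>UNIV. wnorm (rec (p i)) (f i) (W (Some i)))) * ?N"
        by (intro mult_right_mono bspec [OF hyp W]) auto
      also have "\<dots> = B * wprod \<mu> F W"
        unfolding prod_UNIV_option \<mu> F(2) by (simp only: mult_ac)
      also have "\<dots> \<le> B * (C * wprod \<nu> F V)"
        by (intro mult_left_mono WF) auto
      also have "\<dots> = ennpowr Z (t - S) * (B * C * ?R)"
        unfolding prod_UNIV_option FV F(2) \<nu>(2) by (simp only: mult_ac)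
      finally have le: "ennpowr Z t \<le> ennpowr Z (t - S) * (B * C * ?R)" .
      have "Lnorm lebesgue S y = ennpowr Z S" using S by (simp add: Lnorm_pos Z_def)
      also have "\<dots> \<le> B * C * ?R"
      proof (cases "Z = 0")
        case False
        have "ennpowr Z t = ennpowr Z (t - S) * ennpowr Z S"
          using ennpowr_add [of Z "t - S" S] by simp
        then show ?thesis
          using le False fin by (simp add: ennreal_mult_le_mult_iff Z_def)
      qed simp
      finally show "Lnorm lebesgue S y \<le> B * C * ?R" .
    qed measurable
  qed
qed

text \<open>Only |T f| and the |f_i| enter the estimates, so the operator is replaced by an
  arbitrary pair of g and f. This freedom is what later admits \<ell>^s norms of sequences.\<close>

definition weighted_bound :: "('m::finite \<Rightarrow> ennreal) \<Rightarrow> (real \<Rightarrow> real) \<Rightarrow> (real^'n \<Rightarrow> ennreal)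
    \<Rightarrow> ('m \<Rightarrow> real^'n \<Rightarrow> ennreal) \<Rightarrow> bool" where
  "weighted_bound p \<phi> g f \<longleftrightarrow> (\<forall>w\<in>Ap_class p.
     Lp_ennnorm (harmonic_exponent p) (\<lambda>x. g x * ennreal (prod_weight w x))
       \<le> ennreal (\<phi> (enn2real (Ap_constant p w))) * (\<Prod>i\<in>UNIV. Lp_ennnorm (p i) (\<lambda>x. f i x * ennreal (w i x))))"

lemma extrapolation:
  fixes p q :: "'m::finite \<Rightarrow> ennreal"
  assumes p: "\<And>i. 1 \<le> p i" and q: "\<And>i. 1 < q i" "0 < (\<Sum>i\<in>UNIV. inverse (q i))" and \<phi>: "mono (\<phi> :: real \<Rightarrow> real)"
  obtains \<psi> :: "real \<Rightarrow> real" where "mono \<psi>"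
    "\<forall>(g :: real^'n \<Rightarrow> ennreal) f. g \<in> lmeas \<longrightarrow> (\<forall>i. f i \<in> lmeas) \<longrightarrow>
      weighted_bound p \<phi> g f \<longrightarrow> weighted_bound q \<psi> g f"
proof -
  have q1: "1 \<le> q i" for i using q(1) [of i] by simp
  have nz: "p i \<noteq> 0" "q i \<noteq> 0" for i using p [of i] q(1) [of i] by auto
  \<comment> \<open>Constants are first obtained for integer bounds n on the weight constant, with
    no monotonicity in n.\<close>
  define good where "good n C \<longleftrightarrow> (\<forall>(g :: real^'n \<Rightarrow> ennreal) f v. g \<in> lmeas \<longrightarrow> (\<forall>i. f i \<in> lmeas) \<longrightarrow>
      weighted_bound p \<phi> g f \<longrightarrow>
      v \<in> Ap_class q \<longrightarrow> Ap_constant q v \<le> ennreal (real n) \<longrightarrow>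
        Lp_ennnorm (harmonic_exponent q) (\<lambda>x. g x * ennreal (prod_weight v x))
          \<le> ennreal C * (\<Prod>i\<in>UNIV. Lp_ennnorm (q i) (\<lambda>x. f i x * ennreal (v i x))))" for n :: nat and C :: real
  have "\<exists>C\<ge>0. good n C" for n
  proof -
    obtain C K' where C: "C \<noteq> top" and tup:
      "\<forall>V (g :: real^'n \<Rightarrow> ennreal) f B. V \<in> mclass (exponents q) (real n) \<longrightarrow>
        g \<in> lmeas \<longrightarrow> (\<forall>i. f i \<in> lmeas) \<longrightarrow>
        (\<forall>W\<in>mclass (exponents p) K'.
          wnorm (\<Sum>i\<in>UNIV. rec (p i)) g (\<lambda>x. 1 / W None x)
            \<le> B * (\<Prod>i\<in>UNIV. wnorm (rec (p i)) (f i) (W (Some i)))) \<longrightarrow>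
        wnorm (\<Sum>i\<in>UNIV. rec (q i)) g (\<lambda>x. 1 / V None x)
            \<le> B * C * (\<Prod>i\<in>UNIV. wnorm (rec (q i)) (f i) (V (Some i)))"
      by (rule tuple_extrapolation [where p = p and q = q, OF p q])
    \<comment> \<open>For negative \<open>K'\<close> the class constant is 0, whence the
      maximum.\<close>
    define B where "B = ennreal (\<phi> (max 0 K'))"
    have BC: "ennreal (enn2real (B * C)) = B * C"
      using C by (simp add: B_def ennreal_mult_less_top less_top)
    have "good n (enn2real (B * C))"
      unfolding good_def BC
    proof (intro allI impI)
      fix g :: "real^'n \<Rightarrow> ennreal" and f :: "'m \<Rightarrow> real^'n \<Rightarrow> ennreal" and v :: "'m \<Rightarrow> real^'n \<Rightarrow> real"
      assume g [measurable]: "g \<in> lmeas" and f: "\<forall>i. f i \<in> lmeas"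
        and hyp: "weighted_bound p \<phi> g f"
        and v: "v \<in> Ap_class q" "Ap_constant q v \<le> ennreal (real n)"
      have [measurable]: "f i \<in> lmeas" "v i \<in> lmeas" for i
        using f v by (auto simp: Ap_class_def)
      have [measurable]: "prod_weight v \<in> lmeas"
        unfolding prod_weight_def [abs_def] by measurable
      obtain V where V: "V \<in> mclass (exponents q) (real n)" "\<And>i. AE x in lebesgue. v i x = V (Some i) x"
        "AE x in lebesgue. prod_weight v x = 1 / V None x"
        using Ap_class_to_mclass [OF q1 v] by blast
      have [measurable]: "V k \<in> lmeas" for k using V(1) by (auto simp: mclass_def)
      have 1: "Lp_ennnorm (harmonic_exponent q) (\<lambda>x. g x * ennreal (prod_weight v x))
        = wnorm (\<Sum>i\<in>UNIV. rec (q i)) g (\<lambda>x. 1 / V None x)"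
        unfolding Lp_ennnorm_eq_Lnorm [OF rec_harmonic_exponent(2) [OF q1]] rec_harmonic_exponent(1) [OF q1]
        by (rule Lnorm_cong_AE) (use V(3) in \<open>auto intro: sum_nonneg elim: eventually_mono\<close>)
      have 2: "Lp_ennnorm (q i) (\<lambda>x. f i x * ennreal (v i x)) = wnorm (rec (q i)) (f i) (V (Some i))" for i
        unfolding Lp_ennnorm_eq_Lnorm [OF nz(2)]
        by (rule Lnorm_cong_AE) (use V(2) [of i] in \<open>auto elim: eventually_mono\<close>)
      show "Lp_ennnorm (harmonic_exponent q) (\<lambda>x. g x * ennreal (prod_weight v x))
          \<le> B * C * (\<Prod>i\<in>UNIV. Lp_ennnorm (q i) (\<lambda>x. f i x * ennreal (v i x)))"
        unfolding 1 2
      proof (rule tup [rule_format, OF V(1) g])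
        fix W assume W: "W \<in> (mclass (exponents p) K' :: ('m option \<Rightarrow> real^'n \<Rightarrow> real) set)"
        note w = mclass_to_Ap_class [OF p W]
        have "wnorm (\<Sum>i\<in>UNIV. rec (p i)) g (\<lambda>x. 1 / W None x)
          = Lp_ennnorm (harmonic_exponent p) (\<lambda>x. g x * ennreal (prod_weight (\<lambda>i. W (Some i)) x))"
          unfolding Lp_ennnorm_eq_Lnorm [OF rec_harmonic_exponent(2) [OF p]] rec_harmonic_exponent(1) [OF p] w(3) ..
        also have "\<dots> \<le> ennreal (\<phi> (enn2real (Ap_constant p (\<lambda>i. W (Some i)))))
            * (\<Prod>i\<in>UNIV. Lp_ennnorm (p i) (\<lambda>x. f i x * ennreal (W (Some i) x)))"
          using hyp w(1) unfolding weighted_bound_def by blast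
        also have "\<dots> \<le> B * (\<Prod>i\<in>UNIV. Lp_ennnorm (p i) (\<lambda>x. f i x * ennreal (W (Some i) x)))"
        proof (intro mult_right_mono)
          have "enn2real (Ap_constant p (\<lambda>i. W (Some i))) \<le> enn2real (ennreal K')"
            using w(2) by (intro enn2real_mono) auto
          also have "\<dots> \<le> max 0 K'" by (cases "0 \<le> K'") (auto simp: ennreal_neg)
          finally show "ennreal (\<phi> (enn2real (Ap_constant p (\<lambda>i. W (Some i))))) \<le> B"
            unfolding B_def by (intro ennreal_leI monoD [OF \<phi>])
        qed auto
        finally show "wnorm (\<Sum>i\<in>UNIV. rec (p i)) g (\<lambda>x. 1 / W None x)
          \<le> B * (\<Prod>i\<in>UNIV. wnorm (rec (p i)) (f i) (W (Some i)))"
          unfolding Lp_ennnorm_eq_Lnorm [OF nz(1)] .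
      qed measurable
    qed
    then show ?thesis by (intro exI conjI) auto
  qed
  then obtain C where C0: "\<And>n. 0 \<le> C n" and C: "\<And>n. good n (C n)" by metis
  \<comment> \<open>Partial sums of the non-negative constants are non-decreasing and dominate the
    constant at n = \<lceil>x\<rceil>.\<close>
  define \<psi> where "\<psi> x = (\<Sum>k\<le>nat \<lceil>x\<rceil>. C k)" for x :: real
  have "mono \<psi>"
    unfolding mono_def \<psi>_def using C0 by (intro allI impI sum_mono2) (auto intro: order_trans [OF _ real_nat_ceiling_ge])
  moreover have "Lp_ennnorm (harmonic_exponent q) (\<lambda>x. g x * ennreal (prod_weight v x))
          \<le> ennreal (\<psi> (enn2real (Ap_constant q v))) * (\<Prod>i\<in>UNIV. Lp_ennnorm (q i) (\<lambda>x. f i x * ennreal (v i x)))"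
    if "g \<in> lmeas" "\<And>i. f i \<in> lmeas"
      "weighted_bound p \<phi> g f"
      and v: "v \<in> Ap_class q" for g :: "real^'n \<Rightarrow> ennreal" and f and v :: "'m \<Rightarrow> real^'n \<Rightarrow> real"
  proof -
    define n where "n = nat \<lceil>enn2real (Ap_constant q v)\<rceil>"
    have "Ap_constant q v = ennreal (enn2real (Ap_constant q v))"
      using v by (simp add: Ap_class_def)
    also have "\<dots> \<le> ennreal (real n)"
      unfolding n_def by (intro ennreal_leI real_nat_ceiling_ge)
    finally have "Lp_ennnorm (harmonic_exponent q) (\<lambda>x. g x * ennreal (prod_weight v x))
          \<le> ennreal (C n) * (\<Prod>i\<in>UNIV. Lp_ennnorm (q i) (\<lambda>x. f i x * ennreal (v i x)))"
      using C [of n] that unfolding good_def by blast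
    also have "\<dots> \<le> ennreal (\<psi> (enn2real (Ap_constant q v))) * (\<Prod>i\<in>UNIV. Lp_ennnorm (q i) (\<lambda>x. f i x * ennreal (v i x)))"
      unfolding \<psi>_def n_def using C0 by (intro mult_right_mono ennreal_leI member_le_sum) auto
    finally show ?thesis .
  qed
  ultimately show thesis
    by (intro that) (auto simp only: weighted_bound_def)
qed

section \<open>Sequences of functions\<close>

text \<open>Makes all \<ell>^s norms, \<ell>^\<infinity> included, instances of \<open>Lnorm\<close>
  for counting measure, so that Hoelder's inequality for series is already available.\<close>

lemma esssup_count_space: "esssup (count_space UNIV) a = (SUP j. a j)"
proof (rule antisym)
  show "esssup (count_space UNIV) a \<le> (SUP j. a j)"
    by (rule esssup_I) (auto simp: AE_count_space intro: SUP_upper)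
  have "AE j in count_space UNIV. a j \<le> esssup (count_space UNIV) a" by (rule esssup_AE)
  then show "(SUP j. a j) \<le> esssup (count_space UNIV) a"
    by (auto simp: AE_count_space intro: SUP_least)
qed

abbreviation seq_Lnorm :: "real \<Rightarrow> (nat \<Rightarrow> ennreal) \<Rightarrow> ennreal" where
  "seq_Lnorm \<nu> a \<equiv> Lnorm (count_space UNIV) \<nu> a"

lemma seq_Lnorm_eq:
  "seq_Lnorm \<nu> a = (if \<nu> = 0 then SUP j. a j else ennpowr (\<Sum>j. ennpowr (a j) (1 / \<nu>)) \<nu>)"
  by (simp add: Lnorm_def esssup_count_space nn_integral_count_space_nat)

lemma lseq_norm_eq: "s \<noteq> 0 \<Longrightarrow> lseq_norm s a = seq_Lnorm (rec s) (\<lambda>j. ennreal (cmod (a j)))"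
proof (cases s rule: ennreal_cases)
  case (real t)
  assume "s \<noteq> 0"
  then have "0 < t" using real by (auto simp: less_eq_real_def)
  then have "rec s = 1 / t" "s \<noteq> \<infinity>" "enn2real s = t" "1 / t \<noteq> 0" "1 / (1 / t) = t"
    using real by (simp_all add: inverse_ennreal inverse_eq_divide)
  then show ?thesis
    unfolding lseq_norm_def seq_Lnorm_eq by (simp only: if_False ennpowr_ennreal norm_ge_zero)
qed (simp add: lseq_norm_def seq_Lnorm_eq)

lemma seq_Lnorm_cmult: "0 \<le> \<nu> \<Longrightarrow> seq_Lnorm \<nu> (\<lambda>j. a j * c) = seq_Lnorm \<nu> a * c"
  by (simp add: seq_Lnorm_eq SUP_mult_right_ennreal ennpowr_mult ennpowr_ennpowr)

lemma seq_Lnorm_mono: "0 \<le> \<nu> \<Longrightarrow> (\<And>j. a j \<le> b j) \<Longrightarrow> seq_Lnorm \<nu> a \<le> seq_Lnorm \<nu> b"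
  by (intro Lnorm_mono_AE) auto

lemma borel_measurable_seq_Lnorm [measurable (raw)]:
  assumes [measurable]: "\<And>j. h j \<in> borel_measurable M"
  shows "(\<lambda>x. seq_Lnorm \<nu> (\<lambda>j. h j x)) \<in> borel_measurable M"
  unfolding seq_Lnorm_eq by (cases "\<nu> = 0") simp_all

text \<open>The inner and outer exponents agree, so this is the interchange of sum and
  integral.\<close>

lemma seq_Lnorm_swap:
  assumes [measurable]: "\<And>j. h j \<in> borel_measurable M" and \<nu>: "0 < \<nu>"
  shows "seq_Lnorm \<nu> (\<lambda>j. Lnorm M \<nu> (h j)) = Lnorm M \<nu> (\<lambda>x. seq_Lnorm \<nu> (\<lambda>j. h j x))"
  using \<nu> by (simp add: seq_Lnorm_eq Lnorm_pos ennpowr_ennpowr nn_integral_suminf)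

text \<open>This direction is what the functions f_i need, and there
  \<open>s i = \<infinity>\<close>, that is \<nu> = 0, can occur.\<close>

lemma seq_Lnorm_swap_le:
  assumes [measurable]: "\<And>j. h j \<in> borel_measurable M" and \<nu>: "0 \<le> \<nu>"
  shows "seq_Lnorm \<nu> (\<lambda>j. Lnorm M \<nu> (h j)) \<le> Lnorm M \<nu> (\<lambda>x. seq_Lnorm \<nu> (\<lambda>j. h j x))"
proof (cases "\<nu> = 0")
  case True
  have "Lnorm M 0 (h j) \<le> Lnorm M 0 (\<lambda>x. SUP j. h j x)" for j
    by (rule Lnorm_mono_AE) (auto intro!: AE_I2 SUP_upper)
  then show ?thesis using True by (auto simp: seq_Lnorm_eq intro: SUP_least)
qed (use \<nu> seq_Lnorm_swap [of h M \<nu>] in simp)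

lemma Lp_lseq_norm_weighted:
  assumes p: "p \<noteq> 0" "s \<noteq> 0" and [measurable]: "\<And>j. g j \<in> lmeas" "u \<in> lmeas"
    and u: "AE x in lebesgue. 0 < u x"
  shows "Lp_lseq_norm p s (\<lambda>j. weighted (g j) u)
    = Lp_ennnorm p (\<lambda>x. seq_Lnorm (rec s) (\<lambda>j. ennreal (cmod (g j x))) * ennreal (u x))"
  unfolding Lp_lseq_norm_def Lp_ennnorm_eq_Lnorm [OF p(1)] lseq_norm_eq [OF p(2)]
proof (rule Lnorm_cong_AE)
  show "AE x in lebesgue. seq_Lnorm (rec s) (\<lambda>j. ennreal (cmod (weighted (g j) u x)))
      = seq_Lnorm (rec s) (\<lambda>j. ennreal (cmod (g j x))) * ennreal (u x)"
    using u
  proof eventually_elim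
    case (elim x)
    have "ennreal (cmod (weighted (g j) u x)) = ennreal (cmod (g j x)) * ennreal (u x)" for j
      using elim by (simp add: weighted_def norm_mult ennreal_mult)
    then show ?case by (simp add: seq_Lnorm_cmult)
  qed
qed (simp_all add: weighted_def [abs_def])

lemma Lp_norm_weighted:
  assumes p: "p \<noteq> 0" and [measurable]: "g \<in> lmeas" "u \<in> lmeas"
    and u: "AE x in lebesgue. 0 < u x"
  shows "Lp_norm p (weighted g u) = Lp_ennnorm p (\<lambda>x. ennreal (cmod (g x)) * ennreal (u x))"
  unfolding Lp_norm_def Lp_ennnorm_eq_Lnorm [OF p(1)]
proof (rule Lnorm_cong_AE)
  show "AE x in lebesgue. ennreal (cmod (weighted g u x)) = ennreal (cmod (g x)) * ennreal (u x)"
    using u by eventually_elim (simp add: weighted_def norm_mult ennreal_mult)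
qed (auto simp: weighted_def [abs_def])

lemma Ap_class_weights:
  assumes "w \<in> Ap_class p"
  shows "w i \<in> lmeas" "AE x in lebesgue. 0 < w i x"
    "prod_weight w \<in> lmeas" "AE x in lebesgue. 0 < prod_weight w x"
proof -
  show meas [measurable]: "w i \<in> lmeas" and pos: "AE x in lebesgue. 0 < w i x" for i
    using assms by (auto simp: Ap_class_def)
  show "prod_weight w \<in> lmeas" unfolding prod_weight_def [abs_def] by measurable
  have "AE x in lebesgue. \<forall>i\<in>UNIV. 0 < w i x" by (rule AE_finite_allI) (use pos in auto)
  then show "AE x in lebesgue. 0 < prod_weight w x"
    by eventually_elim (simp add: prod_weight_def prod_pos)
qed

lemma weighted_bound_iff:
  fixes g :: "real^'n \<Rightarrow> complex"
  assumes p: "\<And>i. 1 \<le> p i" and meas: "g \<in> lmeas" "\<And>i. f i \<in> lmeas"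
  shows "weighted_bound p \<phi> (\<lambda>x. ennreal (cmod (g x))) (\<lambda>i x. ennreal (cmod (f i x))) \<longleftrightarrow>
    (\<forall>w\<in>Ap_class p. Lp_norm (harmonic_exponent p) (weighted g (prod_weight w))
       \<le> ennreal (\<phi> (enn2real (Ap_constant p w))) * (\<Prod>i\<in>UNIV. Lp_norm (p i) (weighted (f i) (w i))))"
proof -
  have nz: "p i \<noteq> 0" for i using p [of i] by auto
  show ?thesis
    unfolding weighted_bound_def
    by (intro ball_cong refl) (simp add: Lp_norm_weighted nz rec_harmonic_exponent(2) [OF p] Ap_class_weights meas)
qed

text \<open>Summing the scalar estimate with exponents \<open>s\<close> over the sequence, by Hoelder's inequality for series, gives
  the estimate for the tuple of \<open>\<ell>\<^sup>s\<close> norms; this tuple can then be extrapolated from \<open>s\<close> to \<open>q\<close>.\<close>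

lemma weighted_bound_seq:
  fixes g :: "nat \<Rightarrow> real^'n \<Rightarrow> ennreal" and f :: "nat \<Rightarrow> 'm::finite \<Rightarrow> real^'n \<Rightarrow> ennreal"
  assumes s: "\<And>i. 1 < s i" "0 < (\<Sum>i\<in>UNIV. inverse (s i))"
    and meas [measurable]: "\<And>j. g j \<in> lmeas" "\<And>j i. f j i \<in> lmeas"
    and bound: "\<And>j. weighted_bound s \<phi> (g j) (f j)"
  shows "weighted_bound s \<phi> (\<lambda>x. seq_Lnorm (rec (harmonic_exponent s)) (\<lambda>j. g j x))
    (\<lambda>i x. seq_Lnorm (rec (s i)) (\<lambda>j. f j i x))"
  unfolding weighted_bound_def
proof
  fix w assume w: "w \<in> (Ap_class s :: ('m \<Rightarrow> real^'n \<Rightarrow> real) set)"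
  note [measurable] = Ap_class_weights(1,3) [OF w]
  have s1: "1 \<le> s i" and nz: "s i \<noteq> 0" for i using s(1) [of i] by auto
  define \<sigma> where "\<sigma> = rec (harmonic_exponent s)"
  have \<sigma>: "\<sigma> = (\<Sum>i\<in>UNIV. rec (s i))" "0 < \<sigma>"
    unfolding \<sigma>_def rec_harmonic_exponent(1) [OF s1] using rec_sum_pos [OF s] by auto
  note L = Lp_ennnorm_eq_Lnorm [OF rec_harmonic_exponent(2) [OF s1], folded \<sigma>_def] Lp_ennnorm_eq_Lnorm [OF nz]
  define C where "C = ennreal (\<phi> (enn2real (Ap_constant s w)))"
  define N where "N i j = Lnorm lebesgue (rec (s i)) (\<lambda>x. f j i x * ennreal (w i x))" for i j
  have "Lnorm lebesgue \<sigma> (\<lambda>x. seq_Lnorm \<sigma> (\<lambda>j. g j x) * ennreal (prod_weight w x))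
      = Lnorm lebesgue \<sigma> (\<lambda>x. seq_Lnorm \<sigma> (\<lambda>j. g j x * ennreal (prod_weight w x)))"
    using \<sigma> by (simp add: seq_Lnorm_cmult)
  also have "\<dots> = seq_Lnorm \<sigma> (\<lambda>j. Lnorm lebesgue \<sigma> (\<lambda>x. g j x * ennreal (prod_weight w x)))"
    using \<sigma> by (intro seq_Lnorm_swap [symmetric]) auto
  also have "\<dots> \<le> seq_Lnorm \<sigma> (\<lambda>j. (\<Prod>i\<in>UNIV. N i j) * C)"
  proof (rule seq_Lnorm_mono)
    fix j
    show "Lnorm lebesgue \<sigma> (\<lambda>x. g j x * ennreal (prod_weight w x)) \<le> (\<Prod>i\<in>UNIV. N i j) * C"
      using bspec [OF bound [of j, unfolded weighted_bound_def] w]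
      unfolding L N_def C_def \<sigma>_def by (simp only: mult.commute)
  qed (use \<sigma> in simp)
  also have "\<dots> = seq_Lnorm \<sigma> (\<lambda>j. \<Prod>i\<in>UNIV. N i j) * C"
    using \<sigma> by (intro seq_Lnorm_cmult) auto
  \<comment> \<open>Hoelder's inequality for counting measure, with 1/s as the sum of the
    1/s_i.\<close>
  also have "\<dots> \<le> (\<Prod>i\<in>UNIV. seq_Lnorm (rec (s i)) (N i)) * C"
    unfolding \<sigma>(1) by (intro mult_right_mono Lnorm_Holder_prod) auto
  also have "\<dots> \<le> (\<Prod>i\<in>UNIV. Lnorm lebesgue (rec (s i)) (\<lambda>x. seq_Lnorm (rec (s i)) (\<lambda>j. f j i x) * ennreal (w i x))) * C"
  proof (intro mult_right_mono prod_mono_ennreal)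
    fix i
    have "seq_Lnorm (rec (s i)) (N i) \<le> Lnorm lebesgue (rec (s i)) (\<lambda>x. seq_Lnorm (rec (s i)) (\<lambda>j. f j i x * ennreal (w i x)))"
      unfolding N_def by (rule seq_Lnorm_swap_le) auto
    then show "seq_Lnorm (rec (s i)) (N i) \<le> Lnorm lebesgue (rec (s i)) (\<lambda>x. seq_Lnorm (rec (s i)) (\<lambda>j. f j i x) * ennreal (w i x))"
      by (simp add: seq_Lnorm_cmult)
  qed auto
  finally show "Lp_ennnorm (harmonic_exponent s) (\<lambda>x. seq_Lnorm (rec (harmonic_exponent s)) (\<lambda>j. g j x) * ennreal (prod_weight w x))
      \<le> ennreal (\<phi> (enn2real (Ap_constant s w)))
        * (\<Prod>i\<in>UNIV. Lp_ennnorm (s i) (\<lambda>x. seq_Lnorm (rec (s i)) (\<lambda>j. f j i x) * ennreal (w i x)))"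
    unfolding L \<sigma>_def [symmetric] C_def [symmetric] by (simp only: mult.commute)
qed

theorem theorem1p1:
  fixes T :: "('m::finite \<Rightarrow> real^'n \<Rightarrow> complex) \<Rightarrow> real^'n \<Rightarrow> complex"
    and F :: "('m \<Rightarrow> real^'n \<Rightarrow> complex) set"
    and p :: "'m \<Rightarrow> ennreal"
  assumes "2 \<le> CARD('m)"
    and "\<And>f i. f \<in> F \<Longrightarrow> f i \<in> borel_measurable lebesgue"
    and "\<And>f. f \<in> F \<Longrightarrow> T f \<in> borel_measurable lebesgue"
    and "\<And>i. 1 \<le> p i"
    and "\<exists>\<phi>::real \<Rightarrow> real. mono \<phi> \<and>
           (\<forall>w\<in>Ap_class p. \<forall>f\<in>F.
              Lp_norm (harmonic_exponent p) (weighted (T f) (prod_weight w))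
                \<le> ennreal (\<phi> (enn2real (Ap_constant p w)))
                   * (\<Prod>i\<in>UNIV. Lp_norm (p i) (weighted (f i) (w i))))"
  shows "(\<forall>q::'m \<Rightarrow> ennreal. (\<forall>i. 1 < q i) \<and> 0 < (\<Sum>i\<in>UNIV. inverse (q i)) \<longrightarrow>
            (\<exists>\<psi>::real \<Rightarrow> real. mono \<psi> \<and>
              (\<forall>v\<in>Ap_class q. \<forall>f\<in>F.
                 Lp_norm (harmonic_exponent q) (weighted (T f) (prod_weight v))
                   \<le> ennreal (\<psi> (enn2real (Ap_constant q v)))
                      * (\<Prod>i\<in>UNIV. Lp_norm (q i) (weighted (f i) (v i))))))
       \<and> (\<forall>q s::'m \<Rightarrow> ennreal.
            (\<forall>i. 1 < q i) \<and> 0 < (\<Sum>i\<in>UNIV. inverse (q i)) \<and>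
            (\<forall>i. 1 < s i) \<and> 0 < (\<Sum>i\<in>UNIV. inverse (s i)) \<longrightarrow>
            (\<exists>\<psi>::real \<Rightarrow> real. mono \<psi> \<and>
              (\<forall>v\<in>Ap_class q. \<forall>f::nat \<Rightarrow> 'm \<Rightarrow> real^'n \<Rightarrow> complex. (\<forall>j. f j \<in> F) \<longrightarrow>
                 Lp_lseq_norm (harmonic_exponent q) (harmonic_exponent s)
                     (\<lambda>j. weighted (T (f j)) (prod_weight v))
                   \<le> ennreal (\<psi> (enn2real (Ap_constant q v)))
                      * (\<Prod>i\<in>UNIV. Lp_lseq_norm (q i) (s i) (\<lambda>j. weighted (f j i) (v i))))))"
proof -
  obtain \<phi> :: "real \<Rightarrow> real" where \<phi>: "mono \<phi>"
    and hyp: "\<And>w f. w \<in> Ap_class p \<Longrightarrow> f \<in> F \<Longrightarrow>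
              Lp_norm (harmonic_exponent p) (weighted (T f) (prod_weight w))
                \<le> ennreal (\<phi> (enn2real (Ap_constant p w)))
                   * (\<Prod>i\<in>UNIV. Lp_norm (p i) (weighted (f i) (w i)))"
    using assms(5) by blast
  have start: "weighted_bound p \<phi> (\<lambda>x. ennreal (cmod (T f x))) (\<lambda>i x. ennreal (cmod (f i x)))" if "f \<in> F" for f
    using hyp [OF _ that] weighted_bound_iff [of p "T f" f, OF assms(4) assms(3) [OF that] assms(2) [OF that]] by blast
  \<comment> \<open>Stated for all admissible exponents because it is used twice: at q it is the
    first claim, at s it is the starting point of the second.\<close>
  have scalar: "\<exists>\<psi>. mono \<psi> \<and> (\<forall>f\<in>F. weighted_bound q \<psi> (\<lambda>x. ennreal (cmod (T f x))) (\<lambda>i x. ennreal (cmod (f i x))))"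
    if q: "\<And>i. 1 < q i" "0 < (\<Sum>i\<in>UNIV. inverse (q i))" for q :: "'m \<Rightarrow> ennreal"
  proof -
    obtain \<psi> :: "real \<Rightarrow> real" where \<psi>: "mono \<psi>" and ext:
      "\<forall>(g :: real^'n \<Rightarrow> ennreal) f. g \<in> lmeas \<longrightarrow> (\<forall>i. f i \<in> lmeas) \<longrightarrow>
        weighted_bound p \<phi> g f \<longrightarrow> weighted_bound q \<psi> g f"
      by (rule extrapolation [where p = p and q = q, OF assms(4) q \<phi>])
    have "weighted_bound q \<psi> (\<lambda>x. ennreal (cmod (T f x))) (\<lambda>i x. ennreal (cmod (f i x)))" if "f \<in> F" for f
    proof (rule ext [rule_format, OF _ _ start [OF that]])
      note [measurable] = assms(2,3) [OF that]
      show "(\<lambda>x. ennreal (cmod (T f x))) \<in> lmeas"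
        "(\<lambda>x. ennreal (cmod (f i x))) \<in> lmeas" for i by measurable
    qed
    with \<psi> show ?thesis by blast
  qed
  show ?thesis
  proof (intro conjI allI impI)
    fix q :: "'m \<Rightarrow> ennreal" assume "(\<forall>i. 1 < q i) \<and> 0 < (\<Sum>i\<in>UNIV. inverse (q i))"
    then have q: "\<And>i. 1 < q i" "0 < (\<Sum>i\<in>UNIV. inverse (q i))" by auto
    then have q1: "1 \<le> q i" for i using less_imp_le by blast
    obtain \<psi> where \<psi>: "mono \<psi>"
      "\<And>f. f \<in> F \<Longrightarrow> weighted_bound q \<psi> (\<lambda>x. ennreal (cmod (T f x))) (\<lambda>i x. ennreal (cmod (f i x)))"
      using scalar [OF q] by blast
    have "\<forall>v\<in>Ap_class q. Lp_norm (harmonic_exponent q) (weighted (T f) (prod_weight v))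
        \<le> ennreal (\<psi> (enn2real (Ap_constant q v))) * (\<Prod>i\<in>UNIV. Lp_norm (q i) (weighted (f i) (v i)))"
      if "f \<in> F" for f
      using \<psi>(2) [OF that] weighted_bound_iff [of q "T f" f \<psi>, OF q1 assms(3) [OF that] assms(2) [OF that]] by blast
    with \<psi>(1) show "\<exists>\<psi>::real \<Rightarrow> real. mono \<psi> \<and>
              (\<forall>v\<in>Ap_class q. \<forall>f\<in>F.
                 Lp_norm (harmonic_exponent q) (weighted (T f) (prod_weight v))
                   \<le> ennreal (\<psi> (enn2real (Ap_constant q v)))
                      * (\<Prod>i\<in>UNIV. Lp_norm (q i) (weighted (f i) (v i))))"
      by blast
  next
    fix q s :: "'m \<Rightarrow> ennreal"
    assume "(\<forall>i. 1 < q i) \<and> 0 < (\<Sum>i\<in>UNIV. inverse (q i)) \<and> (\<forall>i. 1 < s i) \<and> 0 < (\<Sum>i\<in>UNIV. inverse (s i))"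
    then have q: "\<And>i. 1 < q i" "0 < (\<Sum>i\<in>UNIV. inverse (q i))"
      and s: "\<And>i. 1 < s i" "0 < (\<Sum>i\<in>UNIV. inverse (s i))" by auto
    have q1: "1 \<le> q i" and s1: "1 \<le> s i" and nz: "q i \<noteq> 0" "s i \<noteq> 0" for i
      using q(1) [of i] s(1) [of i] by auto
    obtain \<psi> where \<psi>: "mono \<psi>"
      and bound: "\<And>f. f \<in> F \<Longrightarrow> weighted_bound s \<psi> (\<lambda>x. ennreal (cmod (T f x))) (\<lambda>i x. ennreal (cmod (f i x)))"
      using scalar [OF s] by blast
    \<comment> \<open>A second extrapolation, from s to q, with \<psi> in the role of \<phi>; it is
      applied to the sequence norms.\<close>
    obtain \<psi>' :: "real \<Rightarrow> real" where \<psi>': "mono \<psi>'" and ext: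
      "\<forall>(g :: real^'n \<Rightarrow> ennreal) f. g \<in> lmeas \<longrightarrow> (\<forall>i. f i \<in> lmeas) \<longrightarrow>
        weighted_bound s \<psi> g f \<longrightarrow> weighted_bound q \<psi>' g f"
      by (rule extrapolation [where p = s and q = q, OF s1 q \<psi>])
    have "Lp_lseq_norm (harmonic_exponent q) (harmonic_exponent s) (\<lambda>j. weighted (T (f j)) (prod_weight v))
                   \<le> ennreal (\<psi>' (enn2real (Ap_constant q v)))
                      * (\<Prod>i\<in>UNIV. Lp_lseq_norm (q i) (s i) (\<lambda>j. weighted (f j i) (v i)))"
      if v: "v \<in> Ap_class q" and f: "\<forall>j. f j \<in> F" for v and f :: "nat \<Rightarrow> 'm \<Rightarrow> real^'n \<Rightarrow> complex"
    proof -
      have meas [measurable]: "T (f j) \<in> lmeas" "f j i \<in> lmeas" for j i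
        using f assms(2,3) by auto
      have "weighted_bound q \<psi>' (\<lambda>x. seq_Lnorm (rec (harmonic_exponent s)) (\<lambda>j. ennreal (cmod (T (f j) x))))
        (\<lambda>i x. seq_Lnorm (rec (s i)) (\<lambda>j. ennreal (cmod (f j i x))))"
      proof (rule ext [rule_format])
        show "weighted_bound s \<psi> (\<lambda>x. seq_Lnorm (rec (harmonic_exponent s)) (\<lambda>j. ennreal (cmod (T (f j) x))))
          (\<lambda>i x. seq_Lnorm (rec (s i)) (\<lambda>j. ennreal (cmod (f j i x))))"
          by (rule weighted_bound_seq [OF s]) (use bound f in auto)
      qed (auto intro!: borel_measurable_seq_Lnorm)
      then show ?thesis
        using v by (simp add: weighted_bound_def Lp_lseq_norm_weighted nz rec_harmonic_exponent(2) q1 s1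
            Ap_class_weights [OF v] meas)
    qed
    then show "\<exists>\<psi>::real \<Rightarrow> real. mono \<psi> \<and>
              (\<forall>v\<in>Ap_class q. \<forall>f::nat \<Rightarrow> 'm \<Rightarrow> real^'n \<Rightarrow> complex. (\<forall>j. f j \<in> F) \<longrightarrow>
                 Lp_lseq_norm (harmonic_exponent q) (harmonic_exponent s)
                     (\<lambda>j. weighted (T (f j)) (prod_weight v))
                   \<le> ennreal (\<psi> (enn2real (Ap_constant q v)))
                      * (\<Prod>i\<in>UNIV. Lp_lseq_norm (q i) (s i) (\<lambda>j. weighted (f j i) (v i))))"
      using \<psi>' by blast
  qed
qed

end
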